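(* Let $p$ be a prime with $p\equiv 2\pmod 3$ and $t\ge1$ an integer with $(p,t)\ne(2,1)$. Put $q=p^{2t}$, $k=\frac{q-1}{3}$. Let $L$ be the Laplacian and $C$ the critical group of the graph $G(p,3,t)$. For an integer $j>0$ let $e_j$ be the multiplicity of $p^j$ as a $p$-elementary divisor of $C$, and let $e_0$ be the $p$-rank of $L$ (the rank of $L$ over $\mathbb{F}_p$). Let $e_{(a,b)}$ be the coefficient of $x^ay^b$ in the polynomial $C(2t)\in\mathbb{C}[x,y]$ defined recursively by $$C(2)=2P,\quad C(4)=2(P^2-2Q),\quad C(6)=6R+2(P^3-2QP)-2PQ,$$ $$C(2s)=P\,C(2s-2)-Q\,C(2s-4)+R\,C(2s-6)\quad\text{for } s>3,$$ where $$P=\left(\tfrac{p+1}{3}\right)^2(x^2y^2+x^2y+xy^2+x+y+1)+\left(\tfrac{p-2}{3}\right)^2 3xy,$$ $$Q=\left(\tfrac{p+1}{3}\right)^2 xy\,(x^2y^2+x^2y+xy^2+x+y+1)+\left(\tfrac{2p-1}{3}\right)^2 3x^2y^2,\qquad R=p^2x^3y^3.$$ Let $\delta_{2,p}$ be $1$ if $p=2$ and $0$ otherwise. Then: 1. $e_0=e_{2t+\delta_{2,p}}+2=\left(\frac{p+1}{3}\right)^{2t}(2^{t+1}-2)$. 2. $e_a=\sum_{a<b\le t}e_{(a,b)}$ for $0\le a<t$, and $e_a=e_{2t+\delta_{2,p}-a}$ for $0<a<t$. 3. $e_{t+\delta_{2,p}}=\left(k+2-\sum_{0\le j<t}e_j\right)+(1-\delta_{2,p})\left(2k-\sum_{0\le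 j<t}e_j\right)$. 4. $e_t=(1-\delta_{2,p})\left(k+2-\sum_{0\le j<t}e_j\right)+\left(2k-\sum_{0\le j<t}e_j\right)$. 5. $e_a=0$ for all other $a$.
   Context: Graph: let $K=\mathbb{F}_q$ with $q=p^{2t}$ and let $S$ be the unique subgroup of $K^\times$ of order $k=(q-1)/3$. The graph $G(p,3,t)$ has vertex set $K$, with $x,y\in K$ adjacent iff $x-y\in S$. It is an undirected $k$-regular graph; with $A$ its adjacency matrix, its Laplacian is $L=kI-A$. The critical group $C$ is the (finite) torsion subgroup of the cokernel $\mathbb{Z}^K/L\mathbb{Z}^K$. The multiplicity of $p^j$ ($j>0$) as a $p$-elementary divisor of $C$ is the number of summands $\mathbb{Z}/p^j\mathbb{Z}$ in a decomposition of the Sylow $p$-subgroup of $C$ into cyclic groups of prime power order. *)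

theory Defs
  imports
    "HOL-Analysis.Cartesian_Space"
    "HOL-Algebra.Product_Groups"
    "HOL-Computational_Algebra.Polynomial"
    "HOL-Computational_Algebra.Primes"
    "HOL-Number_Theory.Cong"
begin

definition units_group :: "'a::field monoid" where
  "units_group = \<lparr>carrier = UNIV - {0}, monoid.mult = (*), one = 1\<rparr>"

definition additive_group :: "'a::ab_group_add monoid" where
  "additive_group = \<lparr>carrier = UNIV, monoid.mult = (+), one = 0\<rparr>"

definition cayley_adj :: "'a::ab_group_add set \<Rightarrow> 'a \<Rightarrow> 'a \<Rightarrow> bool" where
  "cayley_adj S x y \<longleftrightarrow> x - y \<in> S"

definition adjacency_matrix :: "('v::finite \<Rightarrow> 'v \<Rightarrow> bool) \<Rightarrow> int^'v^'v" where
  "adjacency_matrix adj = (\<chi> x y. if adj x y then 1 else 0)"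

definition regular_laplacian :: "nat \<Rightarrow> ('v::finite \<Rightarrow> 'v \<Rightarrow> bool) \<Rightarrow> int^'v^'v" where
  "regular_laplacian k adj = mat (int k) - adjacency_matrix adj"

definition cokernel :: "int^'v^'v \<Rightarrow> (int^'v) set monoid" where
  "cokernel M = additive_group Mod range ((*v) M)"

definition torsion_group :: "('g, 'm) monoid_scheme \<Rightarrow> ('g, 'm) monoid_scheme" where
  "torsion_group G =
     G\<lparr>carrier := {x \<in> carrier G. \<exists>n::nat. n > 0 \<and> x [^]\<^bsub>G\<^esub> n = \<one>\<^bsub>G\<^esub>}\<rparr>"

definition critical_group :: "int^'v^'v \<Rightarrow> (int^'v) set monoid" where
  "critical_group M = torsion_group (cokernel M)"

text \<open>The type \<open>'f\<close> stands for the prime field; it is to be instantiated with a field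
  of cardinality \<open>p\<close>, over which the integer matrix is reduced.\<close>

definition p_rank :: "'f::field itself \<Rightarrow> int^'v^'v \<Rightarrow> nat" where
  "p_rank _ M = rank (map_matrix of_int M :: 'f^'v^'v)"

definition sylow_subgroup :: "nat \<Rightarrow> 'g set \<Rightarrow> ('g, 'm) monoid_scheme \<Rightarrow> bool" where
  "sylow_subgroup p H G \<longleftrightarrow> subgroup H G \<and> card H = p ^ multiplicity p (Coset.order G)"

text \<open>\<open>ns\<close> lists the exponents in a decomposition of a Sylow \<open>p\<close>-subgroup
  into nontrivial cyclic groups \<open>\<int>/p\<^sup>n\<int>\<close>.\<close>

definition elementary_divisor_exponents :: "nat \<Rightarrow> ('g, 'm) monoid_scheme \<Rightarrow> nat list \<Rightarrow> bool" where
  "elementary_divisor_exponents p G ns \<longleftrightarrow>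
     (\<forall>n \<in> set ns. n > 0) \<and>
     (\<exists>H. sylow_subgroup p H G \<and>
          G\<lparr>carrier := H\<rparr> \<cong> product_group {..<length ns} (\<lambda>i. integer_mod_group (p ^ (ns ! i))))"

definition elementary_divisor_multiplicity :: "nat \<Rightarrow> ('g, 'm) monoid_scheme \<Rightarrow> nat \<Rightarrow> nat" where
  "elementary_divisor_multiplicity p G j =
     (THE m. \<exists>ns. elementary_divisor_exponents p G ns \<and> m = count_list ns j)"

text \<open>\<open>\<complex>[x,y]\<close> is represented as \<open>\<complex>[y][x]\<close>: the outer variable is \<open>x\<close>,
  and constants are doubly embedded.\<close>

type_synonym bipoly = "complex poly poly"

definition bi_x :: bipoly where "bi_x = [:0, 1:]"
definition bi_y :: bipoly where "bi_y = [:[:0, 1:]:]"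

definition bi_const :: "complex \<Rightarrow> bipoly" where "bi_const c = [:[:c:]:]"

definition coeff_xy :: "bipoly \<Rightarrow> nat \<Rightarrow> nat \<Rightarrow> complex" where
  "coeff_xy F a b = coeff (coeff F a) b"

definition P_poly :: "nat \<Rightarrow> bipoly" where
  "P_poly p =
     bi_const (((of_nat p + 1) / 3)^2) * (bi_x^2 * bi_y^2 + bi_x^2 * bi_y + bi_x * bi_y^2 + bi_x + bi_y + 1) +
     bi_const (((of_nat p - 2) / 3)^2) * (3 * bi_x * bi_y)"

definition Q_poly :: "nat \<Rightarrow> bipoly" where
  "Q_poly p =
     bi_const (((of_nat p + 1) / 3)^2) * (bi_x * bi_y * (bi_x^2 * bi_y^2 + bi_x^2 * bi_y + bi_x * bi_y^2 + bi_x + bi_y + 1)) +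
     bi_const (((2 * of_nat p - 1) / 3)^2) * (3 * bi_x^2 * bi_y^2)"

definition R_poly :: "nat \<Rightarrow> bipoly" where
  "R_poly p = bi_const (of_nat p ^ 2) * (bi_x^3 * bi_y^3)"

text \<open>\<open>C_poly p s\<close> is the polynomial written \<open>C(2s)\<close>; it is defined for \<open>s \<ge> 1\<close>,
  and the value at \<open>0\<close> is a dummy that the recursion never reaches.\<close>

fun C_poly :: "nat \<Rightarrow> nat \<Rightarrow> bipoly" where
  "C_poly p s =
    (if s = 0 then 0
     else if s = 1 then 2 * P_poly p
     else if s = 2 then 2 * ((P_poly p)^2 - 2 * Q_poly p)
     else if s = 3 then
       6 * R_poly p + 2 * ((P_poly p)^3 - 2 * Q_poly p * P_poly p) - 2 * P_poly p * Q_poly p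
     else P_poly p * C_poly p (s - 1) - Q_poly p * C_poly p (s - 2) + R_poly p * C_poly p (s - 3))"

declare C_poly.simps [simp del]

end

theory Submission imports Defs "HOL-Algebra.FiniteProduct" "HOL-Analysis.Determinants"
begin

text \<open>Let \<open>R\<close> be a valuation ring in the complex numbers in which \<open>p\<close> generates the maximal ideal and
  whose residue field is \<open>K\<close>. The powers of the Teichmueller character of \<open>K\<close>, together with the
  constant and the delta function, form an \<open>R\<close>-basis of the functions on \<open>K\<close>. As \<open>S\<close> is the group of
  cubes, \<open>3 L\<close> maps the span of the characters with exponents \<open>j\<close>, \<open>j + k\<close>, \<open>j + 2 k\<close> into itself,
  with Jacobi sums as coefficients. So \<open>L\<close> is block diagonal with blocks of size 3, whose elementary
  divisors are read off from the valuations of \<open>J j k\<close> and \<open>J j (2 k)\<close>.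

  The valuation of \<open>J a b\<close> is the number of carries in the addition of \<open>a\<close> and \<open>b\<close> to base \<open>p\<close> modulo
  \<open>q - 1\<close>. This follows, without Gauss sums, from the cocycle relation of Jacobi sums, which makes the
  valuation a coboundary \<open>H (a + b) - H a - H b\<close>, from the invariance of Jacobi sums under Frobenius,
  which forces \<open>H a\<close> to be proportional to \<open>a\<close> minus its digit sum, and from \<open>(J k k)\<^sup>2 = q\<close>, which
  fixes the factor.

  The digits of \<open>k\<close> and \<open>2 k\<close> have period 2, so the numbers of exponents with given carries are
  coefficients of the trace of the \<open>t\<close>-th power of a 3 by 3 matrix. Up to sign, the coefficients of its
  characteristic polynomial are the polynomials \<open>P\<close>, \<open>Q\<close>, \<open>R\<close> of the theorem, and the Cayley--Hamilton
  relation is the recursion for \<open>C(2 s)\<close>.\<close>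

section \<open>Diagonal form of integer matrices\<close>

text \<open>For odd p, Gauss sums would bring in p-th roots of unity, in whose ring p ramifies; with
  roots of unity of order q - 1 alone, p stays a uniformizer and all valuations are integers. As p =
  2 mod 3, the number 3 is a unit of R, so writing the indicator of the cubes through the three
  cubic characters costs nothing, and Frobenius exchanges the two nontrivial ones. Hence J k k = J
  (2 k) (2 k); call it \<gamma>, which is p^t up to sign. On a generic block 3 L has only the
  eigenvalues \<gamma> (\<gamma> + 1) and \<gamma> (\<gamma> - 2). This is the origin of the
  symmetry between a and 2 t + \<delta> - a, where \<delta> is the valuation of \<gamma> - 2.

  The exponents divisible by k, the constant and the delta function form an exceptional part, which
  yields the summand 2 in e_0. Carries have to be counted only for a < t: the symmetry and the
  number k - 1 of generic blocks then give all other multiplicities.\<close>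

definition unimodular_equiv :: "int^'n^'n \<Rightarrow> int^'n^'n \<Rightarrow> bool" where
  "unimodular_equiv A B \<longleftrightarrow> (\<exists>U V. invertible U \<and> invertible V \<and> B = U ** A ** V)"

lemma unimodular_equiv_refl: "unimodular_equiv A A"
  unfolding unimodular_equiv_def
  by (rule exI[of _ "mat 1"], rule exI[of _ "mat 1"]) (auto simp: invertible_def intro!: exI[of _ "mat 1"])

lemma unimodular_equiv_trans:
  assumes "unimodular_equiv A B" "unimodular_equiv B C"
  shows "unimodular_equiv A C"
proof -
  from assms obtain U V U' V' where *: "invertible U" "invertible V" "B = U ** A ** V"
    "invertible U'" "invertible V'" "C = U' ** B ** V'" unfolding unimodular_equiv_def by blast
  then have "C = (U' ** U) ** A ** (V ** V')" by (simp add: matrix_mul_assoc)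
  moreover have "invertible (U' ** U)" "invertible (V ** V')" using * by (auto intro: invertible_mult)
  ultimately show ?thesis unfolding unimodular_equiv_def by blast
qed

lemma invertible_transpose_int:
  assumes "invertible (U :: int^'n^'n)" shows "invertible (transpose U)"
proof -
  from assms obtain U' where "U ** U' = mat 1" "U' ** U = mat 1" unfolding invertible_def by blast
  then have "transpose U' ** transpose U = mat 1" "transpose U ** transpose U' = mat 1"
    by (metis matrix_transpose_mul transpose_mat)+
  then show ?thesis unfolding invertible_def by blast
qed

lemma unimodular_equiv_transpose:
  assumes "unimodular_equiv A B" shows "unimodular_equiv (transpose A) (transpose B)"
proof -
  from assms obtain U V where *: "invertible U" "invertible V" "B = U ** A ** V"
    unfolding unimodular_equiv_def by blast
  then have "transpose B = transpose V ** transpose A ** transpose U"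
    by (simp add: matrix_transpose_mul matrix_mul_assoc)
  moreover have "invertible (transpose V)" "invertible (transpose U)"
    using * by (simp_all add: invertible_transpose_int)
  ultimately show ?thesis unfolding unimodular_equiv_def by blast
qed

definition col_op :: "'n \<Rightarrow> ('n \<Rightarrow> int) \<Rightarrow> int^'n^'n \<Rightarrow> int^'n^'n" where
  "col_op i f A = (\<chi> a b. A$a$b + f b * A$a$i)"

text \<open>The matrix \<open>E f\<close> is 1 plus a rank-one matrix whose only nonzero row is
  \<open>f\<close>, at position \<open>i\<close>. Since \<open>f i = 0\<close>, the square of the
  latter is zero, so changing the sign of \<open>f\<close> gives the inverse.\<close>

lemma unimodular_equiv_col_op:
  fixes A :: "int^'n^'n"
  assumes "f i = 0" shows "unimodular_equiv A (col_op i f A)"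
proof -
  define E where "E g = ((\<chi> a b. (if a = b then 1 else 0) + (if a = i then g b else 0)) :: int^'n^'n)"
    for g :: "'n \<Rightarrow> int"
  have mult: "M ** E g = (\<chi> a b. M$a$b + g b * M$a$i)" for M :: "int^'n^'n" and g
    unfolding E_def matrix_matrix_mult_def
    by (simp add: vec_eq_iff distrib_left sum.distrib if_distrib[of "\<lambda>x. _ * x"] mult.commute cong: if_cong)
  have inv: "E f ** E (\<lambda>x. - f x) = mat 1" "E (\<lambda>x. - f x) ** E f = mat 1"
    unfolding mult using assms by (auto simp: E_def vec_eq_iff mat_def)
  have "col_op i f A = mat 1 ** A ** E f" by (simp add: col_op_def mult)
  moreover have "invertible (E f)" using inv unfolding invertible_def by blast
  moreover have "invertible (mat 1 :: int^'n^'n)" unfolding invertible_def by (metis matrix_mul_lid)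
  ultimately show ?thesis unfolding unimodular_equiv_def by blast
qed

definition row_op :: "'n \<Rightarrow> ('n \<Rightarrow> int) \<Rightarrow> int^'n^'n \<Rightarrow> int^'n^'n" where
  "row_op i f A = (\<chi> a b. A$a$b + f a * A$i$b)"

lemma unimodular_equiv_row_op:
  assumes "f i = 0" shows "unimodular_equiv A (row_op i f A)"
proof -
  have "row_op i f A = transpose (col_op i f (transpose A))"
    by (simp add: row_op_def col_op_def transpose_def vec_eq_iff)
  then show ?thesis
    using unimodular_equiv_transpose[OF unimodular_equiv_col_op[where f = f and i = i and A = "transpose A", OF assms]]
    by (simp add: transpose_transpose)
qed

text \<open>The state of the elimination: rows and columns with an index in \<open>S\<close> are
  finished, the block outside \<open>S\<close> is arbitrary.\<close>

definition diag_on :: "'n set \<Rightarrow> int^'n^'n \<Rightarrow> bool" where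
  "diag_on S A \<longleftrightarrow> (\<forall>a b. a \<noteq> b \<longrightarrow> (a \<in> S \<or> b \<in> S) \<longrightarrow> A$a$b = 0)"

lemma diag_on_transpose: "diag_on S A \<Longrightarrow> diag_on S (transpose A)"
  by (auto simp: diag_on_def transpose_def)

lemma diag_on_col_op: "diag_on S A \<Longrightarrow> i \<notin> S \<Longrightarrow> (\<forall>b\<in>S. f b = 0) \<Longrightarrow> diag_on S (col_op i f A)"
  unfolding diag_on_def col_op_def by (auto, metis+)

lemma diag_on_row_op: "diag_on S A \<Longrightarrow> i \<notin> S \<Longrightarrow> (\<forall>b\<in>S. f b = 0) \<Longrightarrow> diag_on S (row_op i f A)"
  unfolding diag_on_def row_op_def by (auto, metis+)

text \<open>The pivot has to stay at position (i, i). Instead of exchanging columns, the remainder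
  \<open>r\<close> is created in column \<open>b\<close> and a multiple of column \<open>b\<close>
  is then added to column \<open>i\<close>.\<close>

lemma col_op_smaller_pivot:
  assumes A: "diag_on S A" "i \<notin> S" "A$i$i \<noteq> 0" and b: "b \<notin> S" "\<not> A$i$i dvd A$i$b"
  shows "\<exists>B. unimodular_equiv A B \<and> diag_on S B \<and> B$i$i \<noteq> 0 \<and> \<bar>B$i$i\<bar> < \<bar>A$i$i\<bar>"
proof -
  have bi: "b \<noteq> i" using b by auto
  define r where "r = A$i$b mod A$i$i"
  define B where "B = col_op i (\<lambda>x. if x = b then - (A$i$b div A$i$i) else 0) A"
  have r: "r \<noteq> 0" "\<bar>r\<bar> < \<bar>A$i$i\<bar>"
    using b A(3) unfolding r_def by (auto simp: dvd_eq_mod_eq_0 abs_mod_less)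
  have Bi: "B$i$i = A$i$i" "B$i$b = r"
    using bi unfolding B_def col_op_def r_def by (auto simp: minus_div_mult_eq_mod[symmetric])
  \<comment> \<open>If the pivot is \<open>r * e\<close>, then \<open>m = 1 - e\<close> turns it
    into \<open>r\<close>; otherwise it is replaced by its nonzero remainder modulo
    \<open>r\<close>.\<close>
  obtain m where m: "A$i$i + m * r \<noteq> 0" "\<bar>A$i$i + m * r\<bar> \<le> \<bar>r\<bar>"
  proof (cases "r dvd A$i$i")
    case True
    then obtain e where "A$i$i = r * e" by blast
    then show ?thesis using r by (intro that[of "1 - e"]) (auto simp: algebra_simps)
  next
    case False
    have "A$i$i + (- (A$i$i div r)) * r = A$i$i mod r" by (simp add: minus_div_mult_eq_mod[symmetric])
    then show ?thesis using False r
      by (intro that[of "- (A$i$i div r)"]) (auto simp: dvd_eq_mod_eq_0 less_imp_le[OF abs_mod_less])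
  qed
  define C where "C = col_op b (\<lambda>x. if x = i then m else 0) B"
  have "unimodular_equiv A B" unfolding B_def using bi by (intro unimodular_equiv_col_op) auto
  moreover have "unimodular_equiv B C" unfolding C_def using bi by (intro unimodular_equiv_col_op) auto
  moreover have "diag_on S B" unfolding B_def using A b by (intro diag_on_col_op) auto
  then have "diag_on S C" unfolding C_def using A b by (intro diag_on_col_op) auto
  moreover have "C$i$i = A$i$i + m * r" by (simp add: C_def col_op_def Bi)
  ultimately show ?thesis using m r unimodular_equiv_trans[of A B C]
    by (intro exI[of _ C]) auto
qed

lemma row_op_smaller_pivot:
  assumes A: "diag_on S A" "i \<notin> S" "A$i$i \<noteq> 0" and b: "b \<notin> S" "\<not> A$i$i dvd A$b$i"
  shows "\<exists>B. unimodular_equiv A B \<and> diag_on S B \<and> B$i$i \<noteq> 0 \<and> \<bar>B$i$i\<bar> < \<bar>A$i$i\<bar>"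
proof -
  have "\<exists>B. unimodular_equiv (transpose A) B \<and> diag_on S B \<and> B$i$i \<noteq> 0 \<and> \<bar>B$i$i\<bar> < \<bar>(transpose A)$i$i\<bar>"
    using A b by (intro col_op_smaller_pivot[where b = b]) (auto simp: diag_on_transpose, auto simp: transpose_def)
  then obtain B where "unimodular_equiv (transpose A) B" "diag_on S B" "B$i$i \<noteq> 0" "\<bar>B$i$i\<bar> < \<bar>A$i$i\<bar>"
    by (auto simp: transpose_def)
  moreover from this have "unimodular_equiv A (transpose B)" "diag_on S (transpose B)"
    using unimodular_equiv_transpose[of "transpose A" B] diag_on_transpose[of S B]
    by (simp_all add: transpose_transpose)
  ultimately show ?thesis by (intro exI[of _ "transpose B"]) (simp add: transpose_def)
qed

lemma ex_nonzero_pivot: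
  assumes A: "diag_on S A" "i \<notin> S" "a \<notin> S" "b \<notin> S" "A$a$b \<noteq> 0"
  shows "\<exists>B. unimodular_equiv A B \<and> diag_on S B \<and> B$i$i \<noteq> 0"
proof -
  have "\<exists>B. unimodular_equiv A B \<and> diag_on S B \<and> B$i$b \<noteq> 0"
  proof (cases "A$i$b = 0")
    case True
    then have "a \<noteq> i" using A by auto
    then have "unimodular_equiv A (row_op a (\<lambda>x. if x = i then 1 else 0) A)"
      by (intro unimodular_equiv_row_op) auto
    moreover have "diag_on S (row_op a (\<lambda>x. if x = i then 1 else 0) A)"
      using A by (intro diag_on_row_op) auto
    moreover have "(row_op a (\<lambda>x. if x = i then 1 else 0) A)$i$b \<noteq> 0"
      using A True by (simp add: row_op_def)
    ultimately show ?thesis by blast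
  qed (use A unimodular_equiv_refl in blast)
  then obtain B where B: "unimodular_equiv A B" "diag_on S B" "B$i$b \<noteq> 0" by blast
  show ?thesis
  proof (cases "B$i$i = 0")
    case True
    then have "b \<noteq> i" using B by auto
    have "unimodular_equiv B (col_op b (\<lambda>x. if x = i then 1 else 0) B)"
      using \<open>b \<noteq> i\<close> by (intro unimodular_equiv_col_op) auto
    moreover have "diag_on S (col_op b (\<lambda>x. if x = i then 1 else 0) B)"
      using A B by (intro diag_on_col_op) auto
    moreover have "(col_op b (\<lambda>x. if x = i then 1 else 0) B)$i$i \<noteq> 0"
      using B True by (simp add: col_op_def)
    ultimately show ?thesis using B(1) unimodular_equiv_trans by blast
  qed (use B in blast)
qed

text \<open>Among all equivalent matrices with a nonzero pivot at \<open>i\<close>, take one with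
  least absolute pivot. By the two reductions above this pivot divides its row and column, so both
  can be cleared. If no such matrix exists, the block outside \<open>S\<close> is zero
  already.\<close>

lemma diag_on_extend:
  assumes A: "diag_on S A" "i \<notin> S"
  shows "\<exists>B. unimodular_equiv A B \<and> diag_on (insert i S) B"
proof (cases "\<exists>B. unimodular_equiv A B \<and> diag_on S B \<and> B$i$i \<noteq> 0")
  case False
  then have "A$a$b = 0" if "a \<notin> S" "b \<notin> S" for a b
    using ex_nonzero_pivot[OF A that] by blast
  then have "diag_on (insert i S) A" using A unfolding diag_on_def by blast
  then show ?thesis using unimodular_equiv_refl by blast
next
  case True
  let ?P = "\<lambda>B. unimodular_equiv A B \<and> diag_on S B \<and> B$i$i \<noteq> 0"
  obtain B where B: "?P B" and least: "\<And>C. ?P C \<Longrightarrow> nat \<bar>B$i$i\<bar> \<le> nat \<bar>C$i$i\<bar>"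
    using ex_has_least_nat[of ?P _ "\<lambda>B. nat \<bar>B$i$i\<bar>"] True by blast
  have least': "\<not> \<bar>C$i$i\<bar> < \<bar>B$i$i\<bar>" if "unimodular_equiv B C" "diag_on S C" "C$i$i \<noteq> 0" for C
    using least[of C] that B unimodular_equiv_trans[of A B C] by auto
  have dv: "B$i$i dvd B$i$b" "B$i$i dvd B$b$i" if "b \<notin> S" for b
    using col_op_smaller_pivot[of S B i b] row_op_smaller_pivot[of S B i b] B A that least' by blast+
  define C where "C = col_op i (\<lambda>b. if b = i then 0 else - (B$i$b div B$i$i)) B"
  define D where "D = row_op i (\<lambda>b. if b = i then 0 else - (C$b$i div C$i$i)) C"
  have Biz: "B$i$b = 0" "B$b$i = 0" if "b \<in> S" for b using B that A unfolding diag_on_def by metis+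
  have C: "unimodular_equiv B C" "diag_on S C" unfolding C_def
    using B A Biz by (auto intro!: unimodular_equiv_col_op diag_on_col_op)
  have Ci: "C$b$i = B$b$i" for b by (simp add: C_def col_op_def)
  have Crow: "C$i$b = 0" if "b \<noteq> i" for b
    using dv(1)[of b] Biz[of b] that by (cases "b \<in> S") (auto simp: C_def col_op_def)
  have D: "unimodular_equiv C D" "diag_on S D" unfolding D_def
    using C A Biz by (auto intro!: unimodular_equiv_row_op diag_on_row_op simp: Ci)
  have "D$i$b = 0" if "b \<noteq> i" for b using Crow that by (simp add: D_def row_op_def)
  moreover have "D$b$i = 0" if "b \<noteq> i" for b
    using dv(2)[of b] Biz[of b] that by (cases "b \<in> S") (auto simp: D_def row_op_def Ci)
  ultimately have "diag_on (insert i S) D" using D(2) unfolding diag_on_def by auto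
  then show ?thesis using B C(1) D(1) unimodular_equiv_trans by blast
qed

text \<open>The entries \<open>d i\<close> are not ordered by divisibility: the multiplicities of
  powers of p can be read off from any diagonal form.\<close>

lemma int_matrix_diagonal_form:
  fixes L :: "int^'n^'n"
  obtains U V :: "int^'n^'n" and d where "invertible U" "invertible V" "U ** L ** V = (\<chi> i j. if i = j then d i else 0)"
proof -
  have "\<exists>B. unimodular_equiv L B \<and> diag_on S B" if "finite S" for S :: "'n set"
    using that
  proof induction
    case empty
    show ?case using unimodular_equiv_refl by (auto simp: diag_on_def)
  next
    case (insert i S)
    then show ?case using diag_on_extend unimodular_equiv_trans by meson
  qed
  from this[of UNIV] obtain B where B: "unimodular_equiv L B" "diag_on UNIV B" by auto
  then obtain U V where UV: "invertible U" "invertible V" "B = U ** L ** V"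
    unfolding unimodular_equiv_def by blast
  have "B = (\<chi> i j. if i = j then B$i$i else 0)" using B(2) by (auto simp: diag_on_def vec_eq_iff)
  with UV(3) have "U ** L ** V = (\<chi> i j. if i = j then B$i$i else 0)" by (rule trans[OF sym])
  from that[OF UV(1) UV(2) this] show ?thesis .
qed

section \<open>Elementary divisors of the critical group\<close>

lemma card_multiples_killed:
  assumes "prime p"
  shows "card {c \<in> {0..<int (p ^ n)}. int (p ^ n) dvd int (p ^ j) * c} = p ^ min n j"
proof (cases "n \<le> j")
  case True
  then have "int (p ^ n) dvd int (p ^ j) * c" for c by (simp add: le_imp_power_dvd)
  then have "{c \<in> {0..<int (p ^ n)}. int (p ^ n) dvd int (p ^ j) * c} = {0..<int (p ^ n)}" by blast
  then show ?thesis using True by (metis card_atLeastLessThan_int diff_zero min.absorb1 nat_int)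
next
  case False
  have p: "0 < p" using assms by (rule prime_gt_0_nat)
  have n: "p ^ n = p ^ j * p ^ (n - j)" using False by (simp flip: power_add)
  have "{c \<in> {0..<int (p ^ n)}. int (p ^ n) dvd int (p ^ j) * c} = (\<lambda>c. int (p ^ (n - j)) * c) ` {0..<int (p ^ j)}"
    (is "?A = ?B")
  proof
    show "?A \<subseteq> ?B"
    proof
      fix c assume c: "c \<in> ?A"
      then have "int (p ^ j) * int (p ^ (n - j)) dvd int (p ^ j) * c" unfolding n by simp
      then have "int (p ^ (n - j)) dvd c" using p by simp
      then obtain b where b: "c = int (p ^ (n - j)) * b" by blast
      have "0 \<le> int (p ^ (n - j)) * b" "int (p ^ (n - j)) * b < int (p ^ (n - j)) * int (p ^ j)"
        using c unfolding b n by (auto simp: mult.commute)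
      moreover have "0 < int (p ^ (n - j))" using p by simp
      ultimately have "b \<in> {0..<int (p ^ j)}"
        by (metis atLeastLessThan_iff mult_less_cancel_left_pos zero_le_mult_iff less_le_not_le)
      then show "c \<in> ?B" unfolding b by blast
    qed
    show "?B \<subseteq> ?A" using p unfolding n by (auto simp: mult.commute)
  qed
  moreover have "inj_on (\<lambda>c. int (p ^ (n - j)) * c) {0..<int (p ^ j)}" using p by (auto intro: inj_onI)
  ultimately have "card ?A = card {0..<int (p ^ j)}" by (simp only: card_image)
  also have "\<dots> = p ^ j" by (metis card_atLeastLessThan_int diff_zero nat_int)
  finally show ?thesis using False by (simp add: min_def)
qed

lemma pow_product_integer_mod_group:
  assumes "y \<in> carrier (product_group I (\<lambda>i. integer_mod_group (m i)))"
  shows "y [^]\<^bsub>product_group I (\<lambda>i. integer_mod_group (m i))\<^esub> (N::nat) = (\<lambda>i\<in>I. (int N * y i) mod int (m i))"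
proof (induction N)
  case (Suc N)
  have "((int N * y i) mod int (m i) + y i) mod int (m i) = (y i + int N * y i) mod int (m i)" for i
    by (metis add.commute mod_add_left_eq)
  then show ?case using Suc by (auto simp: fun_eq_iff algebra_simps)
qed (auto simp: fun_eq_iff)

text \<open>Torsion in a product is computed componentwise, and Z/p^n has p^(min n j) elements
  killed by p^j. The sums of \<open>min n j\<close> over the list, taken for all j, are isomorphism
  invariants that determine the multiplicities in the list.\<close>

lemma card_torsion_product_group:
  assumes p: "prime p"
  shows "card {y \<in> carrier (product_group {..<length ns} (\<lambda>i. integer_mod_group (p ^ (ns ! i)))).
      y [^]\<^bsub>product_group {..<length ns} (\<lambda>i. integer_mod_group (p ^ (ns ! i)))\<^esub> (p ^ j) =
      \<one>\<^bsub>product_group {..<length ns} (\<lambda>i. integer_mod_group (p ^ (ns ! i)))\<^esub>} = p ^ (\<Sum>n\<leftarrow>ns. min n j)"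
    (is "card ?A = _")
proof -
  let ?P = "product_group {..<length ns} (\<lambda>i. integer_mod_group (p ^ (ns ! i)))"
  have "?A = (\<Pi>\<^sub>E i\<in>{..<length ns}. {c \<in> {0..<int (p ^ (ns ! i))}. int (p ^ (ns ! i)) dvd int (p ^ j) * c})"
    (is "_ = ?B")
  proof -
    have e: "(y [^]\<^bsub>?P\<^esub> (p ^ j) = \<one>\<^bsub>?P\<^esub>) \<longleftrightarrow> (\<forall>i\<in>{..<length ns}. int (p ^ (ns ! i)) dvd int (p ^ j) * y i)"
      if "y \<in> carrier ?P" for y
      unfolding pow_product_integer_mod_group[OF that]
      by (auto simp: fun_eq_iff restrict_def dvd_eq_mod_eq_0)
    have c: "carrier ?P = (\<Pi>\<^sub>E i\<in>{..<length ns}. {0..<int (p ^ (ns ! i))})"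
      using p by (simp add: carrier_integer_mod_group prime_gt_0_nat)
    have "?A = {y \<in> carrier ?P. \<forall>i\<in>{..<length ns}. int (p ^ (ns ! i)) dvd int (p ^ j) * y i}"
      by (rule Collect_cong) (rule conj_cong[OF refl e])
    also have "\<dots> = ?B"
    proof -
      have "{y \<in> (\<Pi>\<^sub>E i\<in>{..<m}. A i). \<forall>i\<in>{..<m}. Q i (y i)} = (\<Pi>\<^sub>E i\<in>{..<m}. {c \<in> A i. Q i c})"
        for m and A :: "nat \<Rightarrow> int set" and Q
        unfolding set_eq_iff PiE_iff mem_Collect_eq ball_conj_distrib by (simp only: conj_ac simp_thms)
      then show ?thesis unfolding c .
    qed
    finally show ?thesis .
  qed
  then have "card ?A = card ?B" by (rule arg_cong)
  also have "\<dots> = (\<Prod>i<length ns. p ^ min (ns ! i) j)"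
    unfolding card_PiE[OF finite_lessThan] card_multiples_killed[OF p] ..
  also have "\<dots> = p ^ (\<Sum>i<length ns. min (ns ! i) j)" by (simp add: power_sum)
  also have "(\<Sum>i<length ns. min (ns ! i) j) = (\<Sum>n\<leftarrow>ns. min n j)"
    by (simp add: sum_list_sum_nth atLeast0LessThan)
  finally show ?thesis .
qed

text \<open>The index \<open>N\<close> of \<open>H\<close> is prime to p. The coset of
  \<open>x\<close> is killed by \<open>N\<close>, the order of the quotient, and by p^j, hence it is
  trivial.\<close>

lemma p_torsion_in_sylow_subgroup:
  assumes G: "comm_group G" "finite (carrier G)" and p: "prime p"
    and H: "sylow_subgroup p H G" and x: "x \<in> carrier G" "x [^]\<^bsub>G\<^esub> (p ^ j) = \<one>\<^bsub>G\<^esub>"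
  shows "x \<in> H"
proof -
  interpret comm_group G by (rule G)
  have sub: "subgroup H G" and cH: "card H = p ^ multiplicity p (Coset.order G)"
    using H by (auto simp: sylow_subgroup_def)
  interpret normal H G by (rule subgroup_imp_normal[OF sub])
  interpret Q: group "G Mod H" by (rule factorgroup_is_group)
  define N where "N = card (rcosets\<^bsub>G\<^esub> H)"
  have oG: "Coset.order G \<noteq> 0" using G(2) by (simp add: order_gt_0_iff_finite)
  have NG: "N * card H = Coset.order G" unfolding N_def by (rule lagrange[OF sub])
  have oQ: "Coset.order (G Mod H) = N" unfolding Coset.order_def by (simp add: FactGroup_def N_def)
  have "\<not> p dvd N"
  proof
    assume "p dvd N"
    then obtain M where "N = p * M" by blast
    then have "p ^ Suc (multiplicity p (Coset.order G)) dvd Coset.order G"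
      using NG cH by (metis dvd_triv_left mult.assoc mult.commute power_Suc)
    moreover have "\<not> is_unit p" using p not_prime_unit by blast
    ultimately show False using oG multiplicity_lessI by (metis less_irrefl power_dvd_iff_le_multiplicity Suc_n_not_le_n)
  qed
  then have "coprime p N" using p by (simp add: prime_imp_coprime)
  then have cop: "coprime N (p ^ j)" by (metis coprime_commute coprime_power_left_iff)
  have hx: "H #>\<^bsub>G\<^esub> x \<in> carrier (G Mod H)" using x by (auto simp: FactGroup_def RCOSETS_def)
  have "(H #>\<^bsub>G\<^esub> x) [^]\<^bsub>G Mod H\<^esub> n = H #>\<^bsub>G\<^esub> (x [^]\<^bsub>G\<^esub> n)" for n :: nat
  proof (induction n)
    case 0 then show ?case by (simp add: FactGroup_def coset_mult_one[OF subset])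
  next
    case (Suc n)
    then show ?case using x by (simp add: FactGroup_def rcos_sum)
  qed
  then have "(H #>\<^bsub>G\<^esub> x) [^]\<^bsub>G Mod H\<^esub> (p ^ j) = \<one>\<^bsub>G Mod H\<^esub>"
    by (simp add: x FactGroup_def coset_mult_one[OF subset])
  then have h1: "(H #>\<^bsub>G\<^esub> x) [^]\<^bsub>G Mod H\<^esub> (p ^ j * v) = \<one>\<^bsub>G Mod H\<^esub>" for v
    using Q.nat_pow_pow[OF hx, of "p ^ j" v] by (metis Q.nat_pow_one)
  have fQ: "finite (carrier (G Mod H))" unfolding FactGroup_def RCOSETS_def using G(2) by simp
  have "(H #>\<^bsub>G\<^esub> x) [^]\<^bsub>G Mod H\<^esub> N = \<one>\<^bsub>G Mod H\<^esub>"
    using comm_group.power_order_eq_one[OF abelian_FactGroup[OF sub] fQ hx] oQ by (simp add: Coset.order_def)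
  then have h2: "(H #>\<^bsub>G\<^esub> x) [^]\<^bsub>G Mod H\<^esub> (N * u) = \<one>\<^bsub>G Mod H\<^esub>" for u
    using Q.nat_pow_pow[OF hx, of N u] by (metis Q.nat_pow_one)
  have "N \<noteq> 0" using NG oG by (metis mult_0)
  then obtain u v where "N * u = p ^ j * v + 1" using bezout_nat[of N "p ^ j"] cop by auto
  then have "\<one>\<^bsub>G Mod H\<^esub> = (H #>\<^bsub>G\<^esub> x) [^]\<^bsub>G Mod H\<^esub> (p ^ j * v + 1)" using h2[of u] by simp
  also have "\<dots> = H #>\<^bsub>G\<^esub> x"
    using hx h1[of v] by (metis Q.nat_pow_Suc Suc_eq_plus1 Q.l_one)
  finally have "H #>\<^bsub>G\<^esub> x = \<one>\<^bsub>G Mod H\<^esub>" ..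
  then have "H #>\<^bsub>G\<^esub> x = H" by (simp add: FactGroup_def)
  then show ?thesis using x rcos_self[OF x(1) sub] by simp
qed

lemma card_p_torsion:
  assumes G: "comm_group G" "finite (carrier G)" and p: "prime p"
    and ns: "elementary_divisor_exponents p G ns"
  shows "card {x \<in> carrier G. x [^]\<^bsub>G\<^esub> (p ^ j) = \<one>\<^bsub>G\<^esub>} = p ^ (\<Sum>n\<leftarrow>ns. min n j)"
proof -
  interpret comm_group G by (rule G)
  let ?P = "product_group {..<length ns} (\<lambda>i. integer_mod_group (p ^ (ns ! i)))"
  obtain H where H: "sylow_subgroup p H G" "G\<lparr>carrier := H\<rparr> \<cong> ?P"
    using ns unfolding elementary_divisor_exponents_def by blast
  have sub: "subgroup H G" using H by (auto simp: sylow_subgroup_def)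
  have HG: "group (G\<lparr>carrier := H\<rparr>)" by (rule subgroup_imp_group[OF sub])
  have PG: "group ?P" by simp
  obtain h where h: "h \<in> iso (G\<lparr>carrier := H\<rparr>) ?P" using H unfolding is_iso_def by blast
  then have hom: "h \<in> hom (G\<lparr>carrier := H\<rparr>) ?P" and bij: "bij_betw h H (carrier ?P)"
    by (auto simp: iso_def)
  have pow: "h (x [^]\<^bsub>G\<^esub> n) = h x [^]\<^bsub>?P\<^esub> n" if "x \<in> H" for x and n :: nat
    using hom_nat_pow[OF hom _ HG PG] that nat_pow_consistent by simp
  have one: "h \<one>\<^bsub>G\<^esub> = \<one>\<^bsub>?P\<^esub>" using hom_one[OF hom HG PG] by simp
  have eqH: "{x \<in> carrier G. x [^]\<^bsub>G\<^esub> (p ^ j) = \<one>\<^bsub>G\<^esub>} = {x \<in> H. x [^]\<^bsub>G\<^esub> (p ^ j) = \<one>\<^bsub>G\<^esub>}"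
    using p_torsion_in_sylow_subgroup[OF G p H(1)] subgroup.subset[OF sub] by blast
  have bb: "bij_betw h {x \<in> H. x [^]\<^bsub>G\<^esub> (p ^ j) = \<one>\<^bsub>G\<^esub>} {y \<in> carrier ?P. y [^]\<^bsub>?P\<^esub> (p ^ j) = \<one>\<^bsub>?P\<^esub>}"
  proof (rule bij_betw_subset[OF bij])
    have ker: "x [^]\<^bsub>G\<^esub> (p ^ j) = \<one>\<^bsub>G\<^esub> \<longleftrightarrow> h x [^]\<^bsub>?P\<^esub> (p ^ j) = \<one>\<^bsub>?P\<^esub>" if "x \<in> H" for x
    proof -
      have "x [^]\<^bsub>G\<^esub> (p ^ j) \<in> H" "\<one>\<^bsub>G\<^esub> \<in> H" using that sub
        using monoid.nat_pow_closed[OF group.is_monoid[OF HG], of x "p ^ j"] nat_pow_consistent[of x "p ^ j" H]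
        by (auto simp: subgroup.one_closed)
      then have "h (x [^]\<^bsub>G\<^esub> (p ^ j)) = h \<one>\<^bsub>G\<^esub> \<longleftrightarrow> x [^]\<^bsub>G\<^esub> (p ^ j) = \<one>\<^bsub>G\<^esub>"
        by (rule inj_on_eq_iff[OF bij_betw_imp_inj_on[OF bij]])
      then show ?thesis unfolding pow[OF that] one by simp
    qed
    have im: "f ` {x \<in> A. P x} = {y \<in> f ` A. Q y}" if "\<And>x. x \<in> A \<Longrightarrow> P x \<longleftrightarrow> Q (f x)" for f A P Q
      using that by auto
    show "h ` {x \<in> H. x [^]\<^bsub>G\<^esub> (p ^ j) = \<one>\<^bsub>G\<^esub>} = {y \<in> carrier ?P. y [^]\<^bsub>?P\<^esub> (p ^ j) = \<one>\<^bsub>?P\<^esub>}"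
      unfolding bij_betw_imp_surj_on[OF bij, symmetric] by (rule im) (rule ker)
  qed auto
  have "card {x \<in> carrier G. x [^]\<^bsub>G\<^esub> (p ^ j) = \<one>\<^bsub>G\<^esub>} =
      card {y \<in> carrier ?P. y [^]\<^bsub>?P\<^esub> (p ^ j) = \<one>\<^bsub>?P\<^esub>}" unfolding eqH by (rule bij_betw_same_card[OF bb])
  also have "\<dots> = p ^ (\<Sum>n\<leftarrow>ns. min n j)" by (rule card_torsion_product_group[OF p])
  finally show ?thesis .
qed

text \<open>As a function of j > 0, \<open>min n j\<close> has second difference -1 at
  \<open>j = n\<close> and 0 elsewhere. The condition on \<open>j\<close> also keeps
  \<open>j - 1\<close> from being truncated.\<close>

lemma count_list_from_min_sums:
  fixes ns :: "nat list"
  assumes "j > 0"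
  shows "count_list ns j + (\<Sum>n\<leftarrow>ns. min n (j - 1)) + (\<Sum>n\<leftarrow>ns. min n (j + 1)) = 2 * (\<Sum>n\<leftarrow>ns. min n j)"
  using assms by (induction ns) auto

text \<open>Justifies the definite description: the torsion counts determine all sums of
  \<open>min n i\<close>, and these determine how often each positive exponent occurs.\<close>

lemma elementary_divisor_multiplicity_eqI:
  assumes G: "comm_group G" "finite (carrier G)" and p: "prime p"
    and ns: "elementary_divisor_exponents p G ns" and j: "j > 0"
  shows "elementary_divisor_multiplicity p G j = count_list ns j"
  unfolding elementary_divisor_multiplicity_def
proof (rule the_equality)
  show "\<exists>ns'. elementary_divisor_exponents p G ns' \<and> count_list ns j = count_list ns' j" using ns by blast
  fix m assume "\<exists>ns'. elementary_divisor_exponents p G ns' \<and> m = count_list ns' j"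
  then obtain ns' where ns': "elementary_divisor_exponents p G ns'" "m = count_list ns' j" by blast
  have "p ^ (\<Sum>n\<leftarrow>ns. min n i) = p ^ (\<Sum>n\<leftarrow>ns'. min n i)" for i
    using card_p_torsion[OF G p ns] card_p_torsion[OF G p ns'(1)] by simp
  then have "(\<Sum>n\<leftarrow>ns. min n i) = (\<Sum>n\<leftarrow>ns'. min n i)" for i
    using prime_gt_1_nat[OF p] by (metis power_inject_exp)
  then show "m = count_list ns j"
    using count_list_from_min_sums[OF j, of ns] count_list_from_min_sums[OF j, of ns'] ns'(2) by simp
qed

section \<open>The critical group as a sum of cyclic groups\<close>

lemma comm_group_additive_group: "comm_group (additive_group :: 'b::ab_group_add monoid)"
  by (rule comm_groupI) (auto simp: additive_group_def intro: exI[of _ "- _"] left_minus)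

lemma comm_group_torsion_group:
  assumes "comm_group G" shows "comm_group (torsion_group G)" "subgroup (carrier (torsion_group G)) G"
proof -
  interpret comm_group G by (rule assms)
  have "subgroup {x \<in> carrier G. \<exists>n::nat. n > 0 \<and> x [^]\<^bsub>G\<^esub> n = \<one>\<^bsub>G\<^esub>} G" (is "subgroup ?T G")
  proof (rule subgroupI)
    have "\<one>\<^bsub>G\<^esub> \<in> ?T" by (auto intro: exI[of _ 1])
    then show "?T \<noteq> {}" by blast
  next
    fix a assume "a \<in> ?T"
    then show "inv\<^bsub>G\<^esub> a \<in> ?T" by (auto simp: nat_pow_inv)
  next
    fix a b assume "a \<in> ?T" "b \<in> ?T"
    then obtain m n :: nat where *: "a \<in> carrier G" "b \<in> carrier G" "0 < m" "0 < n"
      "a [^]\<^bsub>G\<^esub> m = \<one>\<^bsub>G\<^esub>" "b [^]\<^bsub>G\<^esub> n = \<one>\<^bsub>G\<^esub>" by blast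
    have "a [^]\<^bsub>G\<^esub> (m * n) = \<one>\<^bsub>G\<^esub>" "b [^]\<^bsub>G\<^esub> (n * m) = \<one>\<^bsub>G\<^esub>"
      using * by (simp_all flip: nat_pow_pow)
    then have "(a \<otimes>\<^bsub>G\<^esub> b) [^]\<^bsub>G\<^esub> (m * n) = \<one>\<^bsub>G\<^esub>" using * by (simp add: nat_pow_distrib mult.commute)
    then show "a \<otimes>\<^bsub>G\<^esub> b \<in> ?T" using * by (auto intro!: exI[of _ "m * n"])
  qed auto
  then show sub: "subgroup (carrier (torsion_group G)) G" by (simp add: torsion_group_def)
  have "group (torsion_group G)"
    using subgroup_imp_group[OF sub] by (simp add: torsion_group_def)
  then show "comm_group (torsion_group G)"
    by (rule group.group_comm_groupI) (auto simp: torsion_group_def m_comm)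
qed

text \<open>\<open>K\<close> presents \<open>G\<close> as the quotient of a free abelian group by
  the relations \<open>d i\<close> times the i-th unit vector. Where \<open>d i = 0\<close>, the
  divisibility in \<open>K_eq\<close> says that the coordinates are equal, so these indices make up
  the free part.\<close>

locale diagonal_presentation =
  fixes G :: "('g, 'm) monoid_scheme" and K :: "int^'n \<Rightarrow> 'g" and d :: "'n \<Rightarrow> int"
  assumes G: "comm_group G"
    and carrier_K: "carrier G = range K"
    and K_add: "K (v + w) = K v \<otimes>\<^bsub>G\<^esub> K w"
    and K_eq: "K v = K w \<longleftrightarrow> (\<forall>i. d i dvd v$i - w$i)"
begin

sublocale comm_group G by (rule G)

lemma K_0: "K 0 = \<one>\<^bsub>G\<^esub>"
proof -
  have "K 0 \<otimes>\<^bsub>G\<^esub> K 0 = K 0" using K_add[of 0 0] by simp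
  moreover have "K 0 \<in> carrier G" using carrier_K by blast
  ultimately show ?thesis by (metis l_cancel_one')
qed

lemma K_pow: "K v [^]\<^bsub>G\<^esub> (m::nat) = K (int m *s v)"
proof (induction m)
  case (Suc m)
  have "int (Suc m) *s v = int m *s v + v" by (simp add: vec_eq_iff algebra_simps)
  then show ?case using Suc by (simp only: nat_pow_Suc K_add)
qed (simp add: K_0)

lemma K_torsion: "K v \<in> carrier (torsion_group G) \<longleftrightarrow> (\<forall>i. d i = 0 \<longrightarrow> v$i = 0)"
proof
  assume "K v \<in> carrier (torsion_group G)"
  then obtain m :: nat where "m > 0" "K v [^]\<^bsub>G\<^esub> m = \<one>\<^bsub>G\<^esub>" by (auto simp: torsion_group_def)
  then have "\<forall>i. d i dvd int m * v$i" unfolding K_pow K_0[symmetric] K_eq by simp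
  then show "\<forall>i. d i = 0 \<longrightarrow> v$i = 0" using \<open>m > 0\<close> by (metis dvd_0_left_iff mult_eq_0_iff of_nat_0_less_iff less_irrefl)
next
  assume v: "\<forall>i. d i = 0 \<longrightarrow> v$i = 0"
  define m where "m = (\<Prod>i | d i \<noteq> 0. nat \<bar>d i\<bar>)"
  have "m > 0" unfolding m_def by (intro prod_pos) auto
  have "d i dvd int m * v$i" for i
  proof (cases "d i = 0")
    case False
    then have "nat \<bar>d i\<bar> dvd m" unfolding m_def by (intro dvd_prodI) auto
    then have "int (nat \<bar>d i\<bar>) dvd int m" by (simp only: int_dvd_int_iff)
    then have "d i dvd int m" by simp
    then show ?thesis by simp
  qed (use v in simp)
  then have "K v [^]\<^bsub>G\<^esub> m = \<one>\<^bsub>G\<^esub>" unfolding K_pow K_0[symmetric] K_eq by simp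
  then show "K v \<in> carrier (torsion_group G)" using \<open>m > 0\<close> carrier_K by (auto simp: torsion_group_def)
qed

lemma bij_betw_torsion:
  "bij_betw (\<lambda>y. K (\<chi> i. if d i = 0 then 0 else y i))
     (\<Pi>\<^sub>E i\<in>{i. d i \<noteq> 0}. {0..<\<bar>d i\<bar>}) (carrier (torsion_group G))"
  unfolding bij_betw_def
proof
  show "inj_on (\<lambda>y. K (\<chi> i. if d i = 0 then 0 else y i)) (\<Pi>\<^sub>E i\<in>{i. d i \<noteq> 0}. {0..<\<bar>d i\<bar>})"
  proof (rule inj_onI)
    fix y z assume yz: "y \<in> (\<Pi>\<^sub>E i\<in>{i. d i \<noteq> 0}. {0..<\<bar>d i\<bar>})" "z \<in> (\<Pi>\<^sub>E i\<in>{i. d i \<noteq> 0}. {0..<\<bar>d i\<bar>})"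
      and K: "K (\<chi> i. if d i = 0 then 0 else y i) = K (\<chi> i. if d i = 0 then 0 else z i)"
    show "y = z"
    proof (rule PiE_ext[OF yz])
      fix i assume i: "i \<in> {i. d i \<noteq> 0}"
      then have "d i dvd y i - z i" using K unfolding K_eq by (auto dest!: spec[of _ i])
      moreover have "\<bar>y i - z i\<bar> < \<bar>d i\<bar>" using PiE_mem[OF yz(1) i] PiE_mem[OF yz(2) i] by auto
      ultimately show "y i = z i" using dvd_imp_le_int[of "y i - z i" "d i"] by fastforce
    qed
  qed
  show "(\<lambda>y. K (\<chi> i. if d i = 0 then 0 else y i)) ` (\<Pi>\<^sub>E i\<in>{i. d i \<noteq> 0}. {0..<\<bar>d i\<bar>}) = carrier (torsion_group G)"
  proof
    show "(\<lambda>y. K (\<chi> i. if d i = 0 then 0 else y i)) ` (\<Pi>\<^sub>E i\<in>{i. d i \<noteq> 0}. {0..<\<bar>d i\<bar>}) \<subseteq> carrier (torsion_group G)"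
      by (auto simp: K_torsion)
    show "carrier (torsion_group G) \<subseteq> (\<lambda>y. K (\<chi> i. if d i = 0 then 0 else y i)) ` (\<Pi>\<^sub>E i\<in>{i. d i \<noteq> 0}. {0..<\<bar>d i\<bar>})"
    proof
      fix x assume x: "x \<in> carrier (torsion_group G)"
      then obtain v where v: "x = K v" using carrier_K by (auto simp: torsion_group_def)
      then have v0: "d i = 0 \<Longrightarrow> v$i = 0" for i using x K_torsion by blast
      define y where "y = (\<lambda>i\<in>{i. d i \<noteq> 0}. v$i mod \<bar>d i\<bar>)"
      have "d i dvd v$i - v$i mod \<bar>d i\<bar>" for i by (metis abs_dvd_iff minus_mod_eq_mult_div dvd_triv_left)
      then have "x = K (\<chi> i. if d i = 0 then 0 else y i)" unfolding v K_eq by (simp add: y_def v0)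
      moreover have "y \<in> (\<Pi>\<^sub>E i\<in>{i. d i \<noteq> 0}. {0..<\<bar>d i\<bar>})" by (auto simp: y_def)
      ultimately show "x \<in> (\<lambda>y. K (\<chi> i. if d i = 0 then 0 else y i)) ` (\<Pi>\<^sub>E i\<in>{i. d i \<noteq> 0}. {0..<\<bar>d i\<bar>})" by blast
    qed
  qed
qed

lemma finite_torsion: "finite (carrier (torsion_group G))"
  using bij_betw_finite[OF bij_betw_torsion] by (simp add: finite_PiE)

lemma order_torsion: "Coset.order (torsion_group G) = (\<Prod>i | d i \<noteq> 0. nat \<bar>d i\<bar>)"
  unfolding Coset.order_def bij_betw_same_card[OF bij_betw_torsion, symmetric]
  by (simp add: card_PiE)

lemma multiplicity_order_torsion:
  assumes p: "prime p"
  shows "multiplicity p (Coset.order (torsion_group G)) = (\<Sum>i | d i \<noteq> 0. multiplicity (int p) (d i))"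
proof -
  have "multiplicity p (nat \<bar>x\<bar>) = multiplicity (int p) x" if "x \<noteq> 0" for x :: int
  proof -
    have dv: "p ^ k dvd nat \<bar>x\<bar> \<longleftrightarrow> int p ^ k dvd x" for k
      by (simp flip: int_dvd_int_iff)
    have "\<not> is_unit (int p)" using p not_prime_unit[of "int p"] by auto
    then have "\<not> int p ^ Suc (multiplicity (int p) x) dvd x"
      using multiplicity_geI[OF that, of "int p" "Suc (multiplicity (int p) x)"] by auto
    with multiplicity_dvd[of "int p" x] show ?thesis by (intro multiplicity_eqI) (simp_all only: dv simp_thms)
  qed
  then show ?thesis unfolding order_torsion using p
    by (subst prime_elem_multiplicity_prod_distrib) auto
qed

text \<open>The p-part of Z/d is generated by d / p^m, where m is the multiplicity of p in d. The
  map \<open>h\<close> sends the r-th generator of the product to this element in coordinate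
  \<open>l ! r\<close>; its image has the order of a Sylow subgroup.\<close>

lemma elementary_divisor_exponents_torsion:
  assumes p: "prime p"
    and l: "distinct l" "set l = {i. d i \<noteq> 0 \<and> int p dvd d i}"
  shows "elementary_divisor_exponents p (torsion_group G) (map (\<lambda>i. multiplicity (int p) (d i)) l)"
proof -
  let ?T = "torsion_group G"
  let ?m = "\<lambda>i. multiplicity (int p) (d i)"
  let ?P = "product_group {..<length l} (\<lambda>i. integer_mod_group (p ^ (map ?m l ! i)))"
  have p': "prime (int p)" using p by simp
  have nu: "\<not> is_unit (int p)" using p' not_prime_unit by blast
  have p0: "0 < p" using p by (rule prime_gt_0_nat)
  interpret T: comm_group ?T by (rule comm_group_torsion_group[OF G])
  have multT: "(\<otimes>\<^bsub>?T\<^esub>) = (\<otimes>\<^bsub>G\<^esub>)" by (simp add: torsion_group_def)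
  have bl: "bij_betw ((!) l) {..<length l} (set l)" using l(1) by (intro bij_betw_nth) auto
  define idx where "idx = inv_into {..<length l} ((!) l)"
  have idx: "idx i < length l" "l ! idx i = i" if "i \<in> set l" for i
    using that bl unfolding idx_def bij_betw_def by (metis inv_into_into lessThan_iff, metis f_inv_into_f)
  have idx_nth: "idx (l ! r) = r" if "r < length l" for r
    using that bl unfolding idx_def bij_betw_def by (simp add: inv_into_f_f)
  define w where "w y = (\<chi> i. if i \<in> set l then y (idx i) * (d i div int p ^ ?m i) else 0)" for y :: "nat \<Rightarrow> int"
  define h where "h y = K (w y)" for y
  have dsplit: "d i = int p ^ ?m i * (d i div int p ^ ?m i)" for i
    by (simp add: multiplicity_dvd)
  have dz: "d i div int p ^ ?m i \<noteq> 0" if "i \<in> set l" for i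
    using that l(2) dsplit[of i] by auto
  have heq: "h y = h z \<longleftrightarrow> (\<forall>r<length l. int p ^ ?m (l ! r) dvd y r - z r)" for y z
  proof -
    have "d i dvd w y $ i - w z $ i \<longleftrightarrow> int p ^ ?m i dvd y (idx i) - z (idx i)" if "i \<in> set l" for i
    proof -
      have "w y $ i - w z $ i = (y (idx i) - z (idx i)) * (d i div int p ^ ?m i)"
        using that by (simp add: w_def left_diff_distrib)
      then show ?thesis using dz[OF that] by (subst dsplit) simp
    qed
    moreover have "d i dvd w y $ i - w z $ i" if "i \<notin> set l" for i using that by (simp add: w_def)
    ultimately have "h y = h z \<longleftrightarrow> (\<forall>i\<in>set l. int p ^ ?m i dvd y (idx i) - z (idx i))"
      unfolding h_def K_eq by blast
    also have "\<dots> \<longleftrightarrow> (\<forall>r<length l. int p ^ ?m (l ! r) dvd y r - z r)"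
      unfolding all_set_conv_all_nth by (simp add: idx_nth)
    finally show ?thesis .
  qed
  have carP: "carrier ?P = (\<Pi>\<^sub>E r\<in>{..<length l}. {0..<int (p ^ ?m (l ! r))})"
    unfolding carrier_product_group by (rule PiE_cong) (use p0 in \<open>simp add: carrier_integer_mod_group\<close>)
  have hT: "h y \<in> carrier ?T" for y
    unfolding h_def K_torsion using l(2) by (simp add: w_def)
  have hhom: "h \<in> hom ?P ?T"
  proof (rule homI)
    fix y z
    have "h (y \<otimes>\<^bsub>?P\<^esub> z) = h (\<lambda>r. y r + z r)"
      unfolding heq by (auto simp: mod_eq_dvd_iff[symmetric])
    also have "\<dots> = h y \<otimes>\<^bsub>?T\<^esub> h z"
      unfolding h_def multT K_add[symmetric] by (rule arg_cong[of _ _ K]) (simp add: w_def vec_eq_iff distrib_right)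
    finally show "h (y \<otimes>\<^bsub>?P\<^esub> z) = h y \<otimes>\<^bsub>?T\<^esub> h z" .
  qed (rule hT)
  have hinj: "inj_on h (carrier ?P)"
  proof (rule inj_onI)
    fix y z assume yz: "y \<in> carrier ?P" "z \<in> carrier ?P" and "h y = h z"
    show "y = z"
    proof (rule PiE_ext[OF yz[unfolded carP]])
      fix r assume r: "r \<in> {..<length l}"
      then have "int p ^ ?m (l ! r) dvd y r - z r" using \<open>h y = h z\<close> heq by simp
      moreover have "\<bar>y r - z r\<bar> < int p ^ ?m (l ! r)"
        using PiE_mem[OF yz(1)[unfolded carP] r] PiE_mem[OF yz(2)[unfolded carP] r] by auto
      ultimately show "y r = z r" using dvd_imp_le_int[of "y r - z r" "int p ^ ?m (l ! r)"] by fastforce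
    qed
  qed
  let ?H = "h ` carrier ?P"
  interpret hh: group_hom ?P ?T h
    by (simp add: group_hom_def group_hom_axioms_def hhom T.is_group)
  have "subgroup ?H ?T" by (rule hh.img_is_subgroup)
  moreover have "card ?H = p ^ multiplicity p (Coset.order ?T)"
  proof -
    have "card ?H = card (carrier ?P)" by (rule card_image[OF hinj])
    also have "\<dots> = (\<Prod>r<length l. p ^ ?m (l ! r))" unfolding carP by (simp add: card_PiE nat_power_eq)
    also have "\<dots> = p ^ (\<Sum>r<length l. ?m (l ! r))" by (simp add: power_sum)
    also have "(\<Sum>r<length l. ?m (l ! r)) = (\<Sum>i\<in>set l. ?m i)" by (rule sum.reindex_bij_betw[OF bl])
    also have "\<dots> = (\<Sum>i | d i \<noteq> 0. ?m i)"
      unfolding l(2) by (rule sum.mono_neutral_left) (auto, metis not_dvd_imp_multiplicity_0 less_irrefl)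
    finally show ?thesis by (simp add: multiplicity_order_torsion[OF p])
  qed
  moreover have "?T\<lparr>carrier := ?H\<rparr> \<cong> ?P"
  proof -
    have "h \<in> iso ?P (?T\<lparr>carrier := ?H\<rparr>)"
      using hhom hinj by (auto simp: iso_def hom_def bij_betw_def)
    then have "?P \<cong> ?T\<lparr>carrier := ?H\<rparr>" unfolding is_iso_def by blast
    then show ?thesis by (rule group.iso_sym[OF hh.G.is_group])
  qed
  moreover have "n > 0" if "n \<in> set (map ?m l)" for n
    using that l(2) nu by (auto simp: prime_elem_multiplicity_eq_zero_iff multiplicity_eq_zero_iff intro!: gr0I)
  ultimately show ?thesis unfolding elementary_divisor_exponents_def sylow_subgroup_def length_map by blast
qed

lemma elementary_divisor_multiplicity_torsion:
  assumes p: "prime p" and j: "j > 0"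
  shows "elementary_divisor_multiplicity p (torsion_group G) j =
    card {i. d i \<noteq> 0 \<and> multiplicity (int p) (d i) = j}"
proof -
  obtain l where l: "set l = {i. d i \<noteq> 0 \<and> int p dvd d i}" "distinct l"
    using finite_distinct_list[of "{i. d i \<noteq> 0 \<and> int p dvd d i}"] by auto
  have "elementary_divisor_multiplicity p (torsion_group G) j = count_list (map (\<lambda>i. multiplicity (int p) (d i)) l) j"
    by (rule elementary_divisor_multiplicity_eqI[OF comm_group_torsion_group(1)[OF G] finite_torsion p
          elementary_divisor_exponents_torsion[OF p l(2,1)] j])
  also have "\<dots> = length (filter (\<lambda>i. multiplicity (int p) (d i) = j) l)"
    by (simp add: count_list_eq_length_filter filter_map o_def eq_commute)
  also have "\<dots> = card (set (filter (\<lambda>i. multiplicity (int p) (d i) = j) l))"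
    using l(2) by (simp only: distinct_card[OF distinct_filter])
  also have "set (filter (\<lambda>i. multiplicity (int p) (d i) = j) l) = {i. d i \<noteq> 0 \<and> multiplicity (int p) (d i) = j}"
  proof -
    have "int p dvd d i" if "multiplicity (int p) (d i) = j" for i
      using that j by (metis not_dvd_imp_multiplicity_0 less_irrefl)
    then show ?thesis unfolding set_filter l(1) by blast
  qed
  finally show ?thesis .
qed

end

text \<open>As \<open>V\<close> is invertible, \<open>U\<close> carries the image of
  \<open>L\<close> onto the image of the diagonal matrix, that is, onto the vectors whose i-th
  coordinate is divisible by \<open>d i\<close>.\<close>

lemma elementary_divisor_multiplicity_critical_group:
  fixes L U V :: "int^'n^'n"
  assumes p: "prime p" and j: "j > 0"
    and UV: "invertible U" "invertible V" "U ** L ** V = (\<chi> i j. if i = j then d i else 0)"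
  shows "elementary_divisor_multiplicity p (critical_group L) j =
    card {i. d i \<noteq> 0 \<and> multiplicity (int p) (d i) = j}"
proof -
  let ?A = "additive_group :: (int^'n) monoid"
  let ?H = "range ((*v) L)"
  interpret A: comm_group ?A by (rule comm_group_additive_group)
  obtain U' where U': "U ** U' = mat 1" "U' ** U = mat 1" using UV(1) unfolding invertible_def by blast
  obtain V' where V': "V ** V' = mat 1" "V' ** V = mat 1" using UV(2) unfolding invertible_def by blast
  have subH: "subgroup ?H ?A"
  proof (rule A.subgroupI)
    fix a assume "a \<in> ?H"
    then obtain z where z: "a = L *v z" by blast
    have "inv\<^bsub>?A\<^esub> a = L *v (- z)"
      by (rule A.inv_equality) (auto simp: additive_group_def z matrix_vector_mult_def vec_eq_iff sum_negf)
    then show "inv\<^bsub>?A\<^esub> a \<in> ?H" by blast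
  next
    fix a b assume "a \<in> ?H" "b \<in> ?H"
    then obtain z z' where "a = L *v z" "b = L *v z'" by blast
    then have "a \<otimes>\<^bsub>?A\<^esub> b = L *v (z + z')" by (simp add: additive_group_def matrix_vector_right_distrib)
    then show "a \<otimes>\<^bsub>?A\<^esub> b \<in> ?H" by blast
  qed (auto simp: additive_group_def)
  interpret H: normal ?H ?A by (rule A.subgroup_imp_normal[OF subH])
  define K where "K v = ?H #>\<^bsub>?A\<^esub> (U' *v v)" for v
  have U'U: "U' *v (U *v x) = x" "U *v (U' *v x) = x" for x
    by (simp_all add: matrix_vector_mul_assoc U')
  have rangeL: "x \<in> ?H \<longleftrightarrow> (\<forall>i. d i dvd (U *v x)$i)" for x
  proof -
    have D: "(\<chi> i j. if i = j then d i else 0) *v y = (\<chi> i. d i * y$i)" for y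
      by (simp add: vec_eq_iff matrix_vector_mult_def if_distrib[of "\<lambda>y. y * _"] cong: if_cong)
    have ULV: "U *v (L *v (V *v y)) = (\<chi> i. d i * y$i)" for y
      unfolding D[symmetric] UV(3)[symmetric] by (simp add: matrix_vector_mul_assoc matrix_mul_assoc)
    show ?thesis
    proof
      assume "x \<in> ?H"
      then obtain z where z: "x = L *v z" by blast
      have "z = V *v (V' *v z)" by (simp add: matrix_vector_mul_assoc V')
      then have "U *v x = (\<chi> i. d i * (V' *v z)$i)" using ULV z by metis
      then show "\<forall>i. d i dvd (U *v x)$i" by simp
    next
      assume "\<forall>i. d i dvd (U *v x)$i"
      then have "\<forall>i. \<exists>c. (U *v x)$i = d i * c" unfolding dvd_def .
      from choice[OF this] obtain c where c: "\<forall>i. (U *v x)$i = d i * c i" ..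
      have "U *v (L *v (V *v (\<chi> i. c i))) = U *v x" unfolding ULV by (simp add: vec_eq_iff c)
      then have "x = L *v (V *v (\<chi> i. c i))" by (metis U'U(1))
      then show "x \<in> ?H" by blast
    qed
  qed
  have cos: "?H #>\<^bsub>?A\<^esub> x = ?H #>\<^bsub>?A\<^esub> y \<longleftrightarrow> x - y \<in> ?H" for x y
  proof -
    have car: "z \<in> carrier ?A" for z by (simp add: additive_group_def)
    have "?H #>\<^bsub>?A\<^esub> y = ?H #>\<^bsub>?A\<^esub> x \<longleftrightarrow> x \<in> ?H #>\<^bsub>?A\<^esub> y"
      using A.repr_independence[OF _ car subH, of x y] A.rcos_self[OF car subH, of x] by auto
    also have "\<dots> \<longleftrightarrow> x - y \<in> ?H"
      unfolding r_coset_def additive_group_def by (auto simp: algebra_simps)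
    finally show ?thesis by auto
  qed
  have "diagonal_presentation (cokernel L) K d"
  proof (rule diagonal_presentation.intro)
    show "comm_group (cokernel L)" unfolding cokernel_def by (rule A.abelian_FactGroup[OF subH])
    show "carrier (cokernel L) = range K"
    proof -
      have "?H #>\<^bsub>?A\<^esub> x = K (U *v x)" for x by (simp add: K_def U'U)
      then show ?thesis unfolding cokernel_def FactGroup_def RCOSETS_def
        by (auto simp: additive_group_def K_def)
    qed
    fix v w
    show "K (v + w) = K v \<otimes>\<^bsub>cokernel L\<^esub> K w"
      using H.rcos_sum[of "U' *v v" "U' *v w"]
      by (simp add: K_def cokernel_def FactGroup_def additive_group_def matrix_vector_right_distrib)
    show "(K v = K w) = (\<forall>i. d i dvd v$i - w$i)"
      unfolding K_def cos rangeL by (simp add: matrix_vector_mult_diff_distrib U'U)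
  qed
  from diagonal_presentation.elementary_divisor_multiplicity_torsion[OF this p j]
  show ?thesis by (simp add: critical_group_def)
qed

section \<open>A valuation ring with residue field of order \<open>q\<close>\<close>

lemma finite_field_power_card_minus_1:
  fixes a :: "'a::{field,finite}"
  assumes "a \<noteq> 0" shows "a ^ (CARD('a) - 1) = 1"
proof -
  have "(\<Prod>x\<in>-{0}. x) = (\<Prod>x\<in>-{0}. a * x)"
    by (rule prod.reindex_bij_witness[of _ "\<lambda>x. a * x" "\<lambda>x. x / a"]) (use assms in auto)
  also have "\<dots> = a ^ card (-{0::'a}) * (\<Prod>x\<in>-{0}. x)"
    by (simp add: prod.distrib)
  finally have "a ^ card (-{0::'a}) = 1"
    using prod_zero_iff[of "-{0::'a}" "\<lambda>x. x"] by auto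
  then show ?thesis by (simp add: Compl_eq_Diff_UNIV card_Diff_singleton)
qed

lemma of_nat_CARD_eq_0: "of_nat CARD('a) = (0::'a::{field,finite})"
proof -
  have "(\<Sum>x\<in>UNIV. x) = (\<Sum>x\<in>UNIV. x + (1::'a))"
    by (rule sum.reindex_bij_witness[of _ "\<lambda>x. x + 1" "\<lambda>x. x - 1"]) auto
  then show ?thesis by (simp add: sum.distrib)
qed

lemma of_nat_prime_eq_0:
  assumes "CARD('a::{field,finite}) = p ^ m" shows "of_nat p = (0::'a)"
  using of_nat_CARD_eq_0[where 'a = 'a] by (simp add: assms)

lemma of_int_eq_0_iff_dvd:
  assumes p: "prime p" "of_nat p = (0::'a::field)"
  shows "of_int c = (0::'a) \<longleftrightarrow> int p dvd c"
proof
  show "of_int c = (0::'a)" if "int p dvd c"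
    using that p(2) by (metis dvdE mult_zero_left of_int_mult of_int_of_nat_eq)
  show "int p dvd c" if "of_int c = (0::'a)"
  proof (rule ccontr)
    assume "\<not> int p dvd c"
    then have "coprime c (int p)" using p(1) by (simp add: prime_imp_coprime prime_nat_int_transfer coprime_commute[of _ "int p"])
    then obtain u v where "u * c + v * int p = 1" by (metis bezout_int coprime_iff_gcd_eq_1)
    then have "of_int (u * c + v * int p) = (1::'a)" by simp
    then show False using that p(2) by simp
  qed
qed

text \<open>Evaluation is generic in the ring because the same integer polynomial is evaluated at a
  complex root of unity and at an element of the finite field; reduction at a prime above p is the
  passage from the first value to the second.\<close>

definition int_eval :: "'a::comm_ring_1 \<Rightarrow> int poly \<Rightarrow> 'a" where
  "int_eval x F = poly (map_poly of_int F) x"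

lemma int_eval_pCons [simp]: "int_eval x (pCons a F) = of_int a + x * int_eval x F"
  by (simp add: int_eval_def map_poly_pCons)

lemma int_eval_0 [simp]: "int_eval x 0 = 0" by (simp add: int_eval_def)

lemma int_eval_1 [simp]: "int_eval x 1 = 1" by (simp add: int_eval_def)

lemma int_eval_add [simp]: "int_eval x (F + G) = int_eval x F + int_eval x G"
  by (induction F G rule: poly_induct2) (simp_all add: algebra_simps)

lemma int_eval_smult [simp]: "int_eval x (smult c F) = of_int c * int_eval x F"
  by (induction F) (simp_all add: algebra_simps)

lemma int_eval_uminus [simp]: "int_eval x (- F) = - int_eval x F"
  using int_eval_smult[of x "-1" F] by simp

lemma int_eval_diff [simp]: "int_eval x (F - G) = int_eval x F - int_eval x G"
  using int_eval_add[of x F "- G"] by simp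

lemma int_eval_mult [simp]: "int_eval x (F * G) = int_eval x F * int_eval x G"
  by (induction F) (simp_all add: algebra_simps)

lemma int_eval_power [simp]: "int_eval x (F ^ n) = int_eval x F ^ n"
  by (induction n) simp_all

lemma int_eval_monom [simp]: "int_eval x (monom c n) = of_int c * x ^ n"
  by (induction n) (simp_all add: monom_0 monom_Suc)

lemma int_eval_altdef:
  assumes "degree F < n" shows "int_eval x F = (\<Sum>i<n. of_int (coeff F i) * x ^ i)"
proof -
  have "degree (map_poly of_int F :: 'a poly) \<le> degree F" by (rule map_poly_degree_leq)
  then have "int_eval x F = (\<Sum>i<n. coeff (map_poly of_int F) i * x ^ i)"
    unfolding int_eval_def poly_altdef using assms
    by (intro sum.mono_neutral_left) (auto intro!: le_degree)
  then show ?thesis by (simp add: coeff_map_poly)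
qed

lemma map_poly_of_int_mult:
  "map_poly of_int (F * G) = (map_poly of_int F * map_poly of_int G :: 'a::comm_ring_1 poly)"
proof (induction F)
  case (pCons a F)
  have add: "map_poly of_int (A + B) = (map_poly of_int A + map_poly of_int B :: 'a poly)" for A B
    by (rule poly_eqI) (simp add: coeff_map_poly)
  have sm: "map_poly of_int (smult c A) = (smult (of_int c) (map_poly of_int A) :: 'a poly)" for c A
    by (rule poly_eqI) (simp add: coeff_map_poly)
  show ?case using pCons by (simp add: add sm map_poly_pCons)
qed simp

lemma monic_int_poly_division:
  assumes "lead_coeff (m :: int poly) = 1"
  obtains Q R where "F = m * Q + R" "R = 0 \<or> degree R < degree m"
proof -
  obtain Q R where QR: "pseudo_divmod F m = (Q, R)" by force
  have "m \<noteq> 0" using assms by auto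
  from pseudo_divmod[OF this QR] show ?thesis using assms that by auto
qed

text \<open>Since \<open>I\<close> contains all multiples of p, it corresponds to an ideal of the
  principal ideal domain F_p[X]. A monic element of least degree lifts the generator: an element of
  smaller degree not divisible by p would yield a monic one of smaller degree.\<close>

lemma monic_generator_mod_prime:
  fixes I :: "int poly set"
  assumes p: "prime p"
    and add: "\<And>F G. F \<in> I \<Longrightarrow> G \<in> I \<Longrightarrow> F + G \<in> I"
    and mult: "\<And>F G. F \<in> I \<Longrightarrow> G * F \<in> I"
    and pI: "\<And>F. smult (int p) F \<in> I"
    and monic: "m0 \<in> I" "lead_coeff m0 = 1"
  obtains m where "m \<in> I" "lead_coeff m = 1" "\<And>F. F \<in> I \<Longrightarrow> \<exists>Q R. F = m * Q + smult (int p) R"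
proof -
  obtain m where m: "m \<in> I" "lead_coeff m = 1"
    and least: "\<And>F. F \<in> I \<Longrightarrow> lead_coeff F = 1 \<Longrightarrow> degree m \<le> degree F"
    using ex_has_least_nat[of "\<lambda>F. F \<in> I \<and> lead_coeff F = 1" m0 degree] monic by blast
  have diff: "F - G \<in> I" if "F \<in> I" "G \<in> I" for F G
    using add[OF that(1) mult[OF that(2), of "-1"]] by simp
  have pdiv: "[:int p:] dvd F" if "F \<in> I" "degree F < degree m" for F
  proof (rule ccontr)
    assume "\<not> [:int p:] dvd F"
    with that(1) have "\<exists>G. (G \<in> I \<and> \<not> [:int p:] dvd G) \<and>
        (\<forall>H. H \<in> I \<and> \<not> [:int p:] dvd H \<longrightarrow> degree G \<le> degree H)"
      by (intro ex_has_least_nat[of _ F]) simp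
    then obtain G where G: "G \<in> I" "\<not> [:int p:] dvd G"
      and leastG: "\<And>H. H \<in> I \<Longrightarrow> \<not> [:int p:] dvd H \<Longrightarrow> degree G \<le> degree H" by blast
    then have GF: "degree G \<le> degree F" using that \<open>\<not> [:int p:] dvd F\<close> by blast
    \<comment> \<open>Otherwise the leading term lies in \<open>I\<close>, and dropping it leaves a
      polynomial of smaller degree that is still not divisible by p.\<close>
    have "\<not> int p dvd lead_coeff G"
    proof
      assume "int p dvd lead_coeff G"
      then have pd: "[:int p:] dvd monom (lead_coeff G) (degree G)"
        by (simp add: const_poly_dvd_iff)
      then have "monom (lead_coeff G) (degree G) \<in> I" using pI by (auto elim!: dvdE)
      then have H: "G - monom (lead_coeff G) (degree G) \<in> I" using G diff by blast
      have nd: "\<not> [:int p:] dvd G - monom (lead_coeff G) (degree G)"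
        using pd G(2) by (metis diff_add_cancel dvd_add)
      have "degree G \<noteq> 0"
      proof
        assume "degree G = 0"
        then have "G = monom (lead_coeff G) (degree G)" by (metis degree_0_id monom_0)
        then show False using nd by simp
      qed
      then have "degree (G - monom (lead_coeff G) (degree G)) < degree G"
        by (intro degree_lessI) (auto simp: coeff_eq_0)
      then show False using leastG[OF H nd] by simp
    qed
    then have "coprime (lead_coeff G) (int p)" using p by (simp add: prime_imp_coprime prime_nat_int_transfer coprime_commute[of _ "int p"])
    then obtain u v where uv: "u * lead_coeff G + v * int p = 1" by (metis bezout_int coprime_iff_gcd_eq_1)
    \<comment> \<open>Bezout makes the leading coefficient 1; the added term lies in
      \<open>I\<close> as a multiple of p.\<close>
    define K where "K = [:u:] * G + smult (int p) (monom v (degree G))"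
    have "K \<in> I" unfolding K_def using mult[OF G(1)] pI add by blast
    moreover have c: "coeff K (degree G) = 1" using uv by (simp add: K_def mult.commute)
    moreover have "degree K \<le> degree G" unfolding K_def
      by (intro degree_add_le order.trans[OF degree_smult_le]) (auto simp: degree_monom_le)
    then have "degree K = degree G" using c by (metis le_antisym le_degree zero_neq_one)
    ultimately have "degree m \<le> degree G" using least[of K] by auto
    then show False using GF that by simp
  qed
  show ?thesis
  proof (rule that[OF m])
    fix F assume F: "F \<in> I"
    obtain Q R where QR: "F = m * Q + R" "R = 0 \<or> degree R < degree m"
      using monic_int_poly_division[OF m(2)] by metis
    have "R = F - Q * m" using QR by (simp add: mult.commute)
    then have "R \<in> I" using diff[OF F mult[OF m(1)]] by simp
    then have "[:int p:] dvd R" using pdiv QR by auto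
    then obtain R' where "R = [:int p:] * R'" by blast
    then have "F = m * Q + smult (int p) R'" using QR by simp
    then show "\<exists>Q R. F = m * Q + smult (int p) R" by blast
  qed
qed

lemma det_of_int:
  "det (\<chi> i j. of_int (A$i$j) :: 'a::comm_ring_1^'n^'n) = of_int (det (A :: int^'n^'n))"
  by (simp add: det_def)

text \<open>If p were invertible, every power of \<zeta> would be p times an integral combination of
  powers. The vector of powers would then lie in the kernel of an integer matrix congruent to 1
  modulo p, whose determinant would be both 0 and congruent to 1.\<close>

lemma prime_not_unit_in_cyclotomic_ring:
  fixes \<zeta> :: complex
  assumes p: "prime p" "of_nat p = (0::'a::{field,finite})"
    and n: "0 < n" "n \<le> CARD('a)" "\<zeta> ^ n = 1"
  shows "of_nat p * int_eval \<zeta> H \<noteq> 1"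
proof
  assume H: "of_nat p * int_eval \<zeta> H = 1"
  \<comment> \<open>The type \<open>'a\<close> serves as index set for the exponents below
    \<open>CARD('a)\<close>, since matrices are indexed by finite types.\<close>
  obtain \<phi> :: "'a \<Rightarrow> nat" where \<phi>: "bij_betw \<phi> UNIV {..<CARD('a)}"
    using ex_bij_betw_finite_nat[of "UNIV::'a set"] by (auto simp: atLeast0LessThan)
  have lc: "lead_coeff (monom 1 n - 1 :: int poly) = 1" "degree (monom 1 n - 1 :: int poly) = n"
  proof -
    show "degree (monom 1 n - 1 :: int poly) = n" 
      using n degree_add_eq_left[of "- 1 :: int poly" "monom 1 n"] by (simp add: degree_monom_eq)
    then show "lead_coeff (monom 1 n - 1 :: int poly) = 1" using n by simp
  qed
  have "\<exists>c. \<zeta> ^ i = of_nat p * (\<Sum>y\<in>UNIV. of_int (c y) * \<zeta> ^ \<phi> y)" for i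
  proof -
    obtain Q R where QR: "monom 1 i * H = (monom 1 n - 1) * Q + R" "R = 0 \<or> degree R < n"
      using monic_int_poly_division[OF lc(1)] lc(2) by metis
    then have dR: "degree R < CARD('a)" using n by auto
    have "\<zeta> ^ i * int_eval \<zeta> H = int_eval \<zeta> (monom 1 i * H)" by simp
    also have "\<dots> = int_eval \<zeta> R" unfolding QR using n by simp
    also have "\<dots> = (\<Sum>j<CARD('a). of_int (coeff R j) * \<zeta> ^ j)" by (rule int_eval_altdef[OF dR])
    also have "\<dots> = (\<Sum>y\<in>UNIV. of_int (coeff R (\<phi> y)) * \<zeta> ^ \<phi> y)"
      by (rule sum.reindex_bij_betw[OF \<phi>, symmetric])
    finally have "\<zeta> ^ i * (of_nat p * int_eval \<zeta> H) = of_nat p * (\<Sum>y\<in>UNIV. of_int (coeff R (\<phi> y)) * \<zeta> ^ \<phi> y)"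
      by (simp add: mult.left_commute)
    then show ?thesis unfolding H by (intro exI[of _ "\<lambda>y. coeff R (\<phi> y)"]) simp
  qed
  then obtain c where c: "\<And>i. \<zeta> ^ i = of_nat p * (\<Sum>y\<in>UNIV. of_int (c i y) * \<zeta> ^ \<phi> y)" by metis
  define M :: "((int, 'a) vec, 'a) vec" where "M = (\<chi> x y. (if x = y then 1 else 0) - int p * c (\<phi> x) y)"
  define v :: "(complex, 'a) vec" where "v = (\<chi> x. \<zeta> ^ \<phi> x)"
  have "(\<chi> i j. of_int (M$i$j)) *v v = 0"
  proof (subst vec_eq_iff, rule allI)
    fix x
    have "((\<chi> i j. of_int (M$i$j)) *v v) $ x = (\<Sum>y\<in>UNIV. (if x = y then \<zeta> ^ \<phi> y else 0) - of_nat p * (of_int (c (\<phi> x) y) * \<zeta> ^ \<phi> y))"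
      by (auto simp: matrix_vector_mult_def M_def v_def algebra_simps intro!: sum.cong)
    also have "\<dots> = 0" by (simp add: sum_subtractf sum_distrib_left[symmetric] c[symmetric])
    finally show "((\<chi> i j. of_int (M$i$j)) *v v) $ x = 0 $ x" by simp
  qed
  moreover have "v \<noteq> 0"
  proof
    assume "v = 0"
    then have "v $ x = 0" for x by simp
    then have "\<zeta> = 0" by (simp add: v_def)
    then show False using n by (simp add: power_0_left)
  qed
  ultimately have "\<not> invertible (\<chi> i j. of_int (M$i$j) :: ((complex, 'a) vec, 'a) vec)"
    unfolding invertible_left_inverse matrix_left_invertible_ker by blast
  then have "det M = 0" by (simp add: invertible_det_nz det_of_int)
  moreover have "(\<chi> i j. of_int (M$i$j)) = (mat 1 :: (('a, 'a) vec, 'a) vec)"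
    using p by (simp add: M_def mat_def vec_eq_iff)
  then have "of_int (det M) = (1::'a)" by (metis det_I det_of_int)
  ultimately show False by simp
qed

text \<open>The model is Z[\<zeta>], with \<zeta> of order q - 1, localized at a prime above p;
  \<open>\<nu>\<close> is the residue map, constrained on \<open>R\<close> only, and
  \<open>T\<close> its multiplicative section. \<open>R_inverse\<close> says that \<open>R\<close>
  is local, \<open>\<nu>_eq_0D\<close> that p generates its maximal ideal.\<close>

locale teichmueller_lift =
  fixes p :: nat and R :: "complex set" and \<nu> :: "complex \<Rightarrow> 'a::{field,finite}" and T :: "'a \<Rightarrow> complex"
  assumes prime_p: "prime p"
    and R_1: "1 \<in> R"
    and R_diff: "x \<in> R \<Longrightarrow> y \<in> R \<Longrightarrow> x - y \<in> R"
    and R_mult: "x \<in> R \<Longrightarrow> y \<in> R \<Longrightarrow> x * y \<in> R"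
    and \<nu>_1: "\<nu> 1 = 1"
    and \<nu>_diff: "x \<in> R \<Longrightarrow> y \<in> R \<Longrightarrow> \<nu> (x - y) = \<nu> x - \<nu> y"
    and \<nu>_mult: "x \<in> R \<Longrightarrow> y \<in> R \<Longrightarrow> \<nu> (x * y) = \<nu> x * \<nu> y"
    and \<nu>_p: "\<nu> (of_nat p) = 0"
    and \<nu>_eq_0D: "x \<in> R \<Longrightarrow> \<nu> x = 0 \<Longrightarrow> x / of_nat p \<in> R"
    and R_inverse: "x \<in> R \<Longrightarrow> \<nu> x \<noteq> 0 \<Longrightarrow> inverse x \<in> R"
    and T_R: "a \<noteq> 0 \<Longrightarrow> T a \<in> R"
    and \<nu>_T: "a \<noteq> 0 \<Longrightarrow> \<nu> (T a) = a"
    and T_mult: "a \<noteq> 0 \<Longrightarrow> b \<noteq> 0 \<Longrightarrow> T (a * b) = T a * T b"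
    and T_power: "a \<noteq> 0 \<Longrightarrow> T a ^ (CARD('a) - 1) = 1"

text \<open>The goal is a homomorphism from Z[\<zeta>] to K. Modulo p the polynomials vanishing at
  \<zeta> are generated by some \<open>m\<close> dividing X^n - 1, and \<open>m\<close> is not
  constant because p is no unit in Z[\<zeta>]. Any root of \<open>m\<close> in K is a suitable
  \<open>g\<close>.\<close>

lemma root_of_unity_reduction:
  fixes \<zeta> :: complex
  assumes p: "prime p" "of_nat p = (0::'a::{field,finite})"
    and \<zeta>: "\<zeta> ^ (CARD('a) - 1) = 1"
  shows "\<exists>g::'a. \<forall>F. int_eval \<zeta> F = 0 \<longrightarrow> int_eval g F = 0"
proof -
  define n where "n = CARD('a) - 1"
  have "card {0, 1::'a} \<le> CARD('a)" by (rule card_mono) auto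
  then have n: "0 < n" "n < CARD('a)" by (auto simp: n_def)
  define I where "I = {F + smult (int p) G | F G. int_eval \<zeta> F = 0}"
  have lc: "lead_coeff (monom 1 n - 1 :: int poly) = 1" "degree (monom 1 n - 1 :: int poly) = n"
  proof -
    show "degree (monom 1 n - 1 :: int poly) = n"
      using n degree_add_eq_left[of "- 1 :: int poly" "monom 1 n"] by (simp add: degree_monom_eq)
    then show "lead_coeff (monom 1 n - 1 :: int poly) = 1" using n by simp
  qed
  have I_add: "F + G \<in> I" if FG: "F \<in> I" "G \<in> I" for F G
  proof -
    obtain A B A' B' where "F = A + smult (int p) B" "G = A' + smult (int p) B'"
      "int_eval \<zeta> A = 0" "int_eval \<zeta> A' = 0" using FG unfolding I_def by blast
    then have "F + G = (A + A') + smult (int p) (B + B')" "int_eval \<zeta> (A + A') = 0"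
      by (simp_all add: smult_add_right)
    then show ?thesis unfolding I_def by blast
  qed
  have I_mult: "G * F \<in> I" if F: "F \<in> I" for F G
  proof -
    obtain A B where "F = A + smult (int p) B" "int_eval \<zeta> A = 0" using F unfolding I_def by blast
    then have "G * F = (G * A) + smult (int p) (G * B)" "int_eval \<zeta> (G * A) = 0"
      by (simp_all add: algebra_simps)
    then show ?thesis unfolding I_def by blast
  qed
  have I_p: "smult (int p) F \<in> I" for F
    unfolding I_def by (rule CollectI, rule exI[of _ 0], rule exI[of _ F]) simp
  have I_0: "F \<in> I" if "int_eval \<zeta> F = 0" for F
    unfolding I_def using that by (intro CollectI exI[of _ F] exI[of _ 0]) simp
  have "monom 1 n - 1 \<in> I" using \<zeta> by (intro I_0) (simp add: n_def)
  then obtain m where m: "m \<in> I" "lead_coeff m = 1" "\<And>F. F \<in> I \<Longrightarrow> \<exists>Q S. F = m * Q + smult (int p) S"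
    using monic_generator_mod_prime[of p I "monom 1 n - 1"] p(1) I_add I_mult I_p lc(1) by blast
  have dm: "degree m > 0"
  proof (rule ccontr)
    assume "\<not> 0 < degree m"
    then have "m = [:lead_coeff m:]" by (metis degree_eq_zeroE gr0I lead_coeff_pCons(2) pCons_0_0)
    then have "m = 1" using m(2) by (simp add: one_pCons)
    then obtain F G where "1 = F + smult (int p) G" "int_eval \<zeta> F = 0" using m(1) unfolding I_def by blast
    then have "of_nat p * int_eval \<zeta> G = 1" by (metis add_0 int_eval_1 int_eval_add int_eval_smult of_int_of_nat_eq)
    then show False using prime_not_unit_in_cyclotomic_ring[OF p, of n \<zeta>] n \<zeta> by (simp add: n_def)
  qed
  \<comment> \<open>All n nonzero elements of K are roots of X^n - 1. If none were a root of
    \<open>m\<close>, the cofactor \<open>Q\<close> would have n roots but degree less than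
    n.\<close>
  have "\<exists>g::'a. int_eval g m = 0"
  proof (rule ccontr)
    assume no: "\<not> (\<exists>g::'a. int_eval g m = 0)"
    obtain Q S where QS: "monom 1 n - 1 = m * Q + smult (int p) S"
      using m(3)[OF \<open>monom 1 n - 1 \<in> I\<close>] by blast
    have Q0: "int_eval a Q = 0" if "a \<noteq> 0" for a :: 'a
    proof -
      have "int_eval a (monom 1 n - 1) = int_eval a m * int_eval a Q" unfolding QS using p by simp
      then show ?thesis using no finite_field_power_card_minus_1[OF that] by (simp add: n_def)
    qed
    define h where "h = (map_poly of_int Q :: 'a poly)"
    define f where "f = (map_poly of_int m :: 'a poly)"
    have fh: "f * h = monom 1 n - 1"
    proof -
      have "m * Q = (monom 1 n - 1) - smult (int p) S" unfolding QS by simp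
      then have "f * h = map_poly of_int ((monom 1 n - 1) - smult (int p) S)"
        unfolding f_def h_def map_poly_of_int_mult[symmetric] by simp
      also have "\<dots> = monom 1 n - 1" by (rule poly_eqI) (simp add: coeff_map_poly p)
      finally show ?thesis .
    qed
    have deg: "degree (monom 1 n - 1 :: 'a poly) = n"
      using n degree_add_eq_left[of "- 1 :: 'a poly" "monom 1 n"] by (simp add: degree_monom_eq)
    then have nz: "f \<noteq> 0" "h \<noteq> 0" using fh n by auto
    have "coeff f (degree m) = 1" using m(2) by (simp add: f_def coeff_map_poly)
    then have "degree m \<le> degree f" by (metis le_degree zero_neq_one)
    then have "degree h < n" using deg fh nz degree_mult_eq[of f h] dm by simp
    moreover have "card (-{0::'a}) \<le> card {x. poly h x = 0}"
      using Q0 by (intro card_mono) (auto simp: h_def int_eval_def)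
    then have "n \<le> degree h" using card_poly_roots_bound[OF nz(2)]
      by (simp add: n_def Compl_eq_Diff_UNIV card_Diff_singleton)
    ultimately show False by simp
  qed
  then obtain g :: 'a where g: "int_eval g m = 0" by blast
  have "int_eval g F = 0" if F: "int_eval \<zeta> F = 0" for F
  proof -
    obtain Q S where "F = m * Q + smult (int p) S" using m(3) I_0 F by blast
    then show ?thesis using g p by simp
  qed
  then show ?thesis by blast
qed

text \<open>Expresses that p is unramified in Z[\<zeta>]. With \<open>f\<close> generating, modulo
  p, the polynomials that vanish at \<open>g\<close>, write X^n - 1 = f H + p S. Since n = -1 in K,
  the root \<open>g\<close> is simple, so H(g) is nonzero; and F H becomes a multiple of p at
  \<zeta> for every \<open>F\<close> that vanishes at \<open>g\<close>.\<close>

lemma kernel_of_reduction: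
  fixes \<zeta> :: complex and g :: "'a::{field,finite}"
  assumes p: "prime p" "of_nat p = (0::'a)"
    and \<zeta>: "\<zeta> ^ (CARD('a) - 1) = 1"
    and g: "\<And>F. int_eval \<zeta> F = 0 \<Longrightarrow> int_eval g F = 0"
  obtains H where "int_eval g H \<noteq> 0"
    "\<And>F. int_eval g F = 0 \<Longrightarrow> \<exists>G. int_eval \<zeta> (F * H) = of_nat p * int_eval \<zeta> G"
proof -
  define n where "n = CARD('a) - 1"
  have "card {0, 1::'a} \<le> CARD('a)" by (rule card_mono) auto
  then have n: "0 < n" by (auto simp: n_def)
  have "degree (monom 1 n - 1 :: int poly) = n"
    using n degree_add_eq_left[of "- 1 :: int poly" "monom 1 n"] by (simp add: degree_monom_eq)
  then have lc: "lead_coeff (monom 1 n - 1 :: int poly) = 1" using n by simp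
  have \<zeta>0: "int_eval \<zeta> (monom 1 n - 1) = 0" using \<zeta> by (simp add: n_def)
  then have g0: "int_eval g (monom 1 n - 1) = 0" by (rule g)
  define I where "I = {F. int_eval g F = 0}"
  have I: "F + G \<in> I" if "F \<in> I" "G \<in> I" for F G using that by (simp add: I_def)
  have I': "G * F \<in> I" if "F \<in> I" for F G using that by (simp add: I_def)
  have I'': "smult (int p) F \<in> I" for F using p by (simp add: I_def)
  have I0: "monom 1 n - 1 \<in> I" using g0 by (simp only: I_def mem_Collect_eq)
  obtain f where f: "f \<in> I" "\<And>F. F \<in> I \<Longrightarrow> \<exists>Q S. F = f * Q + smult (int p) S"
    using monic_generator_mod_prime[OF p(1) I I' I'' I0 lc] by metis
  obtain H S where HS: "monom 1 n - 1 = f * H + smult (int p) S" using f(2) I0 by blast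
  have "int_eval g H \<noteq> 0"
  proof
    assume H0: "int_eval g H = 0"
    define f' where "f' = (map_poly of_int f :: 'a poly)"
    define H' where "H' = (map_poly of_int H :: 'a poly)"
    have "f * H = (monom 1 n - 1) - smult (int p) S" unfolding HS by simp
    then have "f' * H' = map_poly of_int ((monom 1 n - 1) - smult (int p) S)"
      unfolding f'_def H'_def map_poly_of_int_mult[symmetric] by simp
    also have "\<dots> = monom 1 n - 1" by (rule poly_eqI) (simp add: coeff_map_poly p)
    finally have "poly (pderiv (f' * H')) g = of_nat n * g ^ (n - 1)"
      by (simp add: pderiv_diff pderiv_monom poly_monom)
    moreover have "poly (pderiv (f' * H')) g = 0"
      using H0 f(1) by (simp add: pderiv_mult I_def int_eval_def f'_def H'_def)
    moreover have "of_nat n = (- 1 :: 'a)" using of_nat_CARD_eq_0[where 'a = 'a] n by (simp add: n_def of_nat_diff)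
    moreover have "g \<noteq> 0" using g0 n by (auto simp: power_0_left)
    ultimately show False by simp
  qed
  moreover have "\<exists>G. int_eval \<zeta> (F * H) = of_nat p * int_eval \<zeta> G" if F0: "int_eval g F = 0" for F
  proof -
    obtain Q S' where F: "F = f * Q + smult (int p) S'" using f(2)[of F] F0 I_def by auto
    have "f * H = (monom 1 n - 1) - smult (int p) S" unfolding HS by simp
    have "F * H = Q * (f * H) + smult (int p) (S' * H)" unfolding F by (simp add: algebra_simps)
    also have "f * H = (monom 1 n - 1) - smult (int p) S" by fact
    finally have "F * H = Q * (monom 1 n - 1) + smult (int p) (S' * H - Q * S)"
      by (simp add: right_diff_distrib smult_diff_right)
    then have "int_eval \<zeta> (F * H) = of_nat p * int_eval \<zeta> (S' * H - Q * S)" using \<zeta>0 by simp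
    then show ?thesis by blast
  qed
  ultimately show ?thesis using that by blast
qed

text \<open>Reduction preserves the order: if g^d = 1 with 0 < d < n, the sum of the first n powers
  of \<zeta>^d, which is 0, would reduce to n = -1 in K. Hence \<open>g\<close> generates the
  multiplicative group.\<close>

lemma primitive_power_reduction:
  fixes \<zeta> :: complex and g :: "'a::{field,finite}"
  assumes g: "\<And>F. int_eval \<zeta> F = 0 \<Longrightarrow> int_eval g F = 0"
    and \<zeta>: "\<zeta> ^ (CARD('a) - 1) = 1" "\<And>d. 0 < d \<Longrightarrow> d < CARD('a) - 1 \<Longrightarrow> \<zeta> ^ d \<noteq> 1"
  shows "g \<noteq> 0" "g ^ i = g ^ j \<Longrightarrow> \<zeta> ^ i = \<zeta> ^ j" "a \<noteq> 0 \<Longrightarrow> \<exists>i. a = g ^ i"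
proof -
  define n where "n = CARD('a) - 1"
  have "card {0, 1::'a} \<le> CARD('a)" by (rule card_mono) auto
  then have n: "0 < n" by (auto simp: n_def)
  have "int_eval g (monom 1 n - 1) = 0" using \<zeta> by (intro g) (simp add: n_def)
  then have gn: "g ^ n = 1" by simp
  then show g0: "g \<noteq> 0" using n by (auto simp: power_0_left)
  have prim: "g ^ d \<noteq> 1" if d: "0 < d" "d < n" for d
  proof
    assume gd: "g ^ d = 1"
    have ev: "int_eval x (\<Sum>i<n. monom 1 (d * i)) = (\<Sum>i<n. (x ^ d) ^ i)" for x :: "'b::comm_ring_1"
    proof -
      have "int_eval x (\<Sum>i<m. monom 1 (d * i)) = (\<Sum>i<m. (x ^ d) ^ i)" for m
        by (induction m) (simp_all add: power_mult)
      then show ?thesis .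
    qed
    have "(\<Sum>i<n. (\<zeta> ^ d) ^ i) = ((\<zeta> ^ d) ^ n - 1) / (\<zeta> ^ d - 1)"
      using \<zeta>(2)[of d] d by (intro geometric_sum) (simp add: n_def)
    also have "(\<zeta> ^ d) ^ n = 1" using \<zeta>(1) by (metis n_def mult.commute power_mult power_one)
    finally have "int_eval \<zeta> (\<Sum>i<n. monom 1 (d * i)) = 0" by (simp add: ev)
    from g[OF this] have "of_nat n = (0::'a)" by (simp add: ev gd)
    then show False using of_nat_CARD_eq_0[where 'a = 'a] n by (simp add: n_def of_nat_diff)
  qed
  have mod: "x ^ i = x ^ (i mod n)" if "x ^ n = 1" for x :: "'b::comm_ring_1" and i
    by (metis that div_mult_mod_eq mult.commute mult_1 power_add power_mult power_one)
  have inj: "inj_on (\<lambda>i. g ^ i) {..<n}"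
  proof -
    have "i = j" if "i \<le> j" "j < n" "g ^ i = g ^ j" for i j
    proof (rule ccontr)
      assume "i \<noteq> j"
      moreover have "g ^ i * g ^ (j - i) = g ^ i" using that by (metis le_add_diff_inverse power_add)
      then have "g ^ (j - i) = 1" using g0 by simp
      ultimately show False using prim[of "j - i"] that by auto
    qed
    then show ?thesis by (intro inj_onI) (metis lessThan_iff linear)
  qed
  show "\<zeta> ^ i = \<zeta> ^ j" if "g ^ i = g ^ j"
  proof -
    have "g ^ (i mod n) = g ^ (j mod n)" using that mod[OF gn] by metis
    then have "i mod n = j mod n" using inj n by (auto dest!: inj_onD)
    then show ?thesis using mod[of \<zeta>] \<zeta>(1) by (metis n_def)
  qed
  have "card ((\<lambda>i. g ^ i) ` {..<n}) = card (-{0::'a})"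
    by (simp only: card_image[OF inj]) (simp add: n_def Compl_eq_Diff_UNIV card_Diff_singleton)
  then have "(\<lambda>i. g ^ i) ` {..<n} = -{0}"
    by (intro card_subset_eq) (use g0 in auto)
  then show "\<exists>i. a = g ^ i" if "a \<noteq> 0" using that by auto
qed

text \<open>\<open>R\<close> consists of the fractions F(\<zeta>) / G(\<zeta>) with G(g) nonzero,
  that is, Z[\<zeta>] localized at the kernel of the reduction; \<open>T\<close> sends g^i to
  \<zeta>^i.\<close>

lemma teichmueller_lift_exists:
  assumes p: "prime p" "CARD('a::{field,finite}) = p ^ e"
  shows "\<exists>R (\<nu> :: complex \<Rightarrow> 'a) T. teichmueller_lift p R \<nu> T"
proof -
  have p0: "of_nat p = (0::'a)" by (rule of_nat_prime_eq_0[OF p(2)])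
  define n where "n = CARD('a) - 1"
  have "card {0, 1::'a} \<le> CARD('a)" by (rule card_mono) auto
  then have n: "0 < n" by (auto simp: n_def)
  define \<zeta> where "\<zeta> = cis (2 * pi / real n)"
  have \<zeta>_pow: "\<zeta> ^ i = cis (2 * pi * real i / real n)" for i
    unfolding \<zeta>_def by (simp add: DeMoivre mult_ac)
  have \<zeta>n: "\<zeta> ^ (CARD('a) - 1) = 1" 
  proof -
    have "\<zeta> ^ n = 1" using n by (simp add: \<zeta>_pow)
    then show ?thesis by (simp only: n_def)
  qed
  have \<zeta>d: "\<zeta> ^ d \<noteq> 1" if d: "0 < d" "d < CARD('a) - 1" for d
  proof
    assume "\<zeta> ^ d = 1"
    then have "cis (2 * pi * real d / real n) = cis (2 * pi * real 0 / real n)" by (simp add: \<zeta>_pow)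
    moreover have "inj_on (\<lambda>k. cis (2 * pi * real k / real n)) {..<n}"
      using bij_betw_roots_unity[OF n] by (simp only: bij_betw_def)
    ultimately have "d = 0" using d n by (elim inj_onD) (simp_all add: n_def)
    then show False using d by simp
  qed
  obtain g :: 'a where g: "\<And>F. int_eval \<zeta> F = 0 \<Longrightarrow> int_eval g F = 0"
    using root_of_unity_reduction[OF p(1) p0 \<zeta>n] by blast
  have pr2: "\<zeta> ^ i = \<zeta> ^ j" if "g ^ i = g ^ j" for i j
    using primitive_power_reduction(2)[of \<zeta> g i j] g \<zeta>n \<zeta>d that by blast
  have pr3: "\<exists>i. a = g ^ i" if "a \<noteq> 0" for a
    using primitive_power_reduction(3)[of \<zeta> g a] g \<zeta>n \<zeta>d that by blast
  obtain H where H: "int_eval g H \<noteq> 0"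
    "\<And>F. int_eval g F = 0 \<Longrightarrow> \<exists>G. int_eval \<zeta> (F * H) = of_nat p * int_eval \<zeta> G"
    using kernel_of_reduction[OF p(1) p0 \<zeta>n g] by blast
  define rep where "rep z F G \<longleftrightarrow> int_eval g G \<noteq> 0 \<and> z = int_eval \<zeta> F / int_eval \<zeta> G" for z F G
  define R where "R = {z. \<exists>F G. rep z F G}"
  define \<nu> where "\<nu> z = (SOME y. \<exists>F G. rep z F G \<and> y = int_eval g F / int_eval g G)" for z
  define T where "T a = \<zeta> ^ (SOME i. a = g ^ i)" for a
  have nz: "int_eval \<zeta> G \<noteq> 0" if "int_eval g G \<noteq> 0" for G using that g by blast
  have \<nu>: "\<nu> z = int_eval g F / int_eval g G" if r: "rep z F G" for z F G
  proof -
    have "\<exists>F' G'. rep z F' G' \<and> \<nu> z = int_eval g F' / int_eval g G'"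
      unfolding \<nu>_def by (rule someI_ex) (use r in blast)
    then obtain F' G' where r': "rep z F' G'" "\<nu> z = int_eval g F' / int_eval g G'" by blast
    have "int_eval \<zeta> (F * G' - F' * G) = 0"
      using r r'(1) nz[of G] nz[of G'] unfolding rep_def by (simp add: field_simps)
    then have "int_eval g (F * G' - F' * G) = 0" by (rule g)
    then have "int_eval g F' / int_eval g G' = int_eval g F / int_eval g G"
      using r r'(1) unfolding rep_def by (simp add: frac_eq_eq)
    then show ?thesis using r'(2) by simp
  qed
  have R: "z \<in> R \<longleftrightarrow> (\<exists>F G. rep z F G)" for z by (simp add: R_def)
  have rep_diff: "rep (x - y) (F * G' - F' * G) (G * G')" if "rep x F G" "rep y F' G'" for x y F G F' G'
    using that nz[of G] nz[of G'] unfolding rep_def by (auto simp: diff_frac_eq)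
  have rep_mult: "rep (x * y) (F * F') (G * G')" if "rep x F G" "rep y F' G'" for x y F G F' G'
    using that unfolding rep_def by auto
  have rep_int: "rep (int_eval \<zeta> F) F 1" for F unfolding rep_def by simp
  have "teichmueller_lift p R \<nu> T"
  proof
    show "prime p" by fact
    show "1 \<in> R" using rep_int[of 1] R by auto
    show "\<nu> 1 = 1" using \<nu>[OF rep_int[of 1]] by simp
    have "rep (of_nat p) [:int p:] 1" using rep_int[of "[:int p:]"] by simp
    from \<nu>[OF this] show "\<nu> (of_nat p) = 0" by (simp add: p0)
  next
    fix x y assume "x \<in> R" "y \<in> R"
    then obtain F G F' G' where r: "rep x F G" "rep y F' G'" unfolding R by blast
    have G: "int_eval g G \<noteq> 0" "int_eval g G' \<noteq> 0" using r by (auto simp: rep_def)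
    show "x - y \<in> R" using rep_diff[OF r] R by blast
    show "x * y \<in> R" using rep_mult[OF r] R by blast
    show "\<nu> (x - y) = \<nu> x - \<nu> y" using \<nu>[OF rep_diff[OF r]] \<nu>[OF r(1)] \<nu>[OF r(2)] G
      by (simp add: diff_frac_eq)
    show "\<nu> (x * y) = \<nu> x * \<nu> y" using \<nu>[OF rep_mult[OF r]] \<nu>[OF r(1)] \<nu>[OF r(2)] by simp
  next
    fix x assume "x \<in> R"
    then obtain F G where r: "rep x F G" unfolding R by blast
    have G: "int_eval g G \<noteq> 0" using r by (auto simp: rep_def)
    show "x / of_nat p \<in> R" if "\<nu> x = 0"
    proof -
      have "int_eval g F = 0" using that \<nu>[OF r] G by simp
      \<comment> \<open>As \<open>H\<close> is a unit of \<open>R\<close>, the fraction of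
        \<open>K\<close> by \<open>G * H\<close> represents the quotient by p.\<close>
      then obtain K where K: "int_eval \<zeta> (F * H) = of_nat p * int_eval \<zeta> K" using H(2) by blast
      have "int_eval \<zeta> K = int_eval \<zeta> F * int_eval \<zeta> H / of_nat p"
        using K prime_gt_0_nat[OF p(1)] by (simp add: field_simps)
      then have "rep (x / of_nat p) K (G * H)"
        using r H(1) nz[OF H(1)] unfolding rep_def by simp
      then show ?thesis using R by blast
    qed
    show "inverse x \<in> R" if "\<nu> x \<noteq> 0"
    proof -
      have "int_eval g F \<noteq> 0" using that \<nu>[OF r] by auto
      then have "rep (inverse x) G F" using r unfolding rep_def by simp
      then show ?thesis using R by blast
    qed
  next
    have sel: "a = g ^ (SOME i. a = g ^ i)" if "a \<noteq> 0" for a using pr3[OF that] by (rule someI_ex)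
    fix a :: 'a assume a: "a \<noteq> 0"
    have r: "rep (T a) (monom 1 (SOME i. a = g ^ i)) 1" unfolding T_def rep_def by simp
    then show "T a \<in> R" using R by blast
    show "\<nu> (T a) = a" using \<nu>[OF r] sel[OF a] by simp
    show "T a ^ (CARD('a) - 1) = 1" unfolding T_def using \<zeta>n by (metis power_mult mult.commute power_one)
    fix b :: 'a assume b: "b \<noteq> 0"
    have "g ^ (SOME i. a * b = g ^ i) = a * b" using sel[of "a * b"] a b by simp
    also have "\<dots> = g ^ ((SOME i. a = g ^ i) + (SOME i. b = g ^ i))"
      using sel[OF a] sel[OF b] by (simp add: power_add)
    finally have "\<zeta> ^ (SOME i. a * b = g ^ i) = \<zeta> ^ ((SOME i. a = g ^ i) + (SOME i. b = g ^ i))" by (rule pr2)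
    then show "T (a * b) = T a * T b" by (simp add: T_def power_add)
  qed
  then show ?thesis by blast
qed

section \<open>The p-rank from a diagonal form\<close>

lemma map_matrix_of_int_mult:
  "map_matrix of_int (A ** B) = (map_matrix of_int A ** map_matrix of_int B :: 'a::comm_ring_1^'n^'m)"
  by (simp add: vec_eq_iff matrix_matrix_mult_def)

lemma map_matrix_of_int_mat_1: "map_matrix of_int (mat 1) = (mat 1 :: 'a::comm_ring_1^'n^'n)"
  by (simp add: vec_eq_iff mat_def)

lemma invertible_map_matrix_of_int:
  assumes "invertible (U :: int^'n^'n)"
  shows "invertible (map_matrix of_int U :: 'a::comm_ring_1^'n^'n)"
proof -
  from assms obtain U' where "U ** U' = mat 1" "U' ** U = mat 1" unfolding invertible_def by blast
  then show ?thesis unfolding invertible_def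
    by (metis map_matrix_of_int_mult map_matrix_of_int_mat_1)
qed

lemma invertible_imp_inj_mult:
  fixes A :: "'a::field^'n^'n" assumes "invertible A" shows "inj ((*v) A)"
proof -
  from assms obtain B where "B ** A = mat 1" unfolding invertible_def by blast
  then show ?thesis by (intro injI) (metis matrix_vector_mul_assoc matrix_vector_mul_lid)
qed

lemma dim_image_invertible:
  fixes A :: "'a::field^'n^'n" assumes "invertible A"
  shows "vec.dim ((*v) A ` S) = vec.dim S"
  by (rule vec.dim_image_eq[OF matrix_vector_mul_linear_gen])
     (rule inj_on_subset[OF invertible_imp_inj_mult[OF assms]], simp)

lemma mult_axis_eq_column: "(A :: 'a::comm_semiring_1^'n^'m) *v axis k 1 = column k A"
  by (simp add: vec_eq_iff matrix_vector_mult_def column_def axis_def if_distrib[of "\<lambda>y. _ * y"] cong: if_cong)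

text \<open>\<open>rank\<close> is the dimension of the row space. Transposing turns it into the
  dimension of an image, which invertible factors on both sides preserve; the image of the diagonal
  matrix is spanned by the unit vectors with p not dividing \<open>d i\<close>.\<close>

lemma p_rank_diagonal:
  fixes L U V :: "int^'n^'n"
  assumes p: "prime p" "of_nat p = (0::'f::field)"
    and UV: "invertible U" "invertible V" "U ** L ** V = (\<chi> i j. if i = j then d i else 0)"
  shows "p_rank TYPE('f) L = card {i. \<not> int p dvd d i}"
proof -
  let ?c = "map_matrix of_int :: int^'n^'n \<Rightarrow> 'f^'n^'n"
  define D where "D = ?c (transpose (\<chi> i j. if i = j then d i else 0))"
  have Dv: "(D *v x) $ i = of_int (d i) * x $ i" for x i
    by (simp add: D_def matrix_vector_mult_def transpose_def if_distrib[of "\<lambda>y. y * _"]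
        if_distrib[of of_int] cong: if_cong)
  have inv: "invertible (?c (transpose U))" "invertible (?c (transpose V))"
    using UV by (auto intro!: invertible_map_matrix_of_int invertible_transpose_int)
  have D: "D = ?c (transpose V) ** (?c (transpose L) ** ?c (transpose U))"
    unfolding D_def UV(3)[symmetric]
    by (simp add: map_matrix_of_int_mult matrix_transpose_mul)
  have "rank (?c L) = vec.dim (columns (?c (transpose L)))"
    unfolding row_rank_def_gen by (simp add: columns_def rows_def row_def column_def transpose_def)
  also have "\<dots> = vec.dim (vec.span (columns (?c (transpose L))))" by simp
  also have "vec.span (columns (?c (transpose L))) = range ((*v) (?c (transpose L)))"
  proof
    have "columns (?c (transpose L)) \<subseteq> range ((*v) (?c (transpose L)))"
      by (auto simp: columns_def mult_axis_eq_column[symmetric])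
    moreover have "vec.subspace (range ((*v) (?c (transpose L))))"
      by (metis matrix_vector_mul_linear_gen vec.linear_subspace_image vec.subspace_UNIV)
    ultimately show "vec.span (columns (?c (transpose L))) \<subseteq> range ((*v) (?c (transpose L)))"
      by (rule vec.span_minimal)
  qed (auto intro: matrix_vector_mult_in_columnspace_gen)
  also have "vec.dim \<dots> = vec.dim ((*v) (?c (transpose V)) ` \<dots>)"
    by (rule dim_image_invertible[OF inv(2), symmetric])
  also have "(*v) (?c (transpose V)) ` range ((*v) (?c (transpose L))) =
      {z. \<forall>i. i \<notin> {i. \<not> int p dvd d i} \<longrightarrow> z $ i = 0}" (is "?A = ?B")
  proof -
    have surj: "surj ((*v) (?c (transpose U)))"
      using inv(1) invertible_right_inverse matrix_right_invertible_surjective by blast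
    have "?A = range ((*v) D)"
    proof -
      have "range ((*v) D) = (*v) (?c (transpose V)) ` (*v) (?c (transpose L)) ` range ((*v) (?c (transpose U)))"
        unfolding D by (auto simp: image_image matrix_vector_mul_assoc)
      then show ?thesis using surj by simp
    qed
    also have "\<dots> = ?B"
    proof
      show "range ((*v) D) \<subseteq> ?B"
        using of_int_eq_0_iff_dvd[OF p] by (auto simp: Dv)
      show "?B \<subseteq> range ((*v) D)"
      proof
        fix z assume z: "z \<in> ?B"
        have "z = D *v (\<chi> i. if int p dvd d i then 0 else z $ i / of_int (d i))"
          using z by (auto simp: vec_eq_iff Dv of_int_eq_0_iff_dvd[OF p])
        then show "z \<in> range ((*v) D)" by blast
      qed
    qed
    finally show ?thesis .
  qed
  also have "vec.dim \<dots> = card {i. \<not> int p dvd d i}" by (rule dim_substandard_cart)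
  finally show ?thesis by (simp add: p_rank_def)
qed

section \<open>Linear algebra over the valuation ring\<close>

context teichmueller_lift
begin

lemma R_0 [simp]: "0 \<in> R" using R_diff[OF R_1 R_1] by simp
lemma R_uminus: "x \<in> R \<Longrightarrow> - x \<in> R" using R_diff[of 0 x] by simp
lemma R_add: "x \<in> R \<Longrightarrow> y \<in> R \<Longrightarrow> x + y \<in> R" using R_diff[of x "- y"] R_uminus by simp
lemma R_of_nat: "of_nat k \<in> R" by (induction k) (auto intro: R_add R_1)
lemma R_of_int: "of_int k \<in> R" by (cases k) (auto intro: R_uminus R_of_nat simp flip: of_nat_Suc simp del: of_nat_Suc)
lemma R_power: "x \<in> R \<Longrightarrow> x ^ k \<in> R" by (induction k) (auto intro: R_mult R_1)
lemma R_sum: "(\<And>i. i \<in> A \<Longrightarrow> f i \<in> R) \<Longrightarrow> sum f A \<in> R"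
  by (induction A rule: infinite_finite_induct) (auto intro: R_add)
lemma R_prod: "(\<And>i. i \<in> A \<Longrightarrow> f i \<in> R) \<Longrightarrow> prod f A \<in> R"
  by (induction A rule: infinite_finite_induct) (auto intro: R_mult R_1)

lemmas R_closed = R_0 R_1 R_diff R_mult R_uminus R_add R_of_nat R_of_int R_power R_sum R_prod

lemma \<nu>_0 [simp]: "\<nu> 0 = 0" using \<nu>_diff[OF R_1 R_1] by simp
lemma \<nu>_uminus: "x \<in> R \<Longrightarrow> \<nu> (- x) = - \<nu> x" using \<nu>_diff[of 0 x] by simp
lemma \<nu>_add: "x \<in> R \<Longrightarrow> y \<in> R \<Longrightarrow> \<nu> (x + y) = \<nu> x + \<nu> y"
  using \<nu>_diff[of x "- y"] by (simp add: \<nu>_uminus R_uminus)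
lemma \<nu>_of_nat: "\<nu> (of_nat k) = of_nat k" by (induction k) (auto simp: \<nu>_add R_1 R_of_nat \<nu>_1)
lemma \<nu>_of_int: "\<nu> (of_int k) = of_int k"
proof (cases k)
  case (nonneg n) then show ?thesis by (simp add: \<nu>_of_nat)
next
  case (neg n)
  have "\<nu> (of_int k) = - \<nu> (of_nat (Suc n))" unfolding neg by (simp add: \<nu>_uminus R_of_nat del: of_nat_Suc)
  then show ?thesis unfolding neg \<nu>_of_nat by simp
qed
lemma \<nu>_power: "x \<in> R \<Longrightarrow> \<nu> (x ^ k) = \<nu> x ^ k" by (induction k) (auto simp: \<nu>_mult R_power \<nu>_1)
lemma \<nu>_sum: "(\<And>i. i \<in> A \<Longrightarrow> f i \<in> R) \<Longrightarrow> \<nu> (sum f A) = (\<Sum>i\<in>A. \<nu> (f i))"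
  by (induction A rule: infinite_finite_induct) (auto simp: \<nu>_add R_sum)
lemma \<nu>_prod: "(\<And>i. i \<in> A \<Longrightarrow> f i \<in> R) \<Longrightarrow> \<nu> (prod f A) = (\<Prod>i\<in>A. \<nu> (f i))"
  by (induction A rule: infinite_finite_induct) (auto simp: \<nu>_mult R_prod \<nu>_1)

lemma p_eq_0: "of_nat p = (0::'a)" using \<nu>_of_nat[of p] \<nu>_p by simp

lemma p_nonzero: "of_nat p \<noteq> (0::complex)" using prime_p by (simp add: prime_gt_0_nat)

lemma det_R:
  assumes "\<And>i j. A$i$j \<in> R" shows "det (A :: complex^'n^'n) \<in> R" "\<nu> (det A) = det (map_matrix \<nu> A)"
proof -
  have *: "of_int (sign s) * (\<Prod>i\<in>UNIV. A$i$s i) \<in> R" for s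
    using assms by (intro R_closed) auto
  show "det A \<in> R" unfolding det_def using * by (intro R_sum)
  show "\<nu> (det A) = det (map_matrix \<nu> A)" unfolding det_def
    using * assms by (simp add: \<nu>_sum \<nu>_mult \<nu>_of_int \<nu>_prod R_closed)
qed

lemma det_reduction_nonzero:
  assumes "\<And>i j. A$i$j \<in> R" "det (map_matrix \<nu> A) \<noteq> 0" shows "det (A :: complex^'n^'n) \<noteq> 0"
  using det_R[of A] assms by auto

text \<open>Cramer's rule: the determinant of \<open>W\<close> has nonzero reduction, so it is a
  unit of \<open>R\<close>.\<close>

lemma solve_R:
  fixes W :: "complex^'n^'n"
  assumes W: "\<And>i j. W$i$j \<in> R" "det (map_matrix \<nu> W) \<noteq> 0"
    and y: "\<And>i. (W *v y)$i \<in> R"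
  shows "y$i \<in> R"
proof -
  have "y = (\<chi> k. det (\<chi> i j. if j = k then (W *v y)$i else W$i$j) / det W)"
    using cramer[OF det_reduction_nonzero[OF W]] by blast
  then have "y$i = det (\<chi> i' j. if j = i then (W *v y)$i' else W$i'$j) * inverse (det W)"
    by (metis (no_types, lifting) divide_inverse vec_lambda_beta)
  moreover have "det (\<chi> i' j. if j = i then (W *v y)$i' else W$i'$j) \<in> R"
    using W y by (intro det_R) auto
  moreover have "inverse (det W) \<in> R" using det_R[OF W(1)] W(2) by (intro R_inverse) auto
  ultimately show ?thesis by (simp add: R_mult)
qed

lemma ex_lift: "\<exists>x\<in>R. \<nu> x = c"
  by (cases "c = 0") (auto intro: T_R \<nu>_T bexI[of _ 0] bexI[of _ "T c"])

text \<open>The dimension of this space does not change when \<open>L\<close> is multiplied on either side by a matrix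
  invertible over \<open>R\<close>. Computing it from the diagonal form over \<open>\<int>\<close> and from bases of characters
  over \<open>R\<close>, for all \<open>j\<close>, compares the elementary divisors of the two forms.\<close>

definition divisible_reductions :: "int^'n^'n \<Rightarrow> nat \<Rightarrow> ('a, 'n) vec set" where
  "divisible_reductions L j = {(\<chi> i. \<nu> (x$i)) | x. (\<forall>i. x$i \<in> R) \<and>
     (\<forall>i. (map_matrix of_int L *v x)$i / of_nat p ^ j \<in> R)}"

text \<open>In coordinates \<open>x = V y\<close>, and as \<open>W\<close> is invertible over
  \<open>R\<close>, the condition on \<open>L x\<close> says that p^j divides each
  \<open>D i\<close> times the i-th coordinate of \<open>y\<close>. The reductions of these
  \<open>y\<close> are the vectors supported on \<open>S\<close>. The hypotheses on \<open>S\<close>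
  and its complement are phrased so that they also cover \<open>D i = 0\<close>.\<close>

lemma dim_divisible_reductions:
  fixes V W :: "complex^'n^'n" and D :: "'n \<Rightarrow> complex"
  assumes V: "\<And>i j. V$i$j \<in> R" "det (map_matrix \<nu> V) \<noteq> 0"
    and W: "\<And>i j. W$i$j \<in> R" "det (map_matrix \<nu> W) \<noteq> 0"
    and L: "map_matrix of_int L ** V = W ** (\<chi> i j. if i = j then D i else 0)"
    and S: "\<And>i. i \<in> S \<Longrightarrow> D i / of_nat p ^ j \<in> R"
    and nS: "\<And>i y. i \<notin> S \<Longrightarrow> y \<in> R \<Longrightarrow> D i * y / of_nat p ^ j \<in> R \<Longrightarrow> \<nu> y = 0"
  shows "vec.dim (divisible_reductions L j) = card S"
proof -
  have Lv: "map_matrix of_int L *v (V *v y) = W *v (\<chi> i. D i * y$i)" for y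
  proof -
    have "(\<chi> i j. if i = j then D i else 0) *v y = (\<chi> i. D i * y$i)"
      by (simp add: vec_eq_iff matrix_vector_mult_def if_distrib[of "\<lambda>y. y * _"] cong: if_cong)
    moreover have "map_matrix of_int L *v (V *v y) = W *v ((\<chi> i j. if i = j then D i else 0) *v y)"
      by (simp only: matrix_vector_mul_assoc L)
    ultimately show ?thesis by simp
  qed
  have red: "(\<chi> i. \<nu> ((V *v y)$i)) = map_matrix \<nu> V *v (\<chi> i. \<nu> (y$i))" if y: "\<And>i. y$i \<in> R" for y
    unfolding vec_eq_iff matrix_vector_mult_def
    by (simp add: \<nu>_sum R_mult V(1) y) (simp add: \<nu>_mult V(1) y)
  have VR: "(V *v y)$i \<in> R" if "\<And>i. y$i \<in> R" for y i
    using that V(1) by (auto simp: matrix_vector_mult_def intro!: R_sum R_mult)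
  have WR: "(W *v y)$i \<in> R" if "\<And>i. y$i \<in> R" for y i
    using that W(1) by (auto simp: matrix_vector_mult_def intro!: R_sum R_mult)
  have scale: "(W *v z)$i / c = (W *v (\<chi> i. z$i / c))$i" for z i c
    by (simp add: matrix_vector_mult_def sum_divide_distrib)
  have "divisible_reductions L j = (*v) (map_matrix \<nu> V) ` {z. \<forall>i. i \<notin> S \<longrightarrow> z$i = 0}"
  proof
    show "divisible_reductions L j \<subseteq> (*v) (map_matrix \<nu> V) ` {z. \<forall>i. i \<notin> S \<longrightarrow> z$i = 0}"
    proof
      fix w assume "w \<in> divisible_reductions L j"
      then obtain x where x: "w = (\<chi> i. \<nu> (x$i))" "\<And>i. x$i \<in> R"
        "\<And>i. (map_matrix of_int L *v x)$i / of_nat p ^ j \<in> R"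
        unfolding divisible_reductions_def by blast
      have "invertible V" using det_reduction_nonzero[OF V] by (simp add: invertible_det_nz)
      then obtain y where y: "V *v y = x"
        by (metis invertible_def matrix_vector_mul_assoc matrix_vector_mul_lid)
      have yR: "y$i \<in> R" for i using solve_R[OF V] y x by blast
      have "(W *v (\<chi> i. D i * y$i / of_nat p ^ j))$i \<in> R" for i
        using x(3)[of i] unfolding y[symmetric] Lv scale by simp
      from solve_R[OF W this] have "D i * y$i / of_nat p ^ j \<in> R" for i by (metis vec_lambda_beta)
      then have "\<nu> (y$i) = 0" if "i \<notin> S" for i using nS[OF that yR] by blast
      then show "w \<in> (*v) (map_matrix \<nu> V) ` {z. \<forall>i. i \<notin> S \<longrightarrow> z$i = 0}"
        unfolding x(1) y[symmetric] red[OF yR] by (intro imageI) simp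
    qed
    show "(*v) (map_matrix \<nu> V) ` {z. \<forall>i. i \<notin> S \<longrightarrow> z$i = 0} \<subseteq> divisible_reductions L j"
    proof
      fix w assume "w \<in> (*v) (map_matrix \<nu> V) ` {z. \<forall>i. i \<notin> S \<longrightarrow> z$i = 0}"
      then obtain z where z: "w = map_matrix \<nu> V *v z" "\<And>i. i \<notin> S \<Longrightarrow> z$i = 0" by blast
      have "\<exists>c\<in>R. \<nu> c = z$i \<and> (i \<notin> S \<longrightarrow> c = 0)" for i
        using ex_lift[of "z$i"] z(2)[of i] by (cases "i \<in> S") (auto intro!: bexI[of _ 0])
      then obtain y where y: "\<And>i. y i \<in> R" "\<And>i. \<nu> (y i) = z$i" "\<And>i. i \<notin> S \<Longrightarrow> y i = 0" by metis
      define y' where "y' = (\<chi> i. y i)"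
      have y': "y'$i \<in> R" for i using y by (simp add: y'_def)
      have "D i * y i / of_nat p ^ j \<in> R" for i
      proof (cases "i \<in> S")
        case True
        have "D i * y i / of_nat p ^ j = (D i / of_nat p ^ j) * y i" by simp
        then show ?thesis using S[OF True] y(1) R_mult by metis
      qed (simp add: y(3))
      then have "(map_matrix of_int L *v (V *v y'))$i / of_nat p ^ j \<in> R" for i
        unfolding Lv scale by (intro WR) (simp add: y'_def)
      moreover have "w = (\<chi> i. \<nu> ((V *v y')$i))"
        unfolding red[OF y'] z(1) by (simp add: y'_def y(2))
      ultimately show "w \<in> divisible_reductions L j"
        unfolding divisible_reductions_def using VR[OF y'] by blast
    qed
  qed
  then show ?thesis
    using dim_image_invertible[of "map_matrix \<nu> V"] V(2) dim_substandard_cart[of S, where 'a = 'a]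
    by (simp add: invertible_det_nz)
qed

text \<open>A relation instead of a function: it fails for 0 and outside \<open>R\<close>, so
  \<open>has_val x e\<close> also certifies that \<open>x\<close> is a nonzero element of
  \<open>R\<close>.\<close>

definition has_val :: "complex \<Rightarrow> nat \<Rightarrow> bool" where
  "has_val x e \<longleftrightarrow> (\<exists>u\<in>R. \<nu> u \<noteq> 0 \<and> x = of_nat p ^ e * u)"

lemma has_val_R: "has_val x e \<Longrightarrow> x \<in> R"
  unfolding has_val_def by (auto intro!: R_closed)

lemma has_val_div_R:
  assumes "has_val x e" "j \<le> e" shows "x / of_nat p ^ j \<in> R"
proof -
  obtain u where u: "u \<in> R" "x = of_nat p ^ e * u" using assms(1) by (auto simp: has_val_def)
  have "x / of_nat p ^ j = of_nat p ^ (e - j) * u"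
    using p_nonzero assms(2) by (simp add: u(2) power_diff)
  then show ?thesis using u(1) by (auto intro!: R_closed)
qed

lemma has_val_div_reduction:
  assumes "has_val x e" "e < j" "y \<in> R" "x * y / of_nat p ^ j \<in> R" shows "\<nu> y = 0"
proof -
  obtain u where u: "u \<in> R" "\<nu> u \<noteq> 0" "x = of_nat p ^ e * u" using assms(1) by (auto simp: has_val_def)
  have "(of_nat p :: complex) ^ j = of_nat p ^ e * of_nat p ^ (j - e - 1) * of_nat p"
    using assms(2) by (simp flip: power_add power_Suc2)
  then have "u * y = of_nat p * (of_nat p ^ (j - e - 1) * (x * y / of_nat p ^ j))"
    using p_nonzero by (simp add: u(3) field_simps)
  then have "\<nu> (u * y) = 0" using assms(4) by (simp only: \<nu>_mult R_closed \<nu>_p mult_zero_left)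
  then show ?thesis using u assms(3) by (simp add: \<nu>_mult)
qed

lemma has_val_of_int:
  assumes "d \<noteq> 0" shows "has_val (of_int d) (multiplicity (int p) d)"
proof -
  have "\<not> is_unit (int p)" using prime_p by (metis not_prime_unit prime_nat_int_transfer)
  then obtain x where x: "d = int p ^ multiplicity (int p) d * x" "\<not> int p dvd x"
    using multiplicity_decompose'[OF assms] by metis
  then have "of_int d = (of_nat p ^ multiplicity (int p) d * of_int x :: complex)"
    by (metis of_int_mult of_int_of_nat_eq of_int_power)
  moreover have "\<nu> (of_int x) \<noteq> 0" using of_int_eq_0_iff_dvd[OF prime_p p_eq_0] x by (simp add: \<nu>_of_int)
  ultimately show ?thesis unfolding has_val_def using R_of_int by blast
qed

text \<open>The dimension of \<open>divisible_reductions L j\<close> is computed twice, from the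
  diagonal form over the integers and from the one over \<open>R\<close>. \<open>Z\<close> collects
  the zero entries, which every power of p divides.\<close>

lemma elementary_divisors_eq:
  fixes L U' V' :: "int^'n^'n" and V W :: "complex^'n^'n"
  assumes UV: "invertible U'" "invertible V'" "U' ** L ** V' = (\<chi> i j. if i = j then d i else 0)"
    and V: "\<And>i j. V$i$j \<in> R" "det (map_matrix \<nu> V) \<noteq> 0"
    and W: "\<And>i j. W$i$j \<in> R" "det (map_matrix \<nu> W) \<noteq> 0"
    and L: "map_matrix of_int L ** V = W ** (\<chi> i j. if i = j then D i else 0)"
    and D: "\<And>i. i \<in> Z \<Longrightarrow> D i = 0" "\<And>i. i \<notin> Z \<Longrightarrow> has_val (D i) (e i)"
  shows "card {i. int p ^ j dvd d i} = card {i. i \<in> Z \<or> j \<le> e i}"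
proof -
  have "vec.dim (divisible_reductions L j) = card {i. i \<in> Z \<or> j \<le> e i}"
  proof (rule dim_divisible_reductions[OF V W L])
    show "D i / of_nat p ^ j \<in> R" if "i \<in> {i. i \<in> Z \<or> j \<le> e i}" for i
      using that D[of i] has_val_div_R by (cases "i \<in> Z") auto
    show "\<nu> y = 0" if "i \<notin> {i. i \<in> Z \<or> j \<le> e i}" "y \<in> R" "D i * y / of_nat p ^ j \<in> R" for i y
      using that D[of i] has_val_div_reduction[of "D i" "e i" j y] by auto
  qed
  moreover have "vec.dim (divisible_reductions L j) = card {i. int p ^ j dvd d i}"
  proof -
    obtain U'' where U'': "U'' ** U' = mat 1" "U' ** U'' = mat 1" using UV(1) unfolding invertible_def by blast
    then have iU: "invertible U''" unfolding invertible_def by blast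
    have LV: "L ** V' = U'' ** (\<chi> i j. if i = j then d i else 0)"
      unfolding UV(3)[symmetric] by (simp add: matrix_mul_assoc U'')
    have red: "map_matrix \<nu> (map_matrix of_int M) = (map_matrix of_int M :: ('a, 'n) vec ^ 'n)" for M :: "int^'n^'n"
      by (simp add: vec_eq_iff \<nu>_of_int)
    show ?thesis
    proof (rule dim_divisible_reductions[where V = "map_matrix of_int V'" and W = "map_matrix of_int U''"
          and D = "\<lambda>i. of_int (d i)"])
      have "map_matrix complex_of_int L ** map_matrix of_int V' = map_matrix of_int (L ** V')"
        by (rule map_matrix_of_int_mult[symmetric])
      also have "\<dots> = map_matrix of_int U'' ** map_matrix of_int (\<chi> i j. if i = j then d i else 0)"
        unfolding LV by (rule map_matrix_of_int_mult)
      also have "map_matrix of_int (\<chi> i j. if i = j then d i else 0) = (\<chi> i j. if i = j then of_int (d i) else 0)"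
        by (simp add: vec_eq_iff)
      finally show "map_matrix of_int L ** map_matrix of_int V' =
          map_matrix of_int U'' ** (\<chi> i j. if i = j then complex_of_int (d i) else 0)" .
      show "map_matrix complex_of_int V' $ i $ j \<in> R" "map_matrix complex_of_int U'' $ i $ j \<in> R" for i j
        by (simp_all add: R_of_int)
      show "det (map_matrix \<nu> (map_matrix of_int V')) \<noteq> 0" "det (map_matrix \<nu> (map_matrix of_int U'')) \<noteq> 0"
        unfolding red invertible_det_nz[symmetric] using UV iU by (auto intro: invertible_map_matrix_of_int)
      fix i
      show "of_int (d i) / of_nat p ^ j \<in> R" if dv: "i \<in> {i. int p ^ j dvd d i}"
      proof -
        obtain c where "d i = int p ^ j * c" using dv by blast
        then have "complex_of_int (d i) / of_nat p ^ j = of_int c" using p_nonzero by simp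
        then show ?thesis using R_of_int by metis
      qed
      show "\<nu> y = 0" if "i \<notin> {i. int p ^ j dvd d i}" "y \<in> R" "of_int (d i) * y / of_nat p ^ j \<in> R" for y
      proof -
        have nd: "\<not> int p ^ j dvd d i" using that by simp
        then have "d i \<noteq> 0" by auto
        moreover have "multiplicity (int p) (d i) < j" using nd by (metis multiplicity_dvd' not_le)
        ultimately show ?thesis using has_val_div_reduction[OF has_val_of_int _ that(2,3)] by blast
      qed
    qed
  qed
  ultimately show ?thesis by simp
qed

end

section \<open>Jacobi sums\<close>

locale jacobi_sums = teichmueller_lift +
  fixes n :: nat
  assumes CARD_eq: "CARD('a) = Suc n"
begin

lemma n_pos: "n > 0"
proof -
  have "card {0, 1::'a} \<le> CARD('a)" by (rule card_mono) auto
  then show ?thesis by (simp add: CARD_eq)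
qed

lemma power_n: "a \<noteq> 0 \<Longrightarrow> a ^ n = (1::'a)"
  using finite_field_power_card_minus_1[of a] by (simp add: CARD_eq)

lemma T_power_n: "a \<noteq> 0 \<Longrightarrow> T a ^ n = 1"
  using T_power[of a] by (simp add: CARD_eq)

lemma of_nat_Suc_n: "of_nat (Suc n) = (0::'a)"
  using of_nat_CARD_eq_0[where 'a = 'a] by (simp add: CARD_eq)

lemma card_nonzero: "card (UNIV - {0::'a}) = n"
  by (simp add: card_Diff_singleton CARD_eq)

lemma CHAR_eq_p: "CHAR('a) = p"
proof -
  have "CHAR('a) dvd p" using p_eq_0 by (simp add: of_nat_eq_0_iff_char_dvd)
  then show ?thesis using prime_p CHAR_not_1'[where ?'a = 'a] by (auto simp: prime_nat_iff)
qed

lemma T_nonzero: "a \<noteq> 0 \<Longrightarrow> T a \<noteq> 0" using \<nu>_T by (metis \<nu>_0)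

lemma T_1: "T 1 = 1" using T_mult[of 1 1] T_nonzero[of 1] by simp

lemma T_power_nat: "a \<noteq> 0 \<Longrightarrow> T (a ^ j) = T a ^ j"
  by (induction j) (simp_all add: T_1 T_mult)

text \<open>With the negative power of the Teichmueller character, the valuation of
  \<open>J a b\<close> counts carries in the sum of a and b themselves, not of their negatives. The
  value at 0 is 0 for every \<open>j\<close>, also for \<open>j = 0\<close>.\<close>

definition ch :: "nat \<Rightarrow> 'a \<Rightarrow> complex" where
  "ch j x = (if x = 0 then 0 else inverse (T x) ^ j)"

lemma ch_0 [simp]: "ch j 0 = 0" by (simp add: ch_def)
lemma ch_1 [simp]: "ch j 1 = 1" by (simp add: ch_def T_1)
lemma ch_mult: "ch j (x * y) = ch j x * ch j y" by (simp add: ch_def T_mult power_mult_distrib)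
lemma ch_add: "ch (i + j) x = ch i x * ch j x" by (simp add: ch_def power_add)
lemma ch_trivial: "n dvd j \<Longrightarrow> ch j x = of_bool (x \<noteq> 0)"
  using T_power_n[of x] by (auto simp: ch_def power_inverse power_mult elim!: dvdE)
lemma ch_cong: "[i = j] (mod n) \<Longrightarrow> ch i = ch j"
proof -
  have *: "ch j = ch (j mod n)" for j
  proof
    fix x
    have "ch j x = ch (n * (j div n) + j mod n) x" by simp
    also have "\<dots> = ch (j mod n) x" by (simp only: ch_add) (auto simp: ch_trivial)
    finally show "ch j x = ch (j mod n) x" .
  qed
  assume "[i = j] (mod n)"
  then show ?thesis using *[of i] *[of j] by (simp add: cong_def)
qed
lemma ch_R: "ch j x \<in> R"
  by (auto simp: ch_def \<nu>_T intro!: R_power R_inverse T_R)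
lemma \<nu>_ch: "\<nu> (ch j x) = (if x = 0 then 0 else inverse x ^ j)"
proof (cases "x = 0")
  case False
  have iR: "inverse (T x) \<in> R" using False by (auto simp: \<nu>_T intro!: R_inverse T_R)
  have "\<nu> (T x * inverse (T x)) = 1" using T_nonzero[OF False] \<nu>_1 by simp
  then have "\<nu> (inverse (T x)) = inverse x"
    using \<nu>_mult[OF T_R[OF False] iR] \<nu>_T[OF False] False by (simp add: inverse_eq_divide field_simps)
  then show ?thesis using False iR by (simp add: ch_def \<nu>_power)
qed simp

lemma ex_power_neq_1:
  assumes "\<not> n dvd j" shows "\<exists>a::'a. a \<noteq> 0 \<and> a ^ j \<noteq> 1"
proof (rule ccontr)
  assume "\<not> ?thesis"
  then have j: "a ^ j = 1" if "a \<noteq> 0" for a :: 'a using that by blast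
  define r where "r = j mod n"
  have r: "0 < r" "r < n" using assms n_pos by (auto simp: r_def dvd_eq_mod_eq_0)
  have ar: "a ^ r = 1" if "a \<noteq> 0" for a :: 'a
  proof -
    have "1 = a ^ (n * (j div n) + r)" using j[OF that] by (simp add: r_def)
    also have "\<dots> = a ^ r"
      by (simp only: power_add power_mult power_n[OF that] power_one mult_1)
    finally show ?thesis ..
  qed
  have deg: "degree (monom 1 r - 1 :: 'a poly) = r"
    using r degree_add_eq_left[of "- 1 :: 'a poly" "monom 1 r"] by (simp add: degree_monom_eq)
  then have nz: "(monom 1 r - 1 :: 'a poly) \<noteq> 0" using r by auto
  have "card (-{0::'a}) \<le> card {x. poly (monom 1 r - 1) x = (0::'a)}"
    using ar by (intro card_mono) (auto simp: poly_monom)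
  also have "\<dots> \<le> r" using card_poly_roots_bound[OF nz] deg by simp
  finally show False using r by (simp add: Compl_eq_Diff_UNIV card_nonzero)
qed

lemma sum_of_bool_nonzero: "(\<Sum>x\<in>UNIV. of_bool (x \<noteq> (0::'a))) = (of_nat n :: 'b::semiring_1)"
proof -
  have "(\<Sum>x\<in>UNIV. of_bool (x \<noteq> (0::'a))) = (\<Sum>x\<in>UNIV - {0::'a}. 1 :: 'b)"
    by (rule sum.mono_neutral_cong_right) auto
  then show ?thesis by (simp add: card_nonzero)
qed

lemma sum_power_field:
  assumes "j > 0" shows "(\<Sum>x\<in>UNIV. x ^ j) = (if n dvd j then - 1 else (0::'a))"
proof (cases "n dvd j")
  case True
  then obtain c where c: "j = n * c" by blast
  have "(\<Sum>x\<in>UNIV. (x::'a) ^ j) = (\<Sum>x\<in>UNIV. of_bool (x \<noteq> (0::'a)))"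
  proof (rule sum.cong)
    fix x :: 'a
    have "x ^ j = 1" if "x \<noteq> 0"
      using that by (simp only: c power_mult power_n[OF that] power_one)
    then show "x ^ j = of_bool (x \<noteq> 0)" using assms by (auto simp: power_0_left)
  qed simp
  also have "\<dots> = - 1" using of_nat_Suc_n by (simp add: sum_of_bool_nonzero add_eq_0_iff)
  finally show ?thesis using True by simp
next
  case False
  obtain a :: 'a where a: "a \<noteq> 0" "a ^ j \<noteq> 1" using ex_power_neq_1[OF False] by blast
  have "(\<Sum>x\<in>UNIV. (x::'a) ^ j) = (\<Sum>x\<in>UNIV. (a * x) ^ j)"
    by (rule sum.reindex_bij_witness[of _ "\<lambda>x. a * x" "\<lambda>x. x / a"]) (use a in auto)
  also have "\<dots> = a ^ j * (\<Sum>x\<in>UNIV. x ^ j)" by (simp add: power_mult_distrib sum_distrib_left)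
  finally have "(1 - a ^ j) * (\<Sum>x\<in>UNIV. x ^ j) = 0" by (simp add: algebra_simps)
  then show ?thesis using a False by auto
qed

lemma sum_ch: "(\<Sum>x\<in>UNIV. ch j x) = (if n dvd j then of_nat n else 0)"
proof (cases "n dvd j")
  case True
  then show ?thesis by (simp add: ch_trivial sum_of_bool_nonzero)
next
  case False
  obtain a :: 'a where a: "a \<noteq> 0" "a ^ j \<noteq> 1" using ex_power_neq_1[OF False] by blast
  have "(\<Sum>x\<in>UNIV. ch j x) = (\<Sum>x\<in>UNIV. ch j (a * x))"
    by (rule sum.reindex_bij_witness[of _ "\<lambda>x. a * x" "\<lambda>x. x / a"]) (use a in auto)
  also have "\<dots> = ch j a * (\<Sum>x\<in>UNIV. ch j x)" by (simp add: ch_mult sum_distrib_left)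
  finally have "(1 - ch j a) * (\<Sum>x\<in>UNIV. ch j x) = 0" by (simp add: algebra_simps)
  moreover have "ch j a \<noteq> 1"
  proof
    assume "ch j a = 1"
    then have "inverse a ^ j = 1" using \<nu>_ch[of j a] \<nu>_1 a by simp
    then show False using a by (simp add: power_inverse)
  qed
  ultimately show ?thesis using False by auto
qed

definition J :: "nat \<Rightarrow> nat \<Rightarrow> complex" where
  "J a b = (\<Sum>x\<in>UNIV. ch a x * ch b (1 - x))"

lemma J_R: "J a b \<in> R" unfolding J_def by (intro R_sum R_mult ch_R)

lemma J_commute: "J a b = J b a"
  unfolding J_def by (rule sum.reindex_bij_witness[of _ "\<lambda>x. 1 - x" "\<lambda>x. 1 - x"]) (simp_all add: mult.commute)

lemma J_cong: "[a = a'] (mod n) \<Longrightarrow> [b = b'] (mod n) \<Longrightarrow> J a b = J a' b'"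
  unfolding J_def using ch_cong[of a a'] ch_cong[of b b'] by simp

text \<open>For \<open>s \<noteq> 0\<close> the substitution x = s u extracts the factor
  \<open>ch (a + b) s\<close>; at \<open>s = 0\<close> only orthogonality remains. The action of the
  Laplacian on characters and the product relations between Jacobi sums all come from this
  formula.\<close>

lemma ch_conv:
  "(\<Sum>x\<in>UNIV. ch a x * ch b (s - x)) =
     ch (a + b) s * J a b + (if s = 0 \<and> n dvd a + b then ch b (-1) * of_nat n else 0)"
proof (cases "s = 0")
  case True
  have "ch a x * ch b (- x) = ch b (- 1) * ch (a + b) x" for x
    using ch_mult[of b "- 1" x] by (simp add: ch_add)
  then have "(\<Sum>x\<in>UNIV. ch a x * ch b (s - x)) = ch b (- 1) * (\<Sum>x\<in>UNIV. ch (a + b) x)"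
    using True by (simp add: sum_distrib_left)
  then show ?thesis using True by (simp add: sum_ch)
next
  case False
  have "(\<Sum>x\<in>UNIV. ch a x * ch b (s - x)) = (\<Sum>u\<in>UNIV. ch a (s * u) * ch b (s - s * u))"
    by (rule sum.reindex_bij_witness[of _ "\<lambda>x. s * x" "\<lambda>x. x / s"]) (use False in auto)
  also have "\<dots> = (\<Sum>u\<in>UNIV. ch (a + b) s * (ch a u * ch b (1 - u)))"
  proof (rule sum.cong)
    fix u :: 'a
    have "s - s * u = s * (1 - u)" by (simp add: algebra_simps)
    then show "ch a (s * u) * ch b (s - s * u) = ch (a + b) s * (ch a u * ch b (1 - u))"
      by (simp only: ch_mult ch_add mult_ac)
  qed simp
  finally show ?thesis using False by (simp add: J_def sum_distrib_left)
qed

lemma conv_assoc: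
  fixes f g h :: "'a \<Rightarrow> complex"
  shows "(\<Sum>s\<in>UNIV. (\<Sum>x\<in>UNIV. f x * g (s - x)) * h (1 - s)) =
         (\<Sum>x\<in>UNIV. f x * (\<Sum>y\<in>UNIV. g y * h ((1 - x) - y)))"
proof -
  have "(\<Sum>s\<in>UNIV. (\<Sum>x\<in>UNIV. f x * g (s - x)) * h (1 - s)) =
        (\<Sum>x\<in>UNIV. \<Sum>s\<in>UNIV. f x * g (s - x) * h (1 - s))"
    by (subst sum.swap) (simp add: sum_distrib_right)
  also have "\<dots> = (\<Sum>x\<in>UNIV. \<Sum>y\<in>UNIV. f x * (g y * h ((1 - x) - y)))"
  proof (rule sum.cong)
    fix x :: 'a
    show "(\<Sum>s\<in>UNIV. f x * g (s - x) * h (1 - s)) = (\<Sum>y\<in>UNIV. f x * (g y * h ((1 - x) - y)))"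
      by (rule sum.reindex_bij_witness[of _ "\<lambda>y. y + x" "\<lambda>s. s - x"]) (auto simp: algebra_simps)
  qed simp
  finally show ?thesis by (simp add: sum_distrib_left)
qed

text \<open>Associativity of the convolution of three characters, evaluated at 1. The two conditions
  remove the corrections at \<open>s = 0\<close>.\<close>

lemma J_cocycle:
  assumes "\<not> n dvd a + b" "\<not> n dvd b + c"
  shows "J a b * J (a + b) c = J b c * J a (b + c)"
proof -
  have "(\<Sum>s\<in>UNIV. (\<Sum>x\<in>UNIV. ch a x * ch b (s - x)) * ch c (1 - s)) = J a b * J (a + b) c"
    unfolding ch_conv unfolding J_def[of "a + b" c] sum_distrib_left
    using assms by (intro sum.cong) simp_all
  moreover have "(\<Sum>x\<in>UNIV. ch a x * (\<Sum>y\<in>UNIV. ch b y * ch c ((1 - x) - y))) = J b c * J a (b + c)"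
    unfolding ch_conv unfolding J_def[of a "b + c"] sum_distrib_left
    using assms by (intro sum.cong) simp_all
  ultimately show ?thesis by (simp only: conv_assoc)
qed

text \<open>Summed over all s, the convolution is a product of two character sums, which is 0 as
  \<open>ch a\<close> is nontrivial. Since \<open>ch (a + b)\<close> is trivial, this leaves n (J a
  b + ch b (-1)) = 0.\<close>

lemma J_inverse:
  assumes "n dvd a + b" "\<not> n dvd a" shows "J a b = - ch b (- 1)"
proof -
  have "(\<Sum>s\<in>UNIV. \<Sum>x\<in>UNIV. ch a x * ch b (s - x)) = (\<Sum>x\<in>UNIV. \<Sum>s\<in>UNIV. ch a x * ch b (s - x))"
    by (rule sum.swap)
  also have "\<dots> = (\<Sum>x\<in>UNIV. \<Sum>s\<in>UNIV. ch a x * ch b s)"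
  proof (rule sum.cong)
    fix x :: 'a
    show "(\<Sum>s\<in>UNIV. ch a x * ch b (s - x)) = (\<Sum>s\<in>UNIV. ch a x * ch b s)"
      by (rule sum.reindex_bij_witness[of _ "\<lambda>y. y + x" "\<lambda>s. s - x"]) simp_all
  qed simp
  also have "\<dots> = (\<Sum>x\<in>UNIV. ch a x) * (\<Sum>x\<in>UNIV. ch b x)" by (simp add: sum_product)
  also have "\<dots> = 0" using assms by (simp add: sum_ch)
  finally have "(\<Sum>s\<in>UNIV. ch (a + b) s) * J a b + ch b (- 1) * of_nat n = 0"
    using assms by (simp add: ch_conv sum.distrib sum_distrib_right)
  then have "of_nat n * (J a b + ch b (- 1)) = 0"
    using assms by (simp only: sum_ch if_True) (simp add: algebra_simps)
  then show ?thesis using n_pos by (simp add: add_eq_0_iff)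
qed

text \<open>Associativity again, now with the correction at \<open>s = 0\<close> present on one
  side. It adds n ch b (-1) to - J a b = ch b (-1), which together is q ch b (-1).\<close>

lemma J_product:
  assumes "n dvd a + b" "\<not> n dvd a" "\<not> n dvd c" "\<not> n dvd b + c"
  shows "J b c * J a (b + c) = ch b (- 1) * of_nat (Suc n)"
proof -
  have "(\<Sum>s\<in>UNIV. ch (a + b) s * J a b * ch c (1 - s)) = - J a b"
  proof -
    have "(\<Sum>s\<in>UNIV. ch (a + b) s * J a b * ch c (1 - s)) = J a b * (\<Sum>s\<in>UNIV. of_bool (s \<noteq> 0) * ch c (1 - s))"
      unfolding sum_distrib_left by (rule sum.cong) (simp_all add: ch_trivial[OF assms(1)])
    also have "(\<Sum>s\<in>UNIV. of_bool (s \<noteq> 0) * ch c (1 - s)) = (\<Sum>s\<in>UNIV. ch c (1 - s) - (if s = 0 then 1 else 0))"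
      by (rule sum.cong) auto
    also have "\<dots> = (\<Sum>s\<in>UNIV. ch c (1 - s)) - 1" by (simp add: sum_subtractf)
    also have "(\<Sum>s\<in>UNIV. ch c (1 - s)) = (\<Sum>s\<in>UNIV. ch c s)"
      by (rule sum.reindex_bij_witness[of _ "\<lambda>x. 1 - x" "\<lambda>x. 1 - x"]) auto
    finally show ?thesis using assms by (simp add: sum_ch)
  qed
  moreover have "(\<Sum>s\<in>UNIV. (if s = 0 \<and> n dvd a + b then ch b (-1) * of_nat n else 0) * ch c (1 - s)) = ch b (-1) * of_nat n"
  proof -
    have "(\<Sum>s\<in>UNIV. (if s = 0 \<and> n dvd a + b then ch b (-1) * of_nat n else 0) * ch c (1 - s)) =
          (\<Sum>s\<in>UNIV. if s = (0::'a) then ch b (-1) * of_nat n else 0)"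
      using assms by (intro sum.cong) auto
    then show ?thesis by simp
  qed
  ultimately have "(\<Sum>s\<in>UNIV. (\<Sum>x\<in>UNIV. ch a x * ch b (s - x)) * ch c (1 - s)) = ch b (-1) * of_nat n - J a b"
    by (simp only: ch_conv distrib_right sum.distrib) simp
  also have "\<dots> = ch b (- 1) * of_nat (Suc n)"
    by (simp only: J_inverse[OF assms(1,2)]) (simp add: algebra_simps)
  finally have "(\<Sum>x\<in>UNIV. ch a x * (\<Sum>y\<in>UNIV. ch b y * ch c ((1 - x) - y))) = ch b (- 1) * of_nat (Suc n)"
    unfolding conv_assoc .
  moreover have "(\<Sum>x\<in>UNIV. ch a x * (\<Sum>y\<in>UNIV. ch b y * ch c ((1 - x) - y))) = J b c * J a (b + c)"
    unfolding ch_conv unfolding J_def[of a "b + c"] sum_distrib_left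
    using assms by (intro sum.cong) simp_all
  ultimately show ?thesis by simp
qed

text \<open>The map x -> x^p is a field automorphism, and
  \<open>ch (p * j) x = ch j (x ^ p)\<close>.\<close>

lemma J_frobenius: "J (p * a) (p * b) = J a b"
proof -
  have pr: "prime CHAR('a)" using prime_p by (simp add: CHAR_eq_p)
  have chp: "ch (p * j) x = ch j (x ^ p)" for j x
    using prime_gt_0_nat[OF prime_p] by (auto simp: ch_def T_power_nat power_mult power_inverse)
  have add: "(x + y) ^ p = x ^ p + y ^ p" for x y :: 'a
    by (rule freshmans_dream[OF pr CHAR_eq_p[symmetric]])
  have sub: "(x - y) ^ p = x ^ p - y ^ p" for x y :: 'a
    using add[of "x - y" y] by (simp add: algebra_simps)
  have inj: "inj (\<lambda>x::'a. x ^ p)"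
  proof (rule injI)
    fix x y :: 'a assume "x ^ p = y ^ p"
    then have "(x - y) ^ p = 0" by (simp add: sub)
    then show "x = y" by simp
  qed
  then have bij: "bij_betw (\<lambda>x::'a. x ^ p) UNIV UNIV"
    by (simp add: bij_betw_def finite_UNIV_inj_surj)
  have "J (p * a) (p * b) = (\<Sum>x\<in>UNIV. ch a (x ^ p) * ch b (1 - x ^ p))"
    unfolding J_def by (simp add: chp sub)
  also have "\<dots> = J a b"
    unfolding J_def by (rule sum.reindex_bij_betw[OF bij])
  finally show ?thesis .
qed

text \<open>Modulo p the Jacobi sum becomes the sum of x^(n-1) (1-x)^(n-b) over K. The consequence
  to be used is that \<open>J 1 b\<close> is a unit unless p divides b + 1.\<close>

lemma \<nu>_J_1:
  assumes b: "1 \<le> b" "b < n" shows "\<nu> (J 1 b) = - of_nat (b + 1)"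
proof -
  have inv: "inverse x = x ^ (n - 1)" if "x \<noteq> 0" for x :: 'a
  proof -
    have "x ^ n = x * x ^ (n - 1)" using n_pos by (metis power_minus_mult mult.commute)
    then show ?thesis using that power_n[OF that] by (simp add: field_simps inverse_eq_divide)
  qed
  have invb: "inverse x ^ b = x ^ (n - b)" if "x \<noteq> 0" for x :: 'a
  proof -
    have "x ^ n = x ^ b * x ^ (n - b)" using b by (simp flip: power_add)
    then show ?thesis using that power_n[OF that] by (simp add: power_inverse field_simps inverse_eq_divide)
  qed
  have "\<nu> (J 1 b) = (\<Sum>x\<in>UNIV. x ^ (n - 1) * (1 - x) ^ (n - b))"
  proof -
    have "\<nu> (ch 1 x * ch b (1 - x)) = x ^ (n - 1) * (1 - x) ^ (n - b)" for x
    proof (cases "x = 0 \<or> x = 1")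
      case True
      then show ?thesis using b by (auto simp: power_0_left)
    next
      case False
      then have "\<nu> (ch 1 x * ch b (1 - x)) = inverse x * inverse (1 - x) ^ b"
        by (simp add: \<nu>_mult ch_R \<nu>_ch)
      then show ?thesis using inv[of x] invb[of "1 - x"] False by simp
    qed
    then show ?thesis unfolding J_def by (subst \<nu>_sum) (auto intro: R_mult ch_R)
  qed
  also have "\<dots> = (\<Sum>x\<in>UNIV. \<Sum>m\<le>n - b. of_nat ((n - b) choose m) * (- 1) ^ m * x ^ (n - 1 + m))"
  proof (rule sum.cong)
    fix x :: 'a
    have "(1 - x) ^ (n - b) = (\<Sum>m\<le>n - b. of_nat ((n - b) choose m) * (- x) ^ m * 1 ^ (n - b - m))"
      using binomial_ring[of "- x" 1 "n - b"] by simp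
    then show "x ^ (n - 1) * (1 - x) ^ (n - b) = (\<Sum>m\<le>n - b. of_nat ((n - b) choose m) * (- 1) ^ m * x ^ (n - 1 + m))"
      by (simp add: sum_distrib_left power_add power_minus[of x] mult_ac)
  qed simp
  also have "\<dots> = (\<Sum>m\<le>n - b. of_nat ((n - b) choose m) * (- 1) ^ m * (\<Sum>x\<in>UNIV. x ^ (n - 1 + m)))"
    by (subst sum.swap) (simp add: sum_distrib_left)
  \<comment> \<open>A power sum over K is nonzero only for exponents divisible by n. As n - 1 + m <
    2 n, this leaves \<open>m = 1\<close>, where the power sum -1 cancels the sign of the binomial
    term.\<close>
  also have "\<dots> = (\<Sum>m\<le>n - b. if m = 1 then of_nat (n - b) else 0)"
  proof (rule sum.cong)
    fix m assume m: "m \<in> {..n - b}"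
    have pos: "n - 1 + m > 0" using b by simp
    have "n dvd n - 1 + m \<longleftrightarrow> m = 1"
    proof
      assume "n dvd n - 1 + m"
      then obtain c where c: "n - 1 + m = n * c" by blast
      have "c < 2"
      proof (rule ccontr)
        assume "\<not> c < 2"
        then have "n * 2 \<le> n * c" by simp
        moreover have "n - 1 + m < n * 2" using m b by auto
        ultimately show False using c by linarith
      qed
      moreover have "c \<noteq> 0" using pos c by (intro notI) simp
      ultimately have "c = 1" by simp
      then show "m = 1" using c b by simp
    qed (use b in simp)
    then show "of_nat ((n - b) choose m) * (- 1) ^ m * (\<Sum>x\<in>UNIV. x ^ (n - 1 + m)) = (if m = 1 then of_nat (n - b) else (0::'a))"
      using sum_power_field[OF pos] by (cases "m = 1") simp_all
  qed simp
  also have "\<dots> = of_nat (n - b)"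
  proof -
    have "Suc 0 \<le> n - b" using b by linarith
    then show ?thesis by simp
  qed
  also have "\<dots> = - of_nat (b + 1)"
  proof -
    have "of_nat (n - b) + of_nat (b + 1) = (of_nat (Suc n) :: 'a)"
      using b by (simp flip: of_nat_add)
    then show ?thesis using of_nat_Suc_n by (simp only: eq_neg_iff_add_eq_0)
  qed
  finally show ?thesis .
qed

end

section \<open>The Laplacian on a block of characters\<close>

context teichmueller_lift
begin

lemma has_val_mult: "has_val x a \<Longrightarrow> has_val y b \<Longrightarrow> has_val (x * y) (a + b)"
proof -
  assume "has_val x a" "has_val y b"
  then obtain u v where "u \<in> R" "\<nu> u \<noteq> 0" "x = of_nat p ^ a * u" "v \<in> R" "\<nu> v \<noteq> 0" "y = of_nat p ^ b * v"
    by (auto simp: has_val_def)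
  then show ?thesis unfolding has_val_def
    by (intro bexI[of _ "u * v"]) (auto simp: \<nu>_mult R_mult power_add)
qed

lemma has_val_0I: "x \<in> R \<Longrightarrow> \<nu> x \<noteq> 0 \<Longrightarrow> has_val x 0"
  by (auto simp: has_val_def)

lemma has_val_p_power: "has_val (of_nat p ^ e) e"
  unfolding has_val_def by (intro bexI[of _ 1]) (auto simp: R_1 \<nu>_1)

lemma has_val_uminus: "has_val x e \<Longrightarrow> has_val (- x) e"
  using has_val_mult[of "- 1" 0 x e] R_uminus[OF R_1] \<nu>_uminus[OF R_1] \<nu>_1 by (simp add: has_val_0I)

lemma has_val_nonzero: "has_val x e \<Longrightarrow> x \<noteq> 0"
  using p_nonzero by (auto simp: has_val_def)

lemma has_val_divide:
  assumes "has_val x a" "has_val y b" "b \<le> a" shows "has_val (x / y) (a - b)"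
proof -
  obtain u v where u: "u \<in> R" "\<nu> u \<noteq> 0" "x = of_nat p ^ a * u" and v: "v \<in> R" "\<nu> v \<noteq> 0" "y = of_nat p ^ b * v"
    using assms by (auto simp: has_val_def)
  have iv: "inverse v \<in> R" by (rule R_inverse[OF v(1,2)])
  have "\<nu> v * \<nu> (inverse v) = 1" using v iv \<nu>_mult[OF v(1) iv] \<nu>_1 by (metis \<nu>_0 right_inverse)
  then have "\<nu> (inverse v) \<noteq> 0" by auto
  moreover have "x / y = of_nat p ^ (a - b) * (u * inverse v)"
    using p_nonzero assms(3) by (simp add: u(3) v(3) power_diff divide_inverse)
  ultimately show ?thesis unfolding has_val_def
    using u(1,2) iv by (intro bexI[of _ "u * inverse v"]) (auto simp: \<nu>_mult R_mult)
qed

lemma has_val_unique: assumes "has_val x a" "has_val x b" shows "a = b"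
proof -
  have "\<not> c < d" if "has_val x c" "has_val x d" for c d
  proof
    assume "c < d"
    have "x / of_nat p ^ d \<in> R" by (rule has_val_div_R[OF that(2)]) simp
    then have "\<nu> 1 = 0" using has_val_div_reduction[OF that(1) \<open>c < d\<close> R_1] by simp
    then show False by (simp add: \<nu>_1)
  qed
  then show ?thesis using assms by (meson linorder_neqE_nat)
qed

text \<open>Membership in \<open>R\<close> alone gives no valuation, but a factor of an element with
  valuation has one: induction on m divides p out of \<open>x\<close> as long as \<open>x\<close>
  reduces to 0.\<close>

lemma has_val_factor:
  assumes "x \<in> R" "y \<in> R" "has_val (x * y) m"
  shows "\<exists>e\<le>m. has_val x e \<and> has_val y (m - e)"
  using assms
proof (induction m arbitrary: x)
  case 0
  then have "\<nu> (x * y) \<noteq> 0" by (auto simp: has_val_def)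
  then show ?case using 0 by (auto simp: \<nu>_mult has_val_0I)
next
  case (Suc m)
  show ?case
  proof (cases "\<nu> x = 0")
    case False
    then have x: "has_val x 0" using Suc.prems by (intro has_val_0I)
    have "has_val (x * y / x) (Suc m - 0)" by (rule has_val_divide[OF Suc.prems(3) x]) simp
    then show ?thesis using x has_val_nonzero[OF x] by auto
  next
    case True
    define x' where "x' = x / of_nat p"
    have x': "x' \<in> R" "x = of_nat p * x'" using \<nu>_eq_0D[OF Suc.prems(1) True] p_nonzero by (auto simp: x'_def)
    have "x' * y = x * y / of_nat p ^ 1" by (simp add: x'_def)
    then have "has_val (x' * y) (Suc m - 1)"
      using has_val_divide[OF Suc.prems(3) has_val_p_power, of 1] by simp
    then obtain e where e: "e \<le> m" "has_val x' e" "has_val y (m - e)"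
      using Suc.IH[OF x'(1) Suc.prems(2)] by auto
    have "has_val x (1 + e)" using has_val_mult[OF has_val_p_power[of 1] e(2)] x'(2) by simp
    then show ?thesis using e by (intro exI[of _ "Suc e"]) auto
  qed
qed

end

text \<open>Here n = q - 1. The condition \<open>k > 1\<close> excludes q = 4 and makes 1 an
  exponent not divisible by k.\<close>

locale cubic_jacobi = jacobi_sums p R \<nu> T n for p R \<nu> T n +
  fixes k t :: nat
  assumes n_eq: "n = 3 * k" and k_gt_1: "k > 1" and p_mod_3: "[p = 2] (mod 3)"
    and q_eq: "Suc n = p ^ (2 * t)" and t_pos: "t > 0"
begin

lemma not_n_dvd: assumes "\<not> k dvd j" "k dvd i" shows "\<not> n dvd j + i"
proof
  assume "n dvd j + i"
  then have "k dvd j + i" by (simp add: n_eq) (metis dvd_mult_right)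
  then show False using assms by (simp add: dvd_add_left_iff)
qed

lemma not_n_dvd_k: "\<not> n dvd k" "\<not> n dvd 2 * k" "\<not> n dvd 4 * k"
proof -
  show "\<not> n dvd k" "\<not> n dvd 2 * k" using k_gt_1 by (auto simp: n_eq dest: dvd_imp_le)
  have "3 * k dvd 4 * k \<longleftrightarrow> (3::nat) dvd 4" using k_gt_1 by simp
  then show "\<not> n dvd 4 * k" by (simp add: n_eq)
qed

lemma ch_cube_minus_1: "ch k (- 1) = 1" "ch (2 * k) (- 1) = 1"
proof -
  have "ch k (- 1) * ch k (- 1) = 1" using ch_mult[of k "- 1" "- 1"] by simp
  moreover have "k + (k + k) = n" by (simp add: n_eq)
  then have "n dvd k + (k + k)" by simp
  then have "ch (k + (k + k)) (- 1) = 1" by (simp only: ch_trivial) simp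
  then have "ch k (- 1) * (ch k (- 1) * ch k (- 1)) = 1" by (simp only: ch_add)
  ultimately show *: "ch k (- 1) = 1" by simp
  have "ch (k + k) (- 1) = 1" by (simp only: ch_add * mult_1)
  then show "ch (2 * k) (- 1) = 1" by (simp add: mult_2)
qed

definition \<gamma> :: complex where "\<gamma> = J k k"

text \<open>Since p = 2 mod 3, multiplication by p sends k to 2 k modulo n, and Jacobi sums are
  invariant under it.\<close>

lemma J_2k_2k: "J (2 * k) (2 * k) = \<gamma>"
proof -
  have "p \<ge> 2" using prime_p by (rule prime_ge_2_nat)
  then obtain c where "p = 2 + 3 * c"
    using p_mod_3 by (metis cong_le_nat add.commute mult.commute)
  then have "p * k = 2 * k + n * c" by (simp add: n_eq algebra_simps)
  then have "[p * k = 2 * k] (mod n)" by (simp add: cong_def)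
  then have "J (p * k) (p * k) = J (2 * k) (2 * k)" by (intro J_cong)
  then show ?thesis by (simp add: J_frobenius \<gamma>_def)
qed

text \<open>The two nontrivial cubic characters \<open>ch k\<close> and \<open>ch (2 * k)\<close> play symmetric roles.\<close>

definition cubic_pair :: "nat \<Rightarrow> nat \<Rightarrow> bool" where
  "cubic_pair x y \<longleftrightarrow> (x = k \<and> y = 2 * k) \<or> (x = 2 * k \<and> y = k)"

lemma cubic_pairD:
  assumes "cubic_pair x y"
  shows "k dvd x" "k dvd y" "n dvd x + y" "\<not> n dvd x" "\<not> n dvd y" "[x + x = y] (mod n)" "[y + y = x] (mod n)"
    "ch x (- 1) = 1" "J x x = \<gamma>" "cubic_pair y x" "\<not> n dvd x + x"
proof -
  have "[2 * k + 2 * k = k] (mod n)"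
  proof -
    have "2 * k + 2 * k = k + n" by (simp add: n_eq)
    then show ?thesis unfolding cong_def by (simp only: mod_add_self2)
  qed
  then show "[x + x = y] (mod n)" "[y + y = x] (mod n)" using assms by (auto simp: cubic_pair_def mult_2)
  show "k dvd x" "k dvd y" "n dvd x + y" "\<not> n dvd x" "\<not> n dvd y" "ch x (- 1) = 1" "J x x = \<gamma>" "cubic_pair y x"
    using assms not_n_dvd_k ch_cube_minus_1 J_2k_2k \<gamma>_def by (auto simp: cubic_pair_def n_eq)
  show "\<not> n dvd x + x" using assms not_n_dvd_k by (auto simp: cubic_pair_def mult_2[symmetric])
qed

lemma J_pair_product:
  assumes "cubic_pair x y" "\<not> k dvd j" shows "J j x * J (j + x) y = of_nat (Suc n)"
proof -
  note c = cubic_pairD[OF assms(1)]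
  have j: "\<not> n dvd j" using not_n_dvd[OF assms(2), of 0] by simp
  have "J x j * J y (x + j) = ch x (- 1) * of_nat (Suc n)"
    using c j not_n_dvd[OF assms(2) c(1)] by (intro J_product) (simp_all add: add.commute)
  then show ?thesis using c by (simp add: J_commute[of j] J_commute[of "j + x"] add.commute)
qed

text \<open>The cocycle relation for x, x, j, in which x + x is y modulo n.\<close>

lemma J_pair_square:
  assumes "cubic_pair x y" "\<not> k dvd j" shows "J j x * J (j + x) x = \<gamma> * J j y"
proof -
  note c = cubic_pairD[OF assms(1)]
  have "J x x * J (x + x) j = J x j * J x (x + j)"
    using c not_n_dvd[OF assms(2) c(1)] by (intro J_cocycle) (simp_all add: add.commute)
  moreover have "J (x + x) j = J y j" using c by (intro J_cong) auto
  ultimately show ?thesis using c by (simp add: J_commute[of j] J_commute[of "j + x"] add.commute)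
qed

lemma J_shift:
  assumes "cubic_pair x y" shows "J (j + x + x) z = J (j + y) z" "J (j + x + y) z = J j z"
proof -
  note c = cubic_pairD[OF assms(1)]
  have "[j + (x + x) = j + y] (mod n)" using c by (intro cong_add) auto
  then show "J (j + x + x) z = J (j + y) z" by (intro J_cong) (simp_all add: add.assoc)
  have "[j + (x + y) = j + 0] (mod n)" using c by (intro cong_add) (auto simp: cong_def)
  then show "J (j + x + y) z = J j z" by (intro J_cong) (simp_all add: add.assoc)
qed

text \<open>Multiplying the relations around the block of exponents 1, 1 + k, 1 + 2 k lets the
  nonzero factor \<open>J 1 k\<close> cancel.\<close>

lemma \<gamma>_square: "\<gamma> ^ 2 = of_nat (Suc n)"
proof -
  have k1: "\<not> k dvd 1" using k_gt_1 by simp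
  have c: "cubic_pair k (2 * k)" by (simp add: cubic_pair_def)
  note c' = cubic_pairD[OF c]
  have k2: "\<not> k dvd 1 + k" using k1 by (metis dvd_add_left_iff dvd_refl)
  have "J 1 k * J (1 + k) k * J (1 + 2 * k) (2 * k) = \<gamma> * (J 1 (2 * k) * J (1 + 2 * k) (2 * k))"
    using J_pair_square[OF c k1] by simp
  also have "\<dots> = \<gamma> ^ 2 * J 1 k" using J_pair_square[OF c'(10) k1] by (simp add: power2_eq_square)
  also have "J 1 k * J (1 + k) k * J (1 + 2 * k) (2 * k) = J 1 k * of_nat (Suc n)"
    using J_pair_product[OF c k2] by (simp only: J_shift(1)[OF c] mult.assoc)
  finally have "J 1 k * of_nat (Suc n) = J 1 k * \<gamma> ^ 2" by (simp only: mult.commute)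
  moreover have "J 1 k \<noteq> 0" using J_pair_product[OF c k1] by (intro notI) (simp del: of_nat_Suc)
  ultimately show ?thesis by simp
qed

lemma \<gamma>_cases: "\<gamma> = of_nat p ^ t \<or> \<gamma> = - (of_nat p ^ t)"
proof -
  have "of_nat (Suc n) = (of_nat p ^ t :: complex) ^ 2"
    unfolding q_eq by (simp add: power_mult[symmetric] mult.commute)
  then have "\<gamma> ^ 2 = (of_nat p ^ t) ^ 2" using \<gamma>_square by simp
  then show ?thesis by (simp add: power2_eq_iff)
qed

lemma has_val_\<gamma>: "has_val \<gamma> t"
  using \<gamma>_cases has_val_p_power[of t] has_val_uminus by auto

text \<open>The valuation of \<gamma> - 2, a factor of an eigenvalue of 3 times the
  Laplacian.\<close>

definition \<delta> :: nat where "\<delta> = (if p = 2 then 1 else 0)"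

lemma \<gamma>_R: "\<gamma> \<in> R" using has_val_\<gamma> by (rule has_val_R)

lemma \<nu>_\<gamma>: "\<nu> \<gamma> = 0"
proof -
  have "\<nu> (of_nat p ^ t) = 0" using t_pos by (simp add: \<nu>_power R_of_nat \<nu>_p)
  then show ?thesis using \<gamma>_cases by (auto simp: \<nu>_uminus R_power R_of_nat)
qed

lemma has_val_\<gamma>_1: "has_val (\<gamma> + 1) 0"
  by (rule has_val_0I) (auto intro: R_add \<gamma>_R R_1 simp: \<nu>_add \<gamma>_R R_1 \<nu>_\<gamma> \<nu>_1)

lemma of_nat_K_eq_0: "of_nat j = (0::'a) \<longleftrightarrow> p dvd j"
  using of_int_eq_0_iff_dvd[OF prime_p p_eq_0, of "int j"] by simp

lemma has_val_3: "has_val 3 0"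
proof -
  have "\<not> p dvd 3"
  proof
    assume "p dvd 3"
    then have "p \<le> 3" by (rule dvd_imp_le) simp
    with prime_ge_2_nat[OF prime_p] have "p = 2 \<or> p = 3" by auto
    then show False using p_mod_3 \<open>p dvd 3\<close> by (auto simp: cong_def)
  qed
  then show ?thesis using R_of_nat[of 3] \<nu>_of_nat[of 3] of_nat_K_eq_0[of 3] by (intro has_val_0I) auto
qed

text \<open>For odd p the reduction is -2, a unit. For p = 2 the exclusion of q = 4 gives t > 1, so
  4 divides \<gamma> and \<gamma> - 2 is 2 times a unit.\<close>

lemma has_val_\<gamma>_2: "has_val (\<gamma> - 2) \<delta>"
proof (cases "p = 2")
  case False
  have "\<not> p dvd 2" using prime_p False primes_dvd_imp_eq[OF prime_p two_is_prime_nat] by blast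
  then show ?thesis using False R_of_nat[of 2] \<nu>_of_nat[of 2] of_nat_K_eq_0[of 2]
    by (auto simp: \<delta>_def \<nu>_diff \<gamma>_R \<nu>_\<gamma> intro!: has_val_0I R_diff)
next
  case True
  have "t \<noteq> 1" using q_eq True n_eq k_gt_1 by (intro notI) simp
  then have t: "t = Suc (t - 1)" "t - 1 > 0" using t_pos by auto
  have "\<exists>u\<in>R. \<nu> u = 0 \<and> \<gamma> = of_nat p * u"
    using \<gamma>_cases
  proof
    assume "\<gamma> = of_nat p ^ t"
    then have "\<gamma> = of_nat p * of_nat p ^ (t - 1)" using t(1) by (metis power_Suc)
    then show ?thesis using t(2) by (intro bexI[of _ "of_nat p ^ (t - 1)"]) (auto simp: \<nu>_power R_power R_of_nat \<nu>_p)
  next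
    assume "\<gamma> = - (of_nat p ^ t)"
    then have "\<gamma> = of_nat p * - (of_nat p ^ (t - 1))" using t(1) by (metis power_Suc mult_minus_right)
    then show ?thesis using t(2) by (intro bexI[of _ "- (of_nat p ^ (t - 1))"])
      (auto simp: \<nu>_uminus \<nu>_power R_uminus R_power R_of_nat \<nu>_p)
  qed
  then obtain u where u: "u \<in> R" "\<nu> u = 0" "\<gamma> = of_nat p * u" by blast
  have d1: "\<delta> = 1" unfolding \<delta>_def using True by simp
  have "\<gamma> - 2 = of_nat p ^ \<delta> * (u - 1)" unfolding d1 u(3) using True by (simp add: algebra_simps)
  then show ?thesis unfolding has_val_def using u
    by (intro bexI[of _ "u - 1"]) (auto simp: \<nu>_diff R_1 \<nu>_1 R_diff)
qed

definition cube_ind :: "'a \<Rightarrow> complex" where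
  "cube_ind z = of_bool (z ^ k = 1)"

definition lap :: "('a \<Rightarrow> complex) \<Rightarrow> 'a \<Rightarrow> complex" where
  "lap f x = of_nat k * f x - (\<Sum>y\<in>UNIV. cube_ind (x - y) * f y)"

text \<open>For nonzero z, w = \<open>ch k z\<close> is a cube root of unity, equal to 1 exactly if
  z^k = 1; and 1 + w + w^2 is 3 or 0 accordingly.\<close>

lemma cube_indicator: "3 * cube_ind z = ch 0 z + ch k z + ch (2 * k) z"
proof (cases "z = 0")
  case True
  then show ?thesis using k_gt_1 by (simp add: cube_ind_def power_0_left)
next
  case False
  define w where "w = ch k z"
  have w2: "ch (2 * k) z = w * w" using ch_add[of k k z] by (simp add: w_def mult_2)
  have w3: "w * w * w = 1" using ch_add[of "2 * k" k z] w2 ch_trivial[of n z] False by (simp add: w_def n_eq)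
  have w1: "w = 1 \<longleftrightarrow> z ^ k = 1"
  proof
    assume "w = 1"
    then have "\<nu> w = 1" by (simp add: \<nu>_1)
    then have "inverse z ^ k = 1" using False by (simp add: w_def \<nu>_ch)
    then show "z ^ k = 1" by (simp add: power_inverse)
  next
    assume "z ^ k = 1"
    then have "T z ^ k = 1" using T_power_nat[OF False, of k] T_1 by simp
    then show "w = 1" using False by (simp add: w_def ch_def power_inverse)
  qed
  show ?thesis
  proof (cases "w = 1")
    case True
    then show ?thesis using w1 w2 False by (simp add: cube_ind_def w_def[symmetric] ch_trivial)
  next
    case F: False
    have "(w - 1) * (1 + w + w * w) = w * w * w - 1" by (simp add: algebra_simps)
    then have "1 + w + w * w = 0" using w3 F by simp
    then show ?thesis using w1 w2 False F by (simp add: cube_ind_def w_def[symmetric] ch_trivial)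
  qed
qed

lemma lap_3: "3 * lap f x = of_nat n * f x - ((\<Sum>y\<in>UNIV. f y * ch 0 (x - y)) + (\<Sum>y\<in>UNIV. f y * ch k (x - y))
    + (\<Sum>y\<in>UNIV. f y * ch (2 * k) (x - y)))"
proof -
  have "3 * lap f x = of_nat n * f x - (\<Sum>y\<in>UNIV. (3 * cube_ind (x - y)) * f y)"
    by (simp add: lap_def n_eq right_diff_distrib sum_distrib_left mult.assoc)
  also have "(\<Sum>y\<in>UNIV. (3 * cube_ind (x - y)) * f y) =
      (\<Sum>y\<in>UNIV. f y * ch 0 (x - y) + f y * ch k (x - y) + f y * ch (2 * k) (x - y))"
    unfolding cube_indicator by (intro sum.cong) (simp_all add: algebra_simps)
  finally show ?thesis by (simp add: sum.distrib)
qed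

lemma lap_add: "lap (\<lambda>x. f x + g x) x = lap f x + lap g x"
  by (simp add: lap_def algebra_simps sum.distrib)

lemma lap_scale: "lap (\<lambda>x. c * f x) x = c * lap f x"
  by (simp add: lap_def algebra_simps sum_distrib_left)

lemma J_0: assumes "\<not> n dvd j" shows "J j 0 = - 1"
proof -
  have "J j 0 = (\<Sum>x\<in>UNIV. ch j x - (if x = 1 then 1 else 0))"
    unfolding J_def by (intro sum.cong) (auto simp: ch_trivial)
  also have "\<dots> = (\<Sum>x\<in>UNIV. ch j x) - 1" by (simp add: sum_subtractf)
  finally show ?thesis using assms by (simp add: sum_ch)
qed

text \<open>Convolution with \<open>ch 0\<close> contributes \<open>J j 0 = - 1\<close>, which turns
  the coefficient n into q = n + 1.\<close>

lemma lap_ch: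
  assumes "\<not> k dvd j"
  shows "3 * lap (ch j) x = of_nat (Suc n) * ch j x - J j k * ch (j + k) x - J j (2 * k) * ch (j + 2 * k) x"
proof -
  have "\<not> n dvd j" "\<not> n dvd j + k" "\<not> n dvd j + 2 * k"
    using not_n_dvd[OF assms, of 0] not_n_dvd[OF assms] by auto
  then show ?thesis unfolding lap_3 ch_conv by (simp add: J_0 algebra_simps)
qed

lemma lap_ch_pair:
  assumes "cubic_pair u v" "\<not> k dvd j"
  shows "3 * lap (ch j) x = of_nat (Suc n) * ch j x - J j u * ch (j + u) x - J j v * ch (j + v) x"
  using assms(1) unfolding cubic_pair_def lap_ch[OF assms(2)] by auto

lemma lap_1: "lap (\<lambda>x. 1) x = 0"
proof -
  have *: "(\<Sum>y\<in>UNIV. 1 * ch j (x - y)) = (\<Sum>y\<in>UNIV. ch j y)" for j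
    by (rule sum.reindex_bij_witness[of _ "\<lambda>y. x - y" "\<lambda>y. x - y"]) simp_all
  have "3 * lap (\<lambda>x. 1) x = 0" unfolding lap_3 * using not_n_dvd_k by (simp add: sum_ch)
  then show ?thesis by simp
qed

lemma lap_delta: "3 * lap (\<lambda>x. of_bool (x = 0)) x = of_nat (Suc n) * of_bool (x = 0) - 1 - ch k x - ch (2 * k) x"
proof -
  have *: "(\<Sum>y\<in>UNIV. of_bool (y = 0) * ch j (x - y)) = ch j x" for j
  proof -
    have "(\<Sum>y\<in>UNIV. of_bool (y = 0) * ch j (x - y)) = (\<Sum>y\<in>UNIV. if y = (0::'a) then ch j x else 0)"
      by (intro sum.cong) auto
    then show ?thesis by simp
  qed
  show ?thesis unfolding lap_3 * by (simp add: ch_trivial algebra_simps)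
qed

text \<open>Convolution with the inverse character meets the correction at 0 and produces the delta
  function. This is why the exponents k and 2 k need a separate treatment.\<close>

lemma lap_ch_cubic:
  assumes "cubic_pair u v"
  shows "3 * lap (ch u) x = of_nat (Suc n) * ch u x + 1 - of_nat (Suc n) * of_bool (x = 0) - \<gamma> * ch v x"
proof -
  note c = cubic_pairD[OF assms]
  have Juv: "J u v = - 1" using J_inverse[OF c(3,4)] cubic_pairD(8)[OF c(10)] by simp
  have s0: "(\<Sum>y\<in>UNIV. ch u y * ch 0 (x - y)) = - ch u x"
    unfolding ch_conv using c by (simp add: J_0)
  have su: "(\<Sum>y\<in>UNIV. ch u y * ch u (x - y)) = \<gamma> * ch v x"
    unfolding ch_conv using c ch_cong[OF c(6)] by simp
  have sv: "(\<Sum>y\<in>UNIV. ch u y * ch v (x - y)) = of_nat (Suc n) * of_bool (x = 0) - 1"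
    unfolding ch_conv using c cubic_pairD(8)[OF c(10)] by (auto simp: Juv ch_trivial)
  have "3 * lap (ch u) x = of_nat n * ch u x - ((\<Sum>y\<in>UNIV. ch u y * ch 0 (x - y)) + ((\<Sum>y\<in>UNIV. ch u y * ch u (x - y))
    + (\<Sum>y\<in>UNIV. ch u y * ch v (x - y))))"
    using assms unfolding cubic_pair_def lap_3 by auto
  then show ?thesis unfolding s0 su sv by (simp add: algebra_simps)
qed

end

section \<open>Spans over the valuation ring and their reductions\<close>

context teichmueller_lift
begin

inductive_set rspan :: "('a \<Rightarrow> complex) set \<Rightarrow> ('a \<Rightarrow> complex) set" for F where
  base: "f \<in> F \<Longrightarrow> f \<in> rspan F"
| add: "f \<in> rspan F \<Longrightarrow> g \<in> rspan F \<Longrightarrow> (\<lambda>x. f x + g x) \<in> rspan F"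
| scale: "c \<in> R \<Longrightarrow> f \<in> rspan F \<Longrightarrow> (\<lambda>x. c * f x) \<in> rspan F"

lemma rspan_mono: assumes "F \<subseteq> G" shows "rspan F \<subseteq> rspan G"
proof
  fix f assume "f \<in> rspan F"
  then show "f \<in> rspan G" by induction (use assms in \<open>auto intro: rspan.intros\<close>)
qed

lemma rspan_comb:
  assumes "f \<in> rspan F" "g \<in> rspan F" "h \<in> rspan F" "a \<in> R" "b \<in> R" "c \<in> R"
    and "\<And>x. l x = a * f x + b * g x + c * h x"
  shows "l \<in> rspan F"
proof -
  have "(\<lambda>x. (a * f x + b * g x) + c * h x) \<in> rspan F"
    using assms by (intro rspan.add rspan.scale) auto
  moreover have "l = (\<lambda>x. (a * f x + b * g x) + c * h x)" using assms(7) by auto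
  ultimately show ?thesis by simp
qed

definition red :: "('a \<Rightarrow> complex) \<Rightarrow> ('a, 'a) vec" where
  "red f = (\<chi> x. \<nu> (f x))"

lemma red_rspan:
  assumes "f \<in> rspan F" and F: "\<And>g x. g \<in> F \<Longrightarrow> g x \<in> R"
  shows "(\<forall>x. f x \<in> R) \<and> red f \<in> vec.span (red ` F)"
  using assms(1)
proof induction
  case (base f)
  then show ?case using F by (auto intro: vec.span_base)
next
  case (add f g)
  then have "red (\<lambda>x. f x + g x) = red f + red g" by (simp add: red_def vec_eq_iff \<nu>_add)
  then show ?case using add by (auto intro: R_add vec.span_add)
next
  case (scale c f)
  then have "red (\<lambda>x. c * f x) = \<nu> c *s red f" by (simp add: red_def vec_eq_iff \<nu>_mult)
  then show ?case using scale by (auto intro: R_mult vec.span_scale)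
qed

end

context cubic_jacobi
begin

lemma scale_3: "3 * z = w * c \<Longrightarrow> z = w / 3 * (c::complex)"
  by (simp add: mult.commute)

text \<open>\<open>b\<close> is to be part of a basis of the source and \<open>c\<close> of the
  target, with diagonal entries \<open>D\<close> between them. Both must generate \<open>E\<close>
  over \<open>R\<close>; that the families so assembled are bases follows later from their
  reductions, by counting.\<close>

definition adapted where
  "adapted E b c D \<longleftrightarrow> (\<forall>i<3. \<forall>x. b i x \<in> R \<and> c i x \<in> R \<and> lap (b i) x = D i * c i x) \<and>
     E \<subseteq> rspan (b ` {..<3::nat}) \<and> E \<subseteq> rspan (c ` {..<3})"

lemma less_3_iff: "(i::nat) < 3 \<longleftrightarrow> i = 0 \<or> i = 1 \<or> i = 2" by auto

definition pick3 :: "'b \<Rightarrow> 'b \<Rightarrow> 'b \<Rightarrow> nat \<Rightarrow> 'b" where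
  "pick3 x y z i = (if i = 0 then x else if i = 1 then y else z)"

lemma pick3_simps [simp]: "pick3 x y z 0 = x" "pick3 x y z (Suc 0) = y" "pick3 x y z 2 = z"
  by (simp_all add: pick3_def)

lemma pick3_image: "pick3 x y z ` {..<3} = {x, y, z}"
  by (auto simp: less_3_iff image_iff pick3_def intro: bexI[of _ "0::nat"] bexI[of _ "1::nat"] bexI[of _ "2::nat"])

lemma has_val_inverse_3: "has_val x e \<Longrightarrow> has_val (x / 3) e"
  using has_val_divide[OF _ has_val_3, of x e] by simp

text \<open>With \<open>\<lambda> = \<gamma> / J j u\<close>, the function \<open>ch (j + u) - \<lambda> ch j\<close> is an eigenvector, while the quadratic relation
  satisfied by the Laplacian produces the largest elementary divisor.\<close>

lemma adapted_block_ordered: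
  assumes c: "cubic_pair u v" and j: "\<not> k dvd j"
    and A: "has_val (J j u) A" "A \<le> t" and B: "has_val (J j v) B" "B \<le> A"
  shows "\<exists>b c D. adapted {ch j, ch (j + u), ch (j + v)} b c D \<and>
    has_val (D 0) B \<and> has_val (D 1) t \<and> has_val (D 2) (2 * t + \<delta> - B)"
proof -
  note cD = cubic_pairD[OF c]
  define q where "q = (of_nat (Suc n) :: complex)"
  define a where "a = J j u"
  define b where "b = J j v"
  define P where "P = (of_nat p ^ B :: complex)"
  have qg: "q = \<gamma> * \<gamma>" using \<gamma>_square by (simp add: q_def power2_eq_square)
  have P: "has_val P B" unfolding P_def by (rule has_val_p_power)
  have nz: "a \<noteq> 0" "b \<noteq> 0" "P \<noteq> 0" "\<gamma> \<noteq> 0" "\<gamma> + 1 \<noteq> 0"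
    using A B P has_val_\<gamma> has_val_\<gamma>_1 by (auto simp: a_def b_def dest: has_val_nonzero)
  define lm where "lm = \<gamma> / a"
  have lmR: "lm \<in> R" unfolding lm_def a_def by (rule has_val_R[OF has_val_divide[OF has_val_\<gamma> A]])
  have aP: "a / P \<in> R" unfolding a_def by (rule has_val_R[OF has_val_divide[OF A(1) P B(2)]])
  have bP: "b / P \<in> R" unfolding b_def by (rule has_val_R[OF has_val_divide[OF B(1) P]]) simp
  have Pb: "P / b \<in> R" unfolding b_def by (rule has_val_R[OF has_val_divide[OF P B(1)]]) simp
  have gP: "\<gamma> / P \<in> R" by (rule has_val_R[OF has_val_divide[OF has_val_\<gamma> P]]) (use A B in simp)
  have qP: "q / P \<in> R" using R_mult[OF gP \<gamma>_R] by (simp add: qg)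
  have j1: "\<not> k dvd j + u" "\<not> k dvd j + v" using j cD by (simp_all add: dvd_add_left_iff)
  have L1: "3 * lap (ch j) x = q * ch j x - a * ch (j + u) x - b * ch (j + v) x" for x
    using lap_ch_pair[OF c j, of x] by (simp only: q_def a_def b_def)
  have chs: "ch (j + u + u) = ch (j + v)" "ch (j + u + v) = ch j" "ch (j + v + v) = ch (j + u)" "ch (j + v + u) = ch j"
  proof -
    have "[j + (u + u) = j + v] (mod n)" "[j + (u + v) = j + 0] (mod n)" "[j + (v + v) = j + u] (mod n)"
      using cD by (intro cong_add cong_refl; auto simp: cong_def)+
    then show "ch (j + u + u) = ch (j + v)" "ch (j + u + v) = ch j" "ch (j + v + v) = ch (j + u)" "ch (j + v + u) = ch j"
      using ch_cong by (metis add.assoc add_0_right add.commute)+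
  qed
  have s1: "J (j + u) u = \<gamma> * b / a" using J_pair_square[OF c j] nz by (simp add: a_def b_def field_simps)
  have s2: "J (j + u) v = q / a" using J_pair_product[OF c j] nz by (simp add: a_def q_def field_simps del: of_nat_Suc)
  have s3: "J (j + v) v = \<gamma> * a / b" using J_pair_square[OF cD(10) j] nz by (simp add: a_def b_def field_simps)
  have s4: "J (j + v) u = q / b" using J_pair_product[OF cD(10) j] nz by (simp add: b_def q_def field_simps del: of_nat_Suc)
  have L2: "3 * lap (ch (j + u)) x = q * ch (j + u) x - (\<gamma> * b / a) * ch (j + v) x - (q / a) * ch j x" for x
    using lap_ch_pair[OF c j1(1), of x] unfolding chs s1 s2 q_def[symmetric] .
  have L3: "3 * lap (ch (j + v)) x = q * ch (j + v) x - (q / b) * ch j x - (\<gamma> * a / b) * ch (j + u) x" for x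
    using lap_ch_pair[OF c j1(2), of x] unfolding chs s3 s4 q_def[symmetric] .
  \<comment> \<open>An eigenvector for \<gamma> (\<gamma> + 1) / 3. Its coefficient
    \<open>lm\<close> lies in \<open>R\<close> because \<open>A \<le> t\<close>.\<close>
  define b1 where "b1 = (\<lambda>x. 1 * ch (j + u) x + (- lm) * ch j x)"
  \<comment> \<open>On the block M = 3 L satisfies M (M - (2 q - \<gamma>)) = - \<gamma>^2 (\<gamma>
    + 1) (\<gamma> - 2), where 2 q - \<gamma> is the sum of the two eigenvalues. \<open>b2\<close>
    is M - (2 q - \<gamma>) applied to \<open>ch j\<close>, divided by \<open>P\<close>; hence its
    image is a multiple of \<open>ch j\<close>.\<close>
  define b2 where "b2 = (\<lambda>x. ((\<gamma> - q) / P) * ch j x + ((- a / P) * ch (j + u) x + (- b / P) * ch (j + v) x))"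
  define c0 where "c0 = (\<lambda>x. (q / P) * ch j x + ((- a / P) * ch (j + u) x + (- b / P) * ch (j + v) x))"
  have R': "(\<gamma> - q) / P \<in> R" "- a / P \<in> R" "- b / P \<in> R"
    using R_diff[OF gP qP] R_uminus[OF aP] R_uminus[OF bP] by (simp_all add: diff_divide_distrib)
  have rest: "b1 x \<in> R" "b2 x \<in> R" "c0 x \<in> R" for x
    unfolding b1_def b2_def c0_def by (intro R_closed R' lmR qP ch_R)+
  have E0: "lap (ch j) x = (P / 3) * c0 x" for x
  proof -
    have "P * c0 x = q * ch j x - a * ch (j + u) x - b * ch (j + v) x"
      using nz by (simp add: c0_def field_simps)
    then have "3 * lap (ch j) x = P * c0 x" unfolding L1 by simp
    then show ?thesis by (simp add: mult.commute)
  qed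
  have E1: "lap b1 x = (\<gamma> * (\<gamma> + 1) / 3) * b1 x" for x
  proof -
    have "3 * lap b1 x = 1 * (3 * lap (ch (j + u)) x) + (- lm) * (3 * lap (ch j) x)"
      unfolding b1_def by (simp only: lap_add lap_scale) (simp add: algebra_simps)
    also have "\<dots> = (\<gamma> * (\<gamma> + 1)) * b1 x"
      unfolding L1 L2 b1_def lm_def qg using nz by (simp add: field_simps)
    finally show ?thesis by (rule scale_3)
  qed
  have E2: "lap b2 x = (- (\<gamma> * \<gamma> * (\<gamma> + 1) * (\<gamma> - 2) / P) / 3) * ch j x" for x
  proof -
    have "3 * lap b2 x = ((\<gamma> - q) / P) * (3 * lap (ch j) x) + ((- a / P) * (3 * lap (ch (j + u)) x) + (- b / P) * (3 * lap (ch (j + v)) x))"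
      unfolding b2_def by (simp only: lap_add lap_scale) (simp add: algebra_simps)
    also have "\<dots> = (- (\<gamma> * \<gamma> * (\<gamma> + 1) * (\<gamma> - 2) / P)) * ch j x"
      unfolding L1 L2 L3 qg using nz by (simp add: field_simps)
    finally show ?thesis by (rule scale_3)
  qed
  define D where "D = pick3 (P / 3) (\<gamma> * (\<gamma> + 1) / 3) (- (\<gamma> * \<gamma> * (\<gamma> + 1) * (\<gamma> - 2) / P) / 3)"
  have ad: "adapted {ch j, ch (j + u), ch (j + v)} (pick3 (ch j) b1 b2) (pick3 c0 b1 (ch j)) D"
  proof -
    have u1: "1 \<in> R" "0 \<in> R" by (auto intro: R_1)
    let ?B = "{ch j, b1, b2}" and ?C = "{c0, b1, ch j}"
    have g1: "ch j \<in> rspan ?B" "ch j \<in> rspan ?C" by (auto intro: rspan.base)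
    have b1: "b1 \<in> rspan ?B" "b1 \<in> rspan ?C" "b2 \<in> rspan ?B" "c0 \<in> rspan ?C" by (auto intro: rspan.base)
    have g2: "ch (j + u) \<in> rspan ?B"
      by (rule rspan_comb[OF b1(1) g1(1) g1(1) u1(1) lmR u1(2)]) (simp add: b1_def)
    have g2': "ch (j + u) \<in> rspan ?C"
      by (rule rspan_comb[OF b1(2) g1(2) g1(2) u1(1) lmR u1(2)]) (simp add: b1_def)
    have Pbm: "- (P / b) \<in> R" by (rule R_uminus[OF Pb])
    have g3: "ch (j + v) \<in> rspan ?B"
      by (rule rspan_comb[OF b1(3) g1(1) g2 Pbm R_mult[OF Pb R'(1)] R_mult[OF Pb R'(2)]])
         (use nz in \<open>simp add: b2_def field_simps\<close>)
    have g3': "ch (j + v) \<in> rspan ?C"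
      by (rule rspan_comb[OF b1(4) g1(2) g2' Pbm R_mult[OF Pb qP] R_mult[OF Pb R'(2)]])
         (use nz in \<open>simp add: c0_def field_simps\<close>)
    show ?thesis unfolding adapted_def pick3_image
      using g1 g2 g2' g3 g3' rest E0 E1 E2 by (auto simp: less_3_iff D_def ch_R)
  qed
  have d0: "has_val (D 0) B" using P by (simp add: D_def has_val_inverse_3)
  have d1: "has_val (D 1) t"
    using has_val_mult[OF has_val_\<gamma> has_val_\<gamma>_1] by (simp add: D_def has_val_inverse_3)
  have d2: "has_val (D 2) (2 * t + \<delta> - B)"
  proof -
    have "has_val (\<gamma> * \<gamma> * (\<gamma> + 1) * (\<gamma> - 2)) (t + t + 0 + \<delta>)"
      by (intro has_val_mult has_val_\<gamma> has_val_\<gamma>_1 has_val_\<gamma>_2)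
    then have "has_val (\<gamma> * \<gamma> * (\<gamma> + 1) * (\<gamma> - 2) / P) (t + t + 0 + \<delta> - B)"
      using A B by (intro has_val_divide[OF _ P]) auto
    then have "has_val (D 2) (t + t + 0 + \<delta> - B)"
      unfolding D_def pick3_simps by (intro has_val_inverse_3 has_val_uminus)
    then show ?thesis by (simp add: mult_2)
  qed
  show ?thesis using ad d0 d1 d2 by blast
qed

text \<open>The cubic character whose Jacobi sum has the smaller valuation takes the role of
  \<open>v\<close>, which reduces both cases to the ordered one.\<close>

lemma adapted_block:
  assumes j: "\<not> k dvd j" and A: "has_val (J j k) A" "A \<le> t" and B: "has_val (J j (2 * k)) B" "B \<le> t"
  shows "\<exists>b c D. adapted {ch j, ch (j + k), ch (j + 2 * k)} b c D \<and>
    has_val (D 0) (min A B) \<and> has_val (D 1) t \<and> has_val (D 2) (2 * t + \<delta> - min A B)"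
proof (cases "B \<le> A")
  case True
  have "cubic_pair k (2 * k)" by (simp add: cubic_pair_def)
  from adapted_block_ordered[OF this j A B(1) True] show ?thesis using True by (simp add: min_absorb2)
next
  case False
  have "cubic_pair (2 * k) k" by (simp add: cubic_pair_def)
  from adapted_block_ordered[OF this j B A(1)] show ?thesis using False
    by (simp add: min_absorb1 insert_commute)
qed

text \<open>The combination is chosen so that the constant, the delta function and
  \<open>ch k\<close> cancel in the image. It carries the elementary divisor of valuation t +
  \<delta> in the exceptional part.\<close>

lemma lap_special:
  "lap (\<lambda>x. ch k x + (\<gamma> - 1) * ch (2 * k) x + \<gamma> * of_bool (x = 0)) x = (\<gamma> * (\<gamma> + 1) * (\<gamma> - 2) / 3) * ch (2 * k) x"
proof -
  have c: "cubic_pair k (2 * k)" "cubic_pair (2 * k) k" by (simp_all add: cubic_pair_def)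
  have qg: "of_nat (Suc n) = \<gamma> * \<gamma>" using \<gamma>_square by (simp add: power2_eq_square)
  have "3 * lap (\<lambda>x. ch k x + (\<gamma> - 1) * ch (2 * k) x + \<gamma> * of_bool (x = 0)) x =
     3 * lap (ch k) x + (\<gamma> - 1) * (3 * lap (ch (2 * k)) x) + \<gamma> * (3 * lap (\<lambda>x. of_bool (x = 0)) x)"
    by (simp only: lap_add lap_scale) (simp add: algebra_simps)
  also have "\<dots> = (\<gamma> * (\<gamma> + 1) * (\<gamma> - 2)) * ch (2 * k) x"
    unfolding lap_ch_cubic[OF c(1)] lap_ch_cubic[OF c(2)] lap_delta qg by (simp add: algebra_simps)
  finally show ?thesis by (rule scale_3)
qed

text \<open>Modulo p the function \<open>ch j\<close> with 0 < j < n is the monomial x^(n-j), and 1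
  minus the delta function is x^n. So all monomials of degree at most n are reached, and the
  indicator function of a point a is 1 - (x - a)^n.\<close>

lemma span_reductions:
  assumes F: "\<And>f x. f \<in> F \<Longrightarrow> f x \<in> R"
    and E: "(\<lambda>x. 1) \<in> rspan F" "(\<lambda>x. of_bool (x = 0)) \<in> rspan F" "\<And>j. 0 < j \<Longrightarrow> j < n \<Longrightarrow> ch j \<in> rspan F"
  shows "vec.span (red ` F) = UNIV"
proof -
  have rr: "red f \<in> vec.span (red ` F)" if "f \<in> rspan F" for f
    using red_rspan[OF that] F by blast
  have mon: "(\<chi> x::'a. x ^ m) \<in> vec.span (red ` F)" if m_le: "m \<le> n" for m
  proof -
    have one: "(\<chi> x::'a. 1) \<in> vec.span (red ` F)"
      using rr[OF E(1)] by (simp add: red_def \<nu>_1)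
    have z: "(\<chi> x::'a. of_bool (x = 0)) \<in> vec.span (red ` F)"
    proof -
      have "red (\<lambda>x. of_bool (x = 0)) = (\<chi> x::'a. of_bool (x = 0))"
        by (auto simp: red_def vec_eq_iff \<nu>_1)
      then show ?thesis using rr[OF E(2)] by simp
    qed
    consider "m = 0" | "0 < m" "m < n" | "m = n" using m_le by linarith
    then show ?thesis
    proof cases
      case 1 then show ?thesis using one by simp
    next
      case 2
      have "red (ch (n - m)) = (\<chi> x::'a. x ^ m)"
      proof -
        have "inverse x ^ (n - m) = x ^ m" if "x \<noteq> 0" for x :: 'a
        proof -
          have "x ^ m * x ^ (n - m) = 1" using 2 power_n[OF that] by (simp flip: power_add)
          then show ?thesis using that by (simp add: power_inverse field_simps inverse_eq_divide)
        qed
        then show ?thesis using 2 by (auto simp: red_def vec_eq_iff \<nu>_ch power_0_left)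
      qed
      then show ?thesis using rr[OF E(3)[of "n - m"]] 2 by simp
    next
      case 3
      have "(\<chi> x::'a. x ^ m) = (\<chi> x. 1) - (\<chi> x. of_bool (x = 0))"
        using n_pos power_n by (auto simp: vec_eq_iff 3 power_0_left)
      then show ?thesis using vec.span_diff[OF one z] by simp
    qed
  qed
  have ax: "axis a 1 \<in> vec.span (red ` F)" for a :: 'a
  proof -
    have "(axis a 1 :: ('a, 'a) vec) = (\<chi> x. 1 - (x - a) ^ n)"
      using n_pos power_n by (auto simp: vec_eq_iff axis_def power_0_left)
    also have "\<dots> = (\<chi> x. x ^ 0) - (\<Sum>m\<le>n. (of_nat (n choose m) * (- a) ^ (n - m)) *s (\<chi> x. x ^ m))"
    proof -
      have "(x - a) ^ n = (\<Sum>m\<le>n. of_nat (n choose m) * x ^ m * (- a) ^ (n - m))" for x :: 'a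
        using binomial_ring[of x "- a" n] by simp
      then show ?thesis by (simp add: vec_eq_iff sum_component mult_ac)
    qed
    also have "\<dots> \<in> vec.span (red ` F)"
      by (intro vec.span_diff vec.span_sum vec.span_scale mon) auto
    finally show ?thesis .
  qed
  have "v \<in> vec.span (red ` F)" for v
  proof -
    have "v = (\<Sum>i\<in>UNIV. v $ i *s axis i 1)" by (rule basis_expansion[symmetric])
    then show ?thesis by (metis (no_types, lifting) ax vec.span_scale vec.span_sum)
  qed
  then show ?thesis by blast
qed

end

lemma subgroup_units_eq_roots_of_unity:
  fixes S :: "'a::{field,finite} set"
  assumes S: "subgroup S units_group" "card S = k" and k: "k > 0"
  shows "S = {z. z ^ k = 1}"
proof -
  have fin: "finite S" by simp
  have S0: "0 \<notin> S" using subgroup.subset[OF S(1)] by (auto simp: units_group_def)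
  have sub: "S \<subseteq> {z. z ^ k = 1}"
  proof
    fix x assume x: "x \<in> S"
    have im: "(*) x ` S \<subseteq> S" using subgroup.m_closed[OF S(1) x] by (auto simp: units_group_def)
    have inj: "inj_on ((*) x) S" using x S0 by (auto intro: inj_onI)
    have "(*) x ` S = S" by (rule endo_inj_surj[OF fin im inj])
    then have "(\<Prod>y\<in>S. y) = (\<Prod>y\<in>S. x * y)" using prod.reindex[OF inj, of "\<lambda>y. y"] by simp
    also have "\<dots> = x ^ k * (\<Prod>y\<in>S. y)" by (simp add: prod.distrib S)
    finally have "x ^ k = 1" using S0 by auto
    then show "x \<in> {z. z ^ k = 1}" by simp
  qed
  have deg: "degree (monom 1 k - 1 :: 'a poly) = k"
    using k degree_add_eq_left[of "- 1 :: 'a poly" "monom 1 k"] by (simp add: degree_monom_eq)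
  then have "monom 1 k - 1 \<noteq> (0 :: 'a poly)" using k by auto
  from card_poly_roots_bound[OF this] have "card {z::'a. z ^ k = 1} \<le> card S"
    using deg S by (simp add: poly_monom)
  then show ?thesis using card_seteq[OF _ sub] by simp
qed

section \<open>Assembling the blocks\<close>

context cubic_jacobi
begin

text \<open>Index (r, i) is the i-th vector of the block of exponents congruent to r modulo k. The
  class r = 0 stands for the exceptional part, with valuations 0, 0, t + \<delta>; the constant
  function, with diagonal entry 0, is kept outside.\<close>

definition block_exp :: "(nat \<Rightarrow> nat) \<Rightarrow> nat \<times> nat \<Rightarrow> nat" where
  "block_exp \<mu> = (\<lambda>(r, i). if r = 0 then (if i = 2 then t + \<delta> else 0)
     else if i = 0 then \<mu> r else if i = 1 then t else 2 * t + \<delta> - \<mu> r)"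

text \<open>In each nonzero residue class modulo k, \<open>\<rho>\<close> selects an exponent at
  which both valuations are at most t, as \<open>adapted_block\<close> requires. The summand 1
  counts the zero diagonal entry, which every power of p divides.\<close>

lemma laplacian_elementary_divisors:
  fixes S :: "'a set" and U V :: "((int, 'a) vec, 'a) vec"
  assumes S: "S = {z. z ^ k = 1}"
    and UV: "invertible U" "invertible V"
      "U ** regular_laplacian k (cayley_adj S) ** V = (\<chi> i j. if i = j then d i else 0)"
    and \<rho>: "\<And>r. 0 < r \<Longrightarrow> r < k \<Longrightarrow> \<rho> r mod k = r"
    and A: "\<And>r. 0 < r \<Longrightarrow> r < k \<Longrightarrow> has_val (J (\<rho> r) k) (A r) \<and> A r \<le> t"
    and B: "\<And>r. 0 < r \<Longrightarrow> r < k \<Longrightarrow> has_val (J (\<rho> r) (2 * k)) (B r) \<and> B r \<le> t"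
  shows "card {i. int p ^ m dvd d i} =
    card {z \<in> {..<k} \<times> {..<3}. m \<le> block_exp (\<lambda>r. min (A r) (B r)) z} + 1"
proof -
  define \<mu> where "\<mu> r = min (A r) (B r)" for r
  let ?dl = "\<lambda>x::'a. of_bool (x = 0) :: complex"
  have nd: "\<not> k dvd \<rho> r" if "0 < r" "r < k" for r using \<rho>[OF that] that by (auto simp: dvd_eq_mod_eq_0)
  have "\<exists>b c D. adapted {ch (\<rho> r), ch (\<rho> r + k), ch (\<rho> r + 2 * k)} b c D \<and>
      has_val (D 0) (\<mu> r) \<and> has_val (D 1) t \<and> has_val (D 2) (2 * t + \<delta> - \<mu> r)" if "0 < r" "r < k" for r
    unfolding \<mu>_def using adapted_block[OF nd[OF that]] A[OF that] B[OF that] by blast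
  then obtain bs cs Ds where bl: "\<And>r. 0 < r \<Longrightarrow> r < k \<Longrightarrow> adapted {ch (\<rho> r), ch (\<rho> r + k), ch (\<rho> r + 2 * k)} (bs r) (cs r) (Ds r) \<and>
      has_val (Ds r 0) (\<mu> r) \<and> has_val (Ds r 1) t \<and> has_val (Ds r 2) (2 * t + \<delta> - \<mu> r)"
    by metis
  define s0 where "s0 = (\<lambda>x. ch k x + (\<gamma> - 1) * ch (2 * k) x + \<gamma> * ?dl x)"
  define q where "q = (of_nat (Suc n) :: complex)"
  define l1 where "l1 = (\<lambda>x::'a. q * ch (2 * k) x + 1 - q * ?dl x - \<gamma> * ch k x)"
  define l2 where "l2 = (\<lambda>x::'a. q * ?dl x - 1 - ch k x - ch (2 * k) x)"
  \<comment> \<open>The extra index (k, 0) holds the constant function, which L kills. Its target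
    vector is free and is taken to be the delta function, so that \<open>cc\<close> generates
    everything.\<close>
  define bb where "bb = (\<lambda>(r, i). if r = k then (\<lambda>x. 1) else if r = 0 then pick3 (ch (2 * k)) ?dl s0 i else bs r i)"
  define cc where "cc = (\<lambda>(r, i). if r = k then ?dl else if r = 0 then pick3 l1 l2 (ch (2 * k)) i else cs r i)"
  define DD where "DD = (\<lambda>(r, i). if r = k then 0 else if r = 0 then pick3 (1/3) (1/3) (\<gamma> * (\<gamma> + 1) * (\<gamma> - 2) / 3) i else Ds r i)"
  define I where "I = insert (k, 0) ({..<k} \<times> {..<3::nat})"
  have qR: "q \<in> R" unfolding q_def by (rule R_of_nat)
  have dlR: "?dl x \<in> R" for x by (auto intro: R_1)
  have k0: "k \<noteq> 0" using k_gt_1 by simp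
  have g1R: "\<gamma> - 1 \<in> R" by (intro R_diff \<gamma>_R R_1)
  have bcR: "bb z x \<in> R \<and> cc z x \<in> R" if z: "z \<in> I" for z x
  proof -
    obtain r i where ri: "z = (r, i)" by (cases z)
    consider "r = k" | "r = 0" "i < 3" | "0 < r" "r < k" "i < 3" using z ri by (auto simp: I_def)
    then show ?thesis
    proof cases
      case 1 then show ?thesis using dlR by (simp add: ri bb_def cc_def R_1)
    next
      case 2
      have "s0 x \<in> R" "l1 x \<in> R" "l2 x \<in> R" unfolding s0_def l1_def l2_def
        by (intro R_add R_diff R_mult g1R \<gamma>_R ch_R qR R_1 dlR)+
      then show ?thesis using 2 k0 dlR by (auto simp: ri bb_def cc_def less_3_iff ch_R)
    next
      case 3 then show ?thesis using bl[of r] by (auto simp: ri bb_def cc_def adapted_def)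
    qed
  qed
  have lapbb: "lap (bb z) x = DD z * cc z x" if z: "z \<in> I" for z x
  proof -
    obtain r i where ri: "z = (r, i)" by (cases z)
    consider "r = k" | "r = 0" "i < 3" | "0 < r" "r < k" "i < 3" using z ri by (auto simp: I_def)
    then show ?thesis
    proof cases
      case 1 then show ?thesis by (simp add: ri bb_def DD_def lap_1)
    next
      case 2
      have c: "cubic_pair (2 * k) k" by (simp add: cubic_pair_def)
      have "3 * lap (ch (2 * k)) x = 1 * l1 x" "3 * lap ?dl x = 1 * l2 x"
        unfolding lap_ch_cubic[OF c] lap_delta l1_def l2_def q_def by simp_all
      note e = this
      have "lap (ch (2 * k)) x = (1/3) * l1 x" by (rule scale_3[OF e(1)])
      moreover have "lap ?dl x = (1/3) * l2 x" by (rule scale_3[OF e(2)])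
      moreover have "lap s0 x = (\<gamma> * (\<gamma> + 1) * (\<gamma> - 2) / 3) * ch (2 * k) x" unfolding s0_def by (rule lap_special)
      ultimately show ?thesis using 2 k0 by (auto simp: ri bb_def cc_def DD_def less_3_iff)
    next
      case 3 then show ?thesis using bl[of r] by (auto simp: ri bb_def cc_def DD_def adapted_def)
    qed
  qed
  have gen: "ch j \<in> rspan (bb ` I) \<and> ch j \<in> rspan (cc ` I)" if j: "\<not> k dvd j" "j < n" for j
  proof -
    define r where "r = j mod k"
    have r: "0 < r" "r < k" using j k0 by (auto simp: r_def dvd_eq_mod_eq_0)
    have sub: "bs r ` {..<3} \<subseteq> bb ` I" "cs r ` {..<3} \<subseteq> cc ` I"
    proof -
      have "bs r i \<in> bb ` I \<and> cs r i \<in> cc ` I" if "i < 3" for i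
      proof
        have "(r, i) \<in> I" using r that by (simp add: I_def)
        then show "bs r i \<in> bb ` I" "cs r i \<in> cc ` I"
          using r by (auto simp: bb_def cc_def intro!: image_eqI[of _ _ "(r, i)"])
      qed
      then show "bs r ` {..<3} \<subseteq> bb ` I" "cs r ` {..<3} \<subseteq> cc ` I" by auto
    qed
    have "\<exists>i<3. [j = \<rho> r + i * k] (mod n)"
    proof -
      define x where "x = j div k"
      define y where "y = \<rho> r div k"
      have jx: "j = x * k + r" "\<rho> r = y * k + r" using \<rho>[OF r] by (metis x_def r_def div_mult_mod_eq, metis y_def div_mult_mod_eq)
      \<comment> \<open>Solves y + i = x modulo 3, since 3 y vanishes there.\<close>
      define i where "i = (x + 2 * y) mod 3"
      have "[y + i = y + (x + 2 * y)] (mod 3)" unfolding i_def by (intro cong_add) (auto simp: cong_def)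
      also have "y + (x + 2 * y) = x + 3 * y" by simp
      also have "[x + 3 * y = x] (mod 3)" by (simp add: cong_def)
      finally have "[(y + i) * k = x * k] (mod (3 * k))" by (simp add: cong_def mult_mod_left)
      then have "[(y + i) * k + r = x * k + r] (mod n)" unfolding n_eq by (intro cong_add) auto
      then have "[\<rho> r + i * k = j] (mod n)" unfolding jx by (simp add: algebra_simps)
      moreover have "i < 3" by (simp add: i_def)
      ultimately show ?thesis using cong_sym by blast
    qed
    then obtain i where i: "i < 3" "[j = \<rho> r + i * k] (mod n)" by blast
    then have "ch j \<in> {ch (\<rho> r), ch (\<rho> r + k), ch (\<rho> r + 2 * k)}"
      using ch_cong[OF i(2)] by (auto simp: less_3_iff)
    then have "ch j \<in> rspan (bs r ` {..<3})" "ch j \<in> rspan (cs r ` {..<3})"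
      using bl[OF r] unfolding adapted_def by auto
    then show ?thesis using rspan_mono[OF sub(1)] rspan_mono[OF sub(2)] by blast
  qed
  have base: "bb z \<in> rspan (bb ` I)" "cc z \<in> rspan (cc ` I)" if "z \<in> I" for z
    using that by (auto intro: rspan.base)
  have mem: "(k, 0) \<in> I" "(0, 0) \<in> I" "(0, 1) \<in> I" "(0, 2) \<in> I" using k0 by (auto simp: I_def)
  have bI: "(\<lambda>x. 1) \<in> rspan (bb ` I)" "ch (2 * k) \<in> rspan (bb ` I)" "?dl \<in> rspan (bb ` I)" "s0 \<in> rspan (bb ` I)"
    using base(1)[OF mem(1)] base(1)[OF mem(2)] base(1)[OF mem(3)] base(1)[OF mem(4)] k0 by (simp_all add: bb_def)
  have cI: "?dl \<in> rspan (cc ` I)" "l1 \<in> rspan (cc ` I)" "l2 \<in> rspan (cc ` I)" "ch (2 * k) \<in> rspan (cc ` I)"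
    using base(2)[OF mem(1)] base(2)[OF mem(2)] base(2)[OF mem(3)] base(2)[OF mem(4)] k0 by (simp_all add: cc_def)
  have m1R: "- 1 \<in> R" by (intro R_uminus R_1)
  have bk: "ch k \<in> rspan (bb ` I)"
    by (rule rspan_comb[OF bI(4) bI(2) bI(3) R_1 R_uminus[OF g1R] R_uminus[OF \<gamma>_R]]) (simp add: s0_def algebra_simps)
  have i1: "inverse (\<gamma> + 1) \<in> R" using has_val_\<gamma>_1 by (intro R_inverse) (auto simp: has_val_def)
  have nz1: "\<gamma> + 1 \<noteq> 0" by (rule has_val_nonzero[OF has_val_\<gamma>_1])
  have ck: "ch k \<in> rspan (cc ` I)"
  proof -
    \<comment> \<open>This combination equals \<gamma> + 1 times \<open>ch k\<close>, and \<gamma> +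
      1 is a unit of \<open>R\<close>.\<close>
    have s: "(\<lambda>x. (-1) * l1 x + (-1) * l2 x + (q - 1) * ch (2 * k) x) \<in> rspan (cc ` I)"
      by (rule rspan_comb[OF cI(2) cI(3) cI(4) m1R m1R R_diff[OF qR R_1]]) simp
    show ?thesis
    proof (rule rspan_comb[OF s s s i1 R_0 R_0])
      fix x
      have "(-1) * l1 x + (-1) * l2 x + (q - 1) * ch (2 * k) x = (\<gamma> + 1) * ch k x"
        by (simp add: l1_def l2_def algebra_simps)
      then show "ch k x = inverse (\<gamma> + 1) * ((-1) * l1 x + (-1) * l2 x + (q - 1) * ch (2 * k) x)
         + 0 * ((-1) * l1 x + (-1) * l2 x + (q - 1) * ch (2 * k) x) + 0 * ((-1) * l1 x + (-1) * l2 x + (q - 1) * ch (2 * k) x)"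
        using nz1 by simp
    qed
  qed
  have c1: "(\<lambda>x. 1) \<in> rspan (cc ` I)"
  proof -
    have s: "(\<lambda>x. (-1) * l2 x + q * ?dl x + (-1) * ch k x) \<in> rspan (cc ` I)"
      by (rule rspan_comb[OF cI(3) cI(1) ck m1R qR m1R]) simp
    show ?thesis
      by (rule rspan_comb[OF s cI(4) cI(4) R_1 m1R R_0]) (simp add: l2_def algebra_simps)
  qed
  have all: "ch j \<in> rspan (bb ` I) \<and> ch j \<in> rspan (cc ` I)" if j: "0 < j" "j < n" for j
  proof (cases "k dvd j")
    case True
    then obtain x where x: "j = k * x" by blast
    then have "x = 1 \<or> x = 2" using j by (auto simp: n_eq)
    then show ?thesis using x bk ck bI cI by (auto simp: mult.commute)
  qed (use gen j in blast)
  have spanb: "vec.span (red ` bb ` I) = UNIV"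
    using bcR all bI by (intro span_reductions) auto
  have spanc: "vec.span (red ` cc ` I) = UNIV"
    using bcR all cI c1 by (intro span_reductions) auto
  have finI: "finite I" by (simp add: I_def)
  \<comment> \<open>There are 3 k + 1 = q basis functions, so K itself can index them, and spanning
    reductions give a square matrix with nonzero determinant.\<close>
  have "card I = CARD('a)" by (simp add: I_def card_insert_if CARD_eq n_eq)
  then obtain \<phi> :: "'a \<Rightarrow> nat \<times> nat" where \<phi>: "bij_betw \<phi> UNIV I"
    using finite_same_card_bij[of "UNIV :: 'a set" I] finI by auto
  have \<phi>I: "\<phi> y \<in> I" for y using \<phi> by (auto simp: bij_betw_def)
  define M where "M f = (\<chi> x y. f (\<phi> y) x)" for f :: "nat \<times> nat \<Rightarrow> 'a \<Rightarrow> complex"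
  have detM: "det (map_matrix \<nu> (M f)) \<noteq> 0" if "vec.span (red ` f ` I) = UNIV" for f
  proof -
    have "columns (map_matrix \<nu> (M f)) = red ` f ` I"
    proof -
      have "columns (map_matrix \<nu> (M f)) = (\<lambda>y. red (f (\<phi> y))) ` UNIV"
        by (auto simp: columns_def column_def M_def red_def)
      also have "\<dots> = red ` f ` \<phi> ` UNIV" by (simp add: image_image)
      finally show ?thesis using \<phi> by (simp add: bij_betw_def)
    qed
    then show ?thesis using that unfolding invertible_det_nz[symmetric] invertible_right_inverse
      matrix_right_invertible_span_columns by simp
  qed
  have LM: "map_matrix of_int (regular_laplacian k (cayley_adj S)) ** M bb = M cc ** (\<chi> i j. if i = j then DD (\<phi> i) else 0)"
  proof (subst vec_eq_iff, rule allI, subst vec_eq_iff, rule allI)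
    fix x y
    have ent: "regular_laplacian k (cayley_adj S) $ x $ z = (if x = z then int k else 0) - of_bool ((x - z) ^ k = 1)" for x z
      by (simp add: regular_laplacian_def adjacency_matrix_def cayley_adj_def mat_def S)
    have "(map_matrix of_int (regular_laplacian k (cayley_adj S)) ** M bb) $ x $ y =
      (\<Sum>z\<in>UNIV. (if x = z then of_nat k * bb (\<phi> y) z else 0) - cube_ind (x - z) * bb (\<phi> y) z)"
      unfolding matrix_matrix_mult_def by (auto simp: ent M_def cube_ind_def algebra_simps intro!: sum.cong)
    also have "\<dots> = lap (bb (\<phi> y)) x" by (simp add: sum_subtractf lap_def)
    also have "\<dots> = cc (\<phi> y) x * DD (\<phi> y)" using lapbb[OF \<phi>I] by simp
    also have "\<dots> = (M cc ** (\<chi> i j. if i = j then DD (\<phi> i) else 0)) $ x $ y"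
      by (simp add: matrix_matrix_mult_def M_def if_distrib[of "\<lambda>z. _ * z"] cong: if_cong)
    finally show "(map_matrix of_int (regular_laplacian k (cayley_adj S)) ** M bb) $ x $ y =
        (M cc ** (\<chi> i j. if i = j then DD (\<phi> i) else 0)) $ x $ y" .
  qed
  have "card {i. int p ^ m dvd d i} = card {y. y \<in> {y. \<phi> y = (k, 0)} \<or> m \<le> block_exp \<mu> (\<phi> y)}"
  proof (rule elementary_divisors_eq[OF UV _ detM[OF spanb] _ detM[OF spanc] LM])
    show "M bb $ i $ j \<in> R" "M cc $ i $ j \<in> R" for i j using bcR[OF \<phi>I] by (simp_all add: M_def)
    show "DD (\<phi> i) = 0" if "i \<in> {y. \<phi> y = (k, 0)}" for i using that by (simp add: DD_def)
    show "has_val (DD (\<phi> i)) (block_exp \<mu> (\<phi> i))" if i: "i \<notin> {y. \<phi> y = (k, 0)}" for i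
    proof -
      obtain r l where rl: "\<phi> i = (r, l)" by (cases "\<phi> i")
      have h1: "has_val (1 / 3) 0" using has_val_divide[OF has_val_p_power[of 0] has_val_3] by simp
      have h2: "has_val (\<gamma> * (\<gamma> + 1) * (\<gamma> - 2) / 3) (t + \<delta>)"
        using has_val_mult[OF has_val_mult[OF has_val_\<gamma> has_val_\<gamma>_1] has_val_\<gamma>_2] by (simp add: has_val_inverse_3)
      consider "r = 0" "l < 3" | "0 < r" "r < k" "l < 3" using \<phi>I[of i] i rl by (auto simp: I_def)
      then show ?thesis
      proof cases
        case 1
        then show ?thesis using h1 h2 k0 by (auto simp: rl DD_def block_exp_def less_3_iff)
      next
        case 2
        then show ?thesis using bl[of r] by (auto simp: rl DD_def block_exp_def less_3_iff)
      qed
    qed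
  qed
  also have "\<dots> = card {z \<in> I. z = (k, 0) \<or> m \<le> block_exp \<mu> z}"
  proof (rule bij_betw_same_card[of \<phi>])
    show "bij_betw \<phi> {y. y \<in> {y. \<phi> y = (k, 0)} \<or> m \<le> block_exp \<mu> (\<phi> y)} {z \<in> I. z = (k, 0) \<or> m \<le> block_exp \<mu> z}"
      by (rule bij_betw_subset[OF \<phi>]) (use \<phi> in \<open>auto simp: bij_betw_def\<close>)
  qed
  also have "{z \<in> I. z = (k, 0) \<or> m \<le> block_exp \<mu> z} = insert (k, 0) {z \<in> {..<k} \<times> {..<3}. m \<le> block_exp \<mu> z}"
    by (auto simp: I_def)
  also have "card \<dots> = card {z \<in> {..<k} \<times> {..<3}. m \<le> block_exp \<mu> z} + 1"
    by (subst card_insert_disjoint) auto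
  also have "\<mu> = (\<lambda>r. min (A r) (B r))" by (rule ext) (rule \<mu>_def)
  finally show ?thesis .
qed

end

section \<open>Valuations of Jacobi sums\<close>

primrec digit_sum :: "nat \<Rightarrow> nat \<Rightarrow> nat \<Rightarrow> nat" where
  "digit_sum p 0 x = 0"
| "digit_sum p (Suc m) x = x mod p + digit_sum p m (x div p)"

lemma digit_sum_0 [simp]: "digit_sum p m 0 = 0" by (induction m) simp_all

lemma digit_sum_more_digits: "p > 1 \<Longrightarrow> x < p ^ m \<Longrightarrow> digit_sum p (Suc m) x = digit_sum p m x"
proof (induction m arbitrary: x)
  case (Suc m)
  have "x div p < p ^ m" using Suc.prems by (simp add: less_mult_imp_div_less mult.commute)
  from Suc.IH[OF Suc.prems(1) this] show ?case by (simp only: digit_sum.simps)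
qed simp

text \<open>The base-\<open>p\<close> digits of \<open>(p\<^bsup>2t\<^esup> - 1) / 3\<close> are alternately \<open>2 w + 1\<close> and \<open>w\<close>.\<close>

lemma digit_sum_cubic:
  assumes "p = 3 * w + 2" "3 * k + 1 = p ^ (2 * t)"
  shows "digit_sum p (2 * t) k = t * (p - 1)" "digit_sum p (2 * t) (2 * k) = t * (p - 1)"
proof -
  have "digit_sum p (2 * t) k = t * (p - 1) \<and> digit_sum p (2 * t) (2 * k) = t * (p - 1)"
    using assms(2)
  proof (induction t arbitrary: k)
    case (Suc t)
    define u where "u = 2 * w + 1"
    have p0: "p > 0" using assms by simp
    have "[p ^ (2 * t) = 1] (mod 3)"
    proof -
      have "[p = 2] (mod 3)" unfolding cong_def assms(1) by presburger
      then have "[p * p = 2 * 2] (mod 3)" by (rule cong_mult) fact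
      then have "[p * p = 1] (mod 3)" by (simp add: cong_def)
      then have "[(p * p) ^ t = 1 ^ t] (mod 3)" by (rule cong_pow)
      then show ?thesis by (simp add: power_mult power2_eq_square)
    qed
    then have "p ^ (2 * t) mod 3 = 1" by (simp add: cong_def)
    then obtain k' where k': "3 * k' + 1 = p ^ (2 * t)" by (metis div_mult_mod_eq mult.commute)
    have "3 * k + 1 = p * p * (3 * k' + 1)" using Suc.prems k' by (simp add: power_add power2_eq_square mult_ac)
    moreover have "p * p = 3 * (u + p * w) + 1" by (simp add: assms(1) u_def algebra_simps)
    ultimately have k: "k = u + p * (w + p * k')" by (simp add: algebra_simps)
    have k2: "2 * k = w + p * (u + p * (2 * k'))" unfolding k by (simp add: assms(1) u_def algebra_simps)
    have up: "u < p" "w < p" "u + w = p - 1" using assms(1) by (auto simp: u_def)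
    have "digit_sum p (2 * Suc t) k = u + (w + digit_sum p (2 * t) k')"
      using up p0 by (simp add: k)
    moreover have "digit_sum p (2 * Suc t) (2 * k) = w + (u + digit_sum p (2 * t) (2 * k'))"
      unfolding k2 using up p0 by simp
    moreover have "Suc t * (p - 1) = u + (w + t * (p - 1))" "Suc t * (p - 1) = w + (u + t * (p - 1))"
      unfolding mult_Suc up(3)[symmetric] by simp_all
    ultimately show ?case using Suc.IH[OF k'] by metis
  qed simp
  then show "digit_sum p (2 * t) k = t * (p - 1)" "digit_sum p (2 * t) (2 * k) = t * (p - 1)" by auto
qed

context cubic_jacobi
begin

abbreviation s :: "nat \<Rightarrow> nat" where "s \<equiv> digit_sum p (2 * t)"

lemma p_gt_1: "p > 1" by (rule prime_gt_1_nat[OF prime_p])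

lemma digit_sum_k: "s k = t * (p - 1)" "s (2 * k) = t * (p - 1)"
proof -
  have "p mod 3 = 2" using p_mod_3 by (simp add: cong_def)
  then have w: "p = 3 * (p div 3) + 2" by (metis mult_div_mod_eq)
  have "3 * k + 1 = p ^ (2 * t)" using q_eq n_eq by simp
  from digit_sum_cubic[OF w this] show "s k = t * (p - 1)" "s (2 * k) = t * (p - 1)" by auto
qed

lemma digit_sum_step: assumes "r < p" "p * a + r \<le> n" shows "s (p * a + r) = s a + r"
proof -
  obtain m where m: "2 * t = Suc m" using t_pos by (cases t) auto
  have "p * a \<le> n" using assms by simp
  moreover have "Suc n = p * p ^ m" using q_eq by (simp add: m)
  ultimately have "p * a < p * p ^ m" by linarith
  then have "a < p ^ m" by (metis mult_less_cancel1)
  then have "digit_sum p (Suc m) a = digit_sum p m a" by (rule digit_sum_more_digits[OF p_gt_1])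
  then show ?thesis using assms by (simp add: m del: digit_sum.simps(2)) (simp add: digit_sum.simps(2))
qed

definition vJ :: "nat \<Rightarrow> nat \<Rightarrow> nat" where "vJ a b = (THE e. has_val (J a b) e)"

lemma vJ_eqI: "has_val (J a b) e \<Longrightarrow> vJ a b = e"
  unfolding vJ_def using has_val_unique by blast

text \<open>The product with a second Jacobi sum is q up to the unit \<open>ch a (- 1)\<close>, so
  both factors have a valuation. The exponent (n - 1) a represents -a modulo n.\<close>

lemma has_val_J:
  assumes "\<not> n dvd a" "\<not> n dvd b" "\<not> n dvd a + b" shows "has_val (J a b) (vJ a b)"
proof -
  define a' where "a' = (n - 1) * a"
  have a': "a' + a = n * a" using n_pos by (simp add: a'_def algebra_simps)
  have "\<not> n dvd a'" using assms(1) a' by (metis dvd_add_right_iff dvd_triv_left)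
  then have "J a b * J a' (a + b) = ch a (- 1) * of_nat (Suc n)"
    using assms a' by (intro J_product) simp_all
  moreover have "has_val (ch a (- 1)) 0"
    by (rule has_val_0I[OF ch_R]) (simp add: \<nu>_ch)
  then have "has_val (ch a (- 1) * of_nat (Suc n)) (0 + 2 * t)"
    unfolding q_eq of_nat_power by (rule has_val_mult[OF _ has_val_p_power])
  ultimately have "has_val (J a b * J a' (a + b)) (2 * t)" by (simp del: of_nat_Suc)
  from has_val_factor[OF J_R J_R this] show ?thesis using vJ_eqI by metis
qed

lemma nd: "0 < x \<Longrightarrow> x < n \<Longrightarrow> \<not> n dvd x" by (simp add: nat_dvd_not_less)

text \<open>A potential for the cocycle \<open>vJ\<close>, with H 1 = 0. In the end (p - 1) H x = x
  - s x for x < n, which is Legendre's formula for the exponent of p in the factorial of x.\<close>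

definition H :: "nat \<Rightarrow> nat" where "H a = (\<Sum>i\<in>{1..<a}. vJ 1 i)"

lemma H_Suc: "a > 0 \<Longrightarrow> H (Suc a) = H a + vJ 1 a" by (simp add: H_def)

text \<open>Induction on \<open>a\<close>: the valuations in the cocycle relation for 1, a, b allow
  the first argument to be raised by 1.\<close>

lemma vJ_H: assumes "0 < a" "0 < b" "a + b < n" shows "vJ a b + H a + H b = H (a + b)"
  using assms
proof (induction a)
  case (Suc a)
  show ?case
  proof (cases "a = 0")
    case True
    then show ?thesis using Suc.prems H_Suc[of b] by (simp add: H_def)
  next
    case False
    then have IH: "vJ a b + H a + H b = H (a + b)" using Suc by simp
    have val: "has_val (J x y) (vJ x y)" if "0 < x" "0 < y" "x + y < n" for x y
      using that by (intro has_val_J nd) auto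
    have "J 1 a * J (1 + a) b = J a b * J 1 (a + b)"
      using False Suc.prems by (intro J_cocycle nd) auto
    moreover have "has_val (J 1 a * J (1 + a) b) (vJ 1 a + vJ (1 + a) b)"
      "has_val (J a b * J 1 (a + b)) (vJ a b + vJ 1 (a + b))"
      using False Suc.prems by (auto intro!: has_val_mult val)
    ultimately have "vJ 1 a + vJ (1 + a) b = vJ a b + vJ 1 (a + b)" using has_val_unique by metis
    then show ?thesis using IH False H_Suc[of a] H_Suc[of "a + b"] by simp
  qed
qed simp

lemma vJ_1_unit: assumes "0 < i" "i < n" "\<not> p dvd i + 1" shows "vJ 1 i = 0"
proof -
  have "\<nu> (J 1 i) = - of_nat (i + 1)" using assms by (intro \<nu>_J_1) auto
  then have "\<nu> (J 1 i) \<noteq> 0" using of_nat_K_eq_0[of "i + 1"] assms(3) by (simp del: of_nat_Suc of_nat_add)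
  then show ?thesis by (intro vJ_eqI has_val_0I J_R)
qed

text \<open>As \<open>J 1 i\<close> is a unit unless p divides i + 1, \<open>H\<close> changes only
  at multiples of p.\<close>

lemma H_step: assumes "0 < a" "r < p" "p * a + r \<le> n" shows "H (p * a + r) = H (p * a)"
  using assms(2,3)
proof (induction r)
  case (Suc r)
  have "\<not> p dvd (p * a + r) + 1"
  proof
    assume "p dvd (p * a + r) + 1"
    then have "p dvd p * a + Suc r" by simp
    then have "p dvd Suc r" using dvd_add_right_iff dvd_triv_left by blast
    then show False using Suc.prems by (auto dest: dvd_imp_le)
  qed
  then have "vJ 1 (p * a + r) = 0" using Suc.prems assms(1) p_gt_1 by (intro vJ_1_unit) auto
  then show ?case using Suc H_Suc[of "p * a + r"] assms(1) p_gt_1 by simp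
qed simp

lemma H_small: assumes "r < p" "r \<le> n" shows "H r = 0"
proof -
  have "vJ 1 i = 0" if "i \<in> {1..<r}" for i
  proof -
    have "\<not> p dvd i + 1" using that assms by (auto dest: dvd_imp_le)
    then show ?thesis using that assms by (intro vJ_1_unit) auto
  qed
  then show ?thesis by (simp add: H_def)
qed

text \<open>Frobenius gives vJ (p a) p = vJ a 1; hence H (p a) - H a grows by the constant
  \<open>H p\<close> with each step of \<open>a\<close>.\<close>

lemma H_frobenius: assumes "0 < a" "p * a < n" shows "H (p * a) = H a + a * H p"
  using assms
proof (induction a)
  case (Suc a)
  show ?case
  proof (cases "a = 0")
    case False
    have lt: "a + 1 < n" using Suc.prems p_gt_1
    proof -
      have "1 * Suc a \<le> p * Suc a" by (rule mult_le_mono1) (use p_gt_1 in simp)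
      from le_less_trans[OF this Suc.prems(2)] show ?thesis by simp
    qed
    have IH: "H (p * a) = H a + a * H p" using Suc False by simp
    have "vJ (p * a) (p * 1) = vJ a 1" unfolding vJ_def J_frobenius ..
    moreover have "vJ (p * a) (p * 1) + H (p * a) + H (p * 1) = H (p * a + p * 1)"
      using Suc.prems False p_gt_1 by (intro vJ_H) (auto simp: algebra_simps)
    moreover have "vJ a 1 + H a + H 1 = H (a + 1)" using lt False by (intro vJ_H) auto
    moreover have e: "p * Suc a = p * a + p * 1" by simp
    ultimately show ?thesis unfolding e using IH by (simp add: H_def[of 1] H_def[of "Suc 0"])
  qed (simp add: H_def[of 1] H_def[of "Suc 0"])
qed simp

text \<open>Appending a last digit to a > 0, with result x, adds a H p to \<open>H\<close> and (p -
  1) a to the difference of number and digit sum. So H x is proportional to x - s x.\<close>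

lemma H_digit_sum: "x < n \<Longrightarrow> (p - 1) * H x + H p * s x = H p * x"
proof (induction x rule: less_induct)
  case (less x)
  define a where "a = x div p"
  define r where "r = x mod p"
  have x: "x = p * a + r" by (simp add: a_def r_def)
  have r: "r < p" using p_gt_1 by (simp add: r_def)
  have sx: "s x = s a + r" unfolding x using r less.prems x by (intro digit_sum_step) auto
  show ?case
  proof (cases "a = 0")
    case True
    then have "H x = 0" using r x less.prems by (intro H_small) auto
    then show ?thesis using sx True x by simp
  next
    case False
    have "a < p * a" using False p_gt_1 by simp
    then have ax: "a < x" using x by linarith
    have Hx: "H x = H a + a * H p"
      using H_step[of a r] H_frobenius[of a] False r x less.prems by simp
    have "(p - 1) * H a + H p * s a = H p * a" using less.IH[OF ax] ax less.prems by simp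
    moreover have "(p - 1) * (a * H p) + H p * a = H p * (p * a)"
      using p_gt_1 by (simp add: algebra_simps diff_mult_distrib)
    ultimately show ?thesis unfolding Hx sx by (simp add: x algebra_simps)
  qed
qed

lemma vJ_k_k: "vJ k k = t"
  using has_val_\<gamma> by (intro vJ_eqI) (simp add: \<gamma>_def)

lemma vJ_digit_sum_aux:
  assumes "0 < a" "0 < b" "a + b < n" shows "(p - 1) * vJ a b + H p * s (a + b) = H p * (s a + s b)"
proof -
  have "(p - 1) * vJ a b + (p - 1) * H a + (p - 1) * H b = (p - 1) * H (a + b)"
    using vJ_H[OF assms] by (metis add_mult_distrib2)
  moreover have "(p - 1) * H a + H p * s a = H p * a" "(p - 1) * H b + H p * s b = H p * b"
    "(p - 1) * H (a + b) + H p * s (a + b) = H p * (a + b)"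
    using assms H_digit_sum[of a] H_digit_sum[of b] H_digit_sum[of "a + b"] by simp_all
  ultimately show ?thesis by (simp add: algebra_simps)
qed

text \<open>The factor is read off at a = b = k: both k and 2 k have digit sum t (p - 1), and vJ k k
  = t.\<close>

lemma H_p: "H p = 1"
proof -
  define c where "c = t * (p - 1)"
  have "k + k < n" using k_gt_1 by (simp add: n_eq)
  then have "(p - 1) * vJ k k + H p * s (k + k) = H p * (s k + s k)"
    using k_gt_1 by (intro vJ_digit_sum_aux) auto
  then have "c + H p * c = H p * c + H p * c"
    unfolding vJ_k_k mult_2[symmetric, of k] digit_sum_k by (simp only: c_def mult.commute add_mult_distrib2)
  then have "c = H p * c" by simp
  then show ?thesis using p_gt_1 t_pos by (simp add: c_def)
qed

lemma vJ_digit_sum: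
  assumes "0 < a" "0 < b" "a + b < n" shows "(p - 1) * vJ a b + s (a + b) = s a + s b"
  using vJ_digit_sum_aux[OF assms] by (simp add: H_p)

text \<open>If j + u < n this is the digit sum formula. Otherwise j' = j + u - n satisfies j' + v =
  j < n, and the product relation gives vJ j u = 2 t - vJ j' v.\<close>

lemma cubic_val:
  assumes c: "cubic_pair u v" and j: "\<not> k dvd j" "j < n"
  shows "has_val (J j u) (vJ j u)" "(p - 1) * vJ j u + s ((j + u) mod n) = (p - 1) * t + s j"
proof -
  note cD = cubic_pairD[OF c]
  have nj: "\<not> n dvd j" "\<not> n dvd j + u" "\<not> n dvd j + v"
    using not_n_dvd[OF j(1), of 0] not_n_dvd[OF j(1)] cD by auto
  then show hv: "has_val (J j u) (vJ j u)" using cD by (intro has_val_J) auto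
  have j0: "0 < j" using j by (auto intro: gr0I)
  have u: "0 < u" "0 < v" "u + v = n" "s u = (p - 1) * t" "s v = (p - 1) * t"
    using c k_gt_1 digit_sum_k by (auto simp: cubic_pair_def n_eq mult.commute)
  show "(p - 1) * vJ j u + s ((j + u) mod n) = (p - 1) * t + s j"
  proof (cases "j + u < n")
    case True
    then show ?thesis using vJ_digit_sum[OF j0 u(1) True] u by simp
  next
    case False
    define j' where "j' = j + u - n"
    have j': "j + u = j' + n" "j' + v = j" using False u by (auto simp: j'_def)
    have "j' \<noteq> 0" using nj(2) j'(1) by (metis add_0 dvd_refl)
    then have j'0: "0 < j'" by simp
    have "j' < n" using j' j by auto
    then have mod: "(j + u) mod n = j'" using j' by auto
    have "J (j + u) v = J j' v" by (intro J_cong) (simp_all add: cong_def j')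
    then have "J j u * J j' v = of_nat p ^ (2 * t)" using J_pair_product[OF c j(1)] q_eq by (metis of_nat_power)
    moreover have hv': "has_val (J j' v) (vJ j' v)"
    proof (rule has_val_J)
      show "\<not> n dvd j'" by (rule nd[OF j'0 \<open>j' < n\<close>])
      show "\<not> n dvd v" "\<not> n dvd j' + v" using cD(5) nj(1) j'(2) by simp_all
    qed
    ultimately have "vJ j u + vJ j' v = 2 * t"
      using has_val_unique has_val_mult[OF hv hv'] has_val_p_power by metis
    then have "(p - 1) * vJ j u + (p - 1) * vJ j' v = (p - 1) * t + (p - 1) * t"
      by (metis add_mult_distrib2 mult_2)
    moreover have "(p - 1) * vJ j' v + s j = s j' + (p - 1) * t"
      using vJ_digit_sum[of j' v] j' j j'0 u by simp
    ultimately show ?thesis unfolding mod by linarith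
  qed
qed

section \<open>The pair of valuations attached to an exponent\<close>

definition A :: "nat \<Rightarrow> nat" where "A j = vJ j k"
definition B :: "nat \<Rightarrow> nat" where "B j = vJ j (2 * k)"

lemma vJ_cong: "[a = a'] (mod n) \<Longrightarrow> [b = b'] (mod n) \<Longrightarrow> vJ a b = vJ a' b'"
  unfolding vJ_def using J_cong by metis

lemma AB_cong: "[a = a'] (mod n) \<Longrightarrow> A a = A a'" "[a = a'] (mod n) \<Longrightarrow> B a = B a'"
  unfolding A_def B_def by (auto intro: vJ_cong)

lemma AB_mod [simp]: "A (j mod n) = A j" "B (j mod n) = B j"
  by (rule AB_cong; simp add: cong_def)+

lemma has_val_AB:
  assumes "\<not> k dvd j" shows "has_val (J j k) (A j)" "has_val (J j (2 * k)) (B j)"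
proof -
  have nj: "\<not> n dvd j" "\<not> n dvd j + k" "\<not> n dvd j + 2 * k"
    using not_n_dvd[OF assms, of 0] not_n_dvd[OF assms, of k] not_n_dvd[OF assms, of "2 * k"] by simp_all
  show "has_val (J j k) (A j)" unfolding A_def by (rule has_val_J[OF nj(1) not_n_dvd_k(1) nj(2)])
  show "has_val (J j (2 * k)) (B j)" unfolding B_def by (rule has_val_J[OF nj(1) not_n_dvd_k(2) nj(3)])
qed

text \<open>Valuations of \<open>J_pair_product\<close> and \<open>J_pair_square\<close>. From (A,
  B) at j they give (t + B - A, 2 t - A) at j + k and (2 t - B, t + A - B) at j + 2 k.\<close>

lemma AB_relations:
  assumes j: "\<not> k dvd j"
  shows "A j + B (j + k) = 2 * t" "B j + A (j + 2 * k) = 2 * t" "A j + A (j + k) = t + B j" "B j + B (j + 2 * k) = t + A j"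
proof -
  have c: "cubic_pair k (2 * k)" "cubic_pair (2 * k) k" by (simp_all add: cubic_pair_def)
  have j': "\<not> k dvd j + k" "\<not> k dvd j + 2 * k" using j by (simp_all add: dvd_add_left_iff)
  note v = has_val_AB[OF j] has_val_AB[OF j'(1)] has_val_AB[OF j'(2)]
  have q: "has_val (of_nat (Suc n)) (2 * t)" unfolding q_eq of_nat_power by (rule has_val_p_power)
  show "A j + B (j + k) = 2 * t"
    using has_val_mult[OF v(1) v(4)] q has_val_unique unfolding J_pair_product[OF c(1) j] by blast
  show "B j + A (j + 2 * k) = 2 * t"
    using has_val_mult[OF v(2) v(5)] q has_val_unique unfolding J_pair_product[OF c(2) j] by blast
  show "A j + A (j + k) = t + B j"
    using has_val_mult[OF v(1) v(3)] has_val_mult[OF has_val_\<gamma> v(2)] has_val_unique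
    unfolding J_pair_square[OF c(1) j] by blast
  show "B j + B (j + 2 * k) = t + A j"
    using has_val_mult[OF v(2) v(6)] has_val_mult[OF has_val_\<gamma> v(1)] has_val_unique
    unfolding J_pair_square[OF c(2) j] by blast
qed

lemma p_k_cong: "[p * k = 2 * k] (mod n)" "[p * (2 * k) = k] (mod n)"
proof -
  have "[p * k = 2 * k] (mod (3 * k))" using p_mod_3 by (simp add: cong_def mult_mod_left[symmetric])
  then show 1: "[p * k = 2 * k] (mod n)" by (simp add: n_eq)
  then have "[2 * (p * k) = 2 * (2 * k)] (mod n)" by (rule cong_mult[OF cong_refl])
  moreover have "[2 * (2 * k) = k] (mod n)"
  proof -
    have "2 * (2 * k) = k + n" by (simp add: n_eq)
    then show ?thesis unfolding cong_def by (simp only: mod_add_self2)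
  qed
  ultimately show "[p * (2 * k) = k] (mod n)" by (metis cong_trans mult.left_commute)
qed

lemma AB_frobenius: "A (p * j) = B j" "B (p * j) = A j"
proof -
  have "vJ (p * j) (p * (2 * k)) = vJ j (2 * k)" "vJ (p * j) (p * k) = vJ j k"
    unfolding vJ_def J_frobenius by auto
  moreover have "vJ (p * j) (p * (2 * k)) = vJ (p * j) k" "vJ (p * j) (p * k) = vJ (p * j) (2 * k)"
    using p_k_cong by (auto intro!: vJ_cong)
  ultimately show "A (p * j) = B j" "B (p * j) = A j" by (simp_all add: A_def B_def)
qed

text \<open>In the cocycle relation for i, k, j the factors \<open>J (i + k) j\<close> and
  \<open>J i (k + j)\<close> have arguments with sum 0 modulo n, so they are units.\<close>

lemma A_reflect:
  assumes j: "\<not> k dvd j" and i: "n dvd i + j + k" shows "A i = A j"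
proof -
  have "k dvd i + j + k" using i n_eq by (metis dvd_mult_right)
  then have ki: "\<not> k dvd i" using j by (metis dvd_add_right_iff dvd_add_triv_right_iff)
  have nj: "\<not> n dvd j" "\<not> n dvd j + k" "\<not> n dvd i + k" "\<not> n dvd i"
    using not_n_dvd[OF j, of 0] not_n_dvd[OF j] not_n_dvd[OF ki, of 0] not_n_dvd[OF ki] by auto
  have unit: "has_val (J x y) 0" if "n dvd x + y" "\<not> n dvd x" for x y
    unfolding J_inverse[OF that] by (intro has_val_uminus has_val_0I ch_R) (simp add: \<nu>_ch)
  have "J i k * J (i + k) j = J k j * J i (k + j)"
    using nj by (intro J_cocycle) (simp_all add: add.commute)
  moreover have "has_val (J i k * J (i + k) j) (A i + 0)"
    using i nj by (intro has_val_mult has_val_AB ki unit) (simp_all add: add_ac)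
  moreover have "has_val (J k j * J i (k + j)) (A j + 0)"
    using i nj by (intro has_val_mult unit) (simp_all add: add_ac J_commute[of k j] has_val_AB j)
  ultimately show ?thesis using has_val_unique by fastforce
qed

lemma B_reflect:
  assumes j: "\<not> k dvd j" and i: "n dvd i + j + k" shows "B i + B j = t + A j"
proof -
  have "k dvd i + j + k" using i n_eq by (metis dvd_mult_right)
  then have ki: "\<not> k dvd i" using j by (metis dvd_add_right_iff dvd_add_triv_right_iff)
  have j2: "\<not> k dvd j + 2 * k" using j by (simp add: dvd_add_left_iff)
  have "A (i + k) = A (j + 2 * k)"
  proof (rule A_reflect[OF j2])
    have "(i + k) + (j + 2 * k) + k = (i + j + k) + n" by (simp add: n_eq)
    then show "n dvd (i + k) + (j + 2 * k) + k" using dvd_add[OF i dvd_refl] by metis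
  qed
  then show ?thesis using AB_relations(3)[OF ki] AB_relations(2)[OF j] A_reflect[OF j i] by linarith
qed

section \<open>Choosing and counting blocks\<close>

definition gen :: "nat set" where "gen = {j. j < n \<and> \<not> k dvd j}"

lemma k_dvd_mod_n: "k dvd j mod n \<longleftrightarrow> k dvd j"
  by (simp add: n_eq dvd_mod_iff)

lemma gen_mod: "\<not> k dvd j \<Longrightarrow> j mod n \<in> gen"
  using n_pos by (simp add: gen_def k_dvd_mod_n)

text \<open>A block consists of the exponents \<open>j\<close>, \<open>j + k\<close> and \<open>j + 2 k\<close> modulo \<open>n\<close>. The last condition breaks
  ties, so that a block has exactly one leading member.\<close>

definition leading :: "nat \<Rightarrow> bool" where
  "leading j \<longleftrightarrow> j \<in> gen \<and> A j \<le> t \<and> B j \<le> t \<and> \<not> (A j < t \<and> B j = t)"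

text \<open>By the formulas for the three pairs of a block, some member has both valuations at most
  t. If its pair is (A, t) with A < t, the member 2 k further has the pair (t, A) and is leading
  instead.\<close>

lemma leading_exists:
  assumes "0 < r" "r < k" shows "\<exists>j. leading j \<and> j mod k = r"
proof -
  have r: "\<not> k dvd r" using assms by (simp add: nat_dvd_not_less)
  have r': "\<not> k dvd r + k" "\<not> k dvd r + 2 * k" using r by (simp_all add: dvd_add_left_iff)
  have sh: "A (r + 2 * k + k) = A r" "B (r + 2 * k + k) = B r" "B (r + k + 2 * k) = B r" "A (r + k + 2 * k) = A r"
    by (rule AB_cong; simp add: cong_def n_eq)+
  have mk: "(j mod n) mod k = j mod k" for j by (rule mod_mod_cancel) (simp add: n_eq)
  have lead: "leading (j mod n)" if "\<not> k dvd j" "A j \<le> t" "B j \<le> t" "\<not> (A j < t \<and> B j = t)" for j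
    using that gen_mod unfolding leading_def by simp
  have "(A r \<le> t \<and> B r \<le> t \<and> \<not> (A r < t \<and> B r = t)) \<or> (A (r + k) \<le> t \<and> B (r + k) \<le> t \<and> \<not> (A (r + k) < t \<and> B (r + k) = t)) \<or>
      (A (r + 2 * k) \<le> t \<and> B (r + 2 * k) \<le> t \<and> \<not> (A (r + 2 * k) < t \<and> B (r + 2 * k) = t))"
    using AB_relations[OF r] AB_relations[OF r'(1)] AB_relations[OF r'(2)] unfolding sh by linarith
  then obtain j where "j \<in> {r, r + k, r + 2 * k}" "A j \<le> t" "B j \<le> t" "\<not> (A j < t \<and> B j = t)"
    by (elim disjE) blast+
  then have "leading (j mod n)" "(j mod n) mod k = r" using lead r r' assms by (auto simp: mk)
  then show ?thesis by blast
qed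

lemma same_block:
  assumes "i \<in> gen" "j \<in> gen" "i mod k = j mod k"
  shows "i = j \<or> i = (j + k) mod n \<or> i = (j + 2 * k) mod n"
proof -
  define x where "x = i div k"
  define y where "y = j div k"
  have ij: "i = x * k + j mod k" "j = y * k + j mod k"
    using assms(3) by (metis x_def div_mult_mod_eq, metis y_def div_mult_mod_eq)
  have "i < n" "j < n" using assms(1,2) by (simp_all add: gen_def)
  then have "x < 3" "y < 3" unfolding x_def y_def by (simp_all add: n_eq less_mult_imp_div_less)
  then consider "x = y" | "x = y + 1" | "x = y + 2" | "y = x + 1" | "y = x + 2" by linarith
  then show ?thesis
  proof cases
    case 4
    then have "j + 2 * k = i + n" using ij by (simp add: n_eq algebra_simps)
    then show ?thesis using assms(1) by (simp add: gen_def)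
  next
    case 5
    then have "j + k = i + n" using ij by (simp add: n_eq algebra_simps)
    then show ?thesis using assms(1) by (simp add: gen_def)
  qed (use ij assms(1) in \<open>auto simp: gen_def algebra_simps\<close>)
qed

text \<open>If the minimum is below t, the other two pairs violate the definition. If it is t, all
  three pairs are (t, t), which \<open>m\<close> excludes.\<close>

lemma leading_unique:
  assumes i: "leading i" and j: "leading j" and ij: "i mod k = j mod k" and m: "min (A j) (B j) < t"
  shows "i = j"
proof -
  have kj: "\<not> k dvd j" "\<not> k dvd j + k" "\<not> k dvd j + 2 * k"
    using j by (simp_all add: leading_def gen_def dvd_add_left_iff)
  have sh: "A (j + 2 * k + k) = A j" "B (j + 2 * k + k) = B j" "B (j + k + 2 * k) = B j" "A (j + k + 2 * k) = A j"
    by (rule AB_cong; simp add: cong_def n_eq)+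
  note rel = AB_relations[OF kj(1)] AB_relations[OF kj(2), unfolded sh] AB_relations[OF kj(3), unfolded sh]
  have "i \<noteq> (j + k) mod n"
  proof
    assume "i = (j + k) mod n"
    then have "A (j + k) \<le> t" "B (j + k) \<le> t" "\<not> (A (j + k) < t \<and> B (j + k) = t)"
      using i unfolding leading_def by auto
    then show False using rel j m unfolding leading_def by linarith
  qed
  moreover have "i \<noteq> (j + 2 * k) mod n"
  proof
    assume "i = (j + 2 * k) mod n"
    then have "A (j + 2 * k) \<le> t" "B (j + 2 * k) \<le> t" "\<not> (A (j + 2 * k) < t \<and> B (j + 2 * k) = t)"
      using i unfolding leading_def by auto
    then show False using rel j m unfolding leading_def by linarith
  qed
  ultimately show ?thesis using same_block[OF _ _ ij] i j unfolding leading_def by blast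
qed

definition rep :: "nat \<Rightarrow> nat" where "rep r = (SOME j. leading j \<and> j mod k = r)"

lemma rep: "0 < r \<Longrightarrow> r < k \<Longrightarrow> leading (rep r)" "0 < r \<Longrightarrow> r < k \<Longrightarrow> rep r mod k = r"
  unfolding rep_def using someI_ex[OF leading_exists[of r]] by auto

lemma finite_gen: "finite gen" by (simp add: gen_def)

text \<open>The map j -> p j is injective on exponents modulo n and exchanges \<open>A\<close> and
  \<open>B\<close>, which gives both inequalities.\<close>

lemma card_swap:
  "card {j \<in> gen. B j = m \<and> m < A j \<and> A j \<le> t} = card {j \<in> gen. A j = m \<and> m < B j \<and> B j \<le> t}"
proof -
  define f where "f j = (p * j) mod n" for j
  have cop: "coprime p n"
  proof -
    have "coprime (p ^ (2 * t)) n" unfolding q_eq[symmetric] by simp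
    then show ?thesis using t_pos by simp
  qed
  then have "coprime p k" unfolding n_eq by simp
  then have copk: "coprime k p" by (simp only: coprime_commute)
  have inj: "inj_on f gen"
  proof (rule inj_onI)
    fix i j assume ij: "i \<in> gen" "j \<in> gen" "f i = f j"
    then have "[p * i = p * j] (mod n)" by (simp add: f_def cong_def)
    then have "[i = j] (mod n)" using cop by (simp add: cong_mult_lcancel_nat)
    then show "i = j" using ij by (simp add: gen_def cong_def)
  qed
  have fgen: "f j \<in> gen" if "j \<in> gen" for j
    unfolding f_def using that copk by (intro gen_mod) (simp add: gen_def coprime_dvd_mult_right_iff)
  have AB: "A (f j) = B j" "B (f j) = A j" for j by (simp_all add: f_def AB_frobenius)
  have "card {j \<in> gen. B j = m \<and> m < A j \<and> A j \<le> t} \<le> card {j \<in> gen. A j = m \<and> m < B j \<and> B j \<le> t}"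
    by (rule card_inj_on_le[of f]) (auto simp: AB fgen finite_gen intro: inj_on_subset[OF inj])
  moreover have "card {j \<in> gen. A j = m \<and> m < B j \<and> B j \<le> t} \<le> card {j \<in> gen. B j = m \<and> m < A j \<and> A j \<le> t}"
    by (rule card_inj_on_le[of f]) (auto simp: AB fgen finite_gen intro: inj_on_subset[OF inj])
  ultimately show ?thesis by simp
qed

text \<open>The reflection j -> - j - k preserves A and sends B to t + A - B, so it exchanges the
  conditions B = A and B = t.\<close>

lemma card_reflect: "card {j \<in> gen. A j = m \<and> B j = m} = card {j \<in> gen. A j = m \<and> B j = t}"
proof -
  define g where "g j = (n + n - j - k) mod n" for j
  have kn: "k < n" using k_gt_1 by (simp add: n_eq)
  have dv: "n dvd g j + j + k" if "j \<in> gen" for j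
  proof -
    have "(n + n - j - k) + (j + k) = n + n" using that kn by (simp add: gen_def)
    moreover have "[g j + (j + k) = (n + n - j - k) + (j + k)] (mod n)"
      unfolding g_def by (intro cong_add) (auto simp: cong_def)
    ultimately have "[g j + (j + k) = 0] (mod n)" by (simp add: cong_def)
    then show ?thesis by (simp add: cong_0_iff add.assoc)
  qed
  have ggen: "g j \<in> gen" if "j \<in> gen" for j
  proof -
    have "k dvd g j + j + k" using dv[OF that] n_eq by (metis dvd_mult_right)
    then have "\<not> k dvd g j" using that by (metis (mono_tags) gen_def mem_Collect_eq dvd_add_right_iff dvd_add_triv_right_iff)
    then show ?thesis using n_pos by (simp add: gen_def g_def)
  qed
  have inj: "inj_on g gen"
  proof (rule inj_onI)
    fix i j assume ij: "i \<in> gen" "j \<in> gen" "g i = g j"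
    have "[g i + k + i = g i + k + j] (mod n)"
    proof -
      have "[g i + i + k = 0] (mod n)" "[g j + j + k = 0] (mod n)"
        using dv[OF ij(1)] dv[OF ij(2)] by (simp_all only: cong_0_iff)
      then have "[g i + i + k = g j + j + k] (mod n)" using cong_sym cong_trans by blast
      then show ?thesis by (simp add: ij(3) add_ac)
    qed
    then have "[i = j] (mod n)" by (simp only: cong_add_lcancel_nat)
    then show "i = j" using ij by (simp add: gen_def cong_def)
  qed
  have AB: "A (g j) = A j" "B (g j) + B j = t + A j" if "j \<in> gen" for j
    using A_reflect[OF _ dv[OF that]] B_reflect[OF _ dv[OF that]] that by (auto simp: gen_def)
  have "card {j \<in> gen. A j = m \<and> B j = m} \<le> card {j \<in> gen. A j = m \<and> B j = t}"
  proof (rule card_inj_on_le[of g])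
    show "g ` {j \<in> gen. A j = m \<and> B j = m} \<subseteq> {j \<in> gen. A j = m \<and> B j = t}"
      using AB ggen by fastforce
  qed (auto simp: finite_gen intro: inj_on_subset[OF inj])
  moreover have "card {j \<in> gen. A j = m \<and> B j = t} \<le> card {j \<in> gen. A j = m \<and> B j = m}"
  proof (rule card_inj_on_le[of g])
    show "g ` {j \<in> gen. A j = m \<and> B j = t} \<subseteq> {j \<in> gen. A j = m \<and> B j = m}"
      using AB ggen by fastforce
  qed (auto simp: finite_gen intro: inj_on_subset[OF inj])
  ultimately show ?thesis by simp
qed

text \<open>Leading exponents with minimum m split into A = m < B < t, A = B = m and B = m < A \<le>
  t. Reflection turns the second set into A = m, B = t, which completes the first; Frobenius turns
  the third into the same set as these two together. This is the origin of the factor 2 in C(2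
  s).\<close>

lemma card_blocks:
  assumes m: "m < t"
  shows "card {r. 0 < r \<and> r < k \<and> min (A (rep r)) (B (rep r)) = m} =
    2 * card {j \<in> gen. A j = m \<and> m < B j \<and> B j \<le> t}"
proof -
  let ?X = "{j \<in> gen. A j = m \<and> m < B j \<and> B j < t}" and ?Y = "{j \<in> gen. A j = m \<and> B j = m}"
    and ?Z = "{j \<in> gen. B j = m \<and> m < A j \<and> A j \<le> t}" and ?W = "{j \<in> gen. A j = m \<and> B j = t}"
  have "card {r. 0 < r \<and> r < k \<and> min (A (rep r)) (B (rep r)) = m} = card {j. leading j \<and> min (A j) (B j) = m}"
  proof (rule bij_betw_same_card[of rep], rule bij_betw_imageI)
    show "inj_on rep {r. 0 < r \<and> r < k \<and> min (A (rep r)) (B (rep r)) = m}"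
      by (rule inj_on_inverseI[of _ "\<lambda>j. j mod k"]) (simp add: rep)
    show "rep ` {r. 0 < r \<and> r < k \<and> min (A (rep r)) (B (rep r)) = m} = {j. leading j \<and> min (A j) (B j) = m}"
    proof
      show "{j. leading j \<and> min (A j) (B j) = m} \<subseteq> rep ` {r. 0 < r \<and> r < k \<and> min (A (rep r)) (B (rep r)) = m}"
      proof
        fix j assume j: "j \<in> {j. leading j \<and> min (A j) (B j) = m}"
        define r where "r = j mod k"
        have r: "0 < r" "r < k" using j k_gt_1 by (auto simp: r_def leading_def gen_def dvd_eq_mod_eq_0)
        have lj: "leading j" "min (A j) (B j) = m" using j by auto
        have "rep r = j"
          by (rule leading_unique[OF rep(1)[OF r] lj(1) trans[OF rep(2)[OF r] r_def]]) (simp only: lj m)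
        then show "j \<in> rep ` {r. 0 < r \<and> r < k \<and> min (A (rep r)) (B (rep r)) = m}"
          using j r by (intro image_eqI[of _ _ r]) auto
      qed
    qed (auto simp: rep)
  qed
  also have "{j. leading j \<and> min (A j) (B j) = m} = ?X \<union> (?Y \<union> ?Z)"
    unfolding leading_def using m by (auto simp: min_def)
  also have "card \<dots> = card ?X + (card ?Y + card ?Z)"
  proof -
    have fin: "finite ?X" "finite ?Y" "finite ?Z" using finite_gen by simp_all
    have "card (?Y \<union> ?Z) = card ?Y + card ?Z" by (rule card_Un_disjoint[OF fin(2,3)]) auto
    moreover have "card (?X \<union> (?Y \<union> ?Z)) = card ?X + card (?Y \<union> ?Z)"
      by (rule card_Un_disjoint) (use fin in auto)
    ultimately show ?thesis by simp
  qed
  also have "card ?Y = card ?W" by (rule card_reflect)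
  also have "card ?Z = card {j \<in> gen. A j = m \<and> m < B j \<and> B j \<le> t}" by (rule card_swap)
  also have "card ?X + (card ?W + card {j \<in> gen. A j = m \<and> m < B j \<and> B j \<le> t}) =
      2 * card {j \<in> gen. A j = m \<and> m < B j \<and> B j \<le> t}"
  proof -
    have e1: "{j \<in> gen. A j = m \<and> m < B j \<and> B j \<le> t} = ?X \<union> ?W" using m by auto
    have e2: "card (?X \<union> ?W) = card ?X + card ?W"
      by (rule card_Un_disjoint) (auto simp: finite_gen)
    have "card {j \<in> gen. A j = m \<and> m < B j \<and> B j \<le> t} = card ?X + card ?W"
      by (rule trans[OF arg_cong[of _ _ card, OF e1] e2])
    then show ?thesis by simp
  qed
  finally show ?thesis .
qed

end

section \<open>Counting carries with a transfer matrix\<close>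

text \<open>\<open>c\<close> is the carry into the lowest digit; the carry out of the top digit is
  counted as well.\<close>

primrec carries :: "nat \<Rightarrow> nat \<Rightarrow> nat \<Rightarrow> nat \<Rightarrow> nat \<Rightarrow> nat" where
  "carries p 0 a j c = 0"
| "carries p (Suc m) a j c =
     (j mod p + a mod p + c) div p + carries p m (a div p) (j div p) ((j mod p + a mod p + c) div p)"

primrec carry_out :: "nat \<Rightarrow> nat \<Rightarrow> nat \<Rightarrow> nat \<Rightarrow> nat \<Rightarrow> nat" where
  "carry_out p 0 a j c = c"
| "carry_out p (Suc m) a j c = carry_out p m (a div p) (j div p) ((j mod p + a mod p + c) div p)"

text \<open>Each carry replaces p in one position by 1 in the next, so it lowers the digit sum by p
  - 1. The last carry leaves the number and is accounted for by \<open>carry_out\<close>.\<close>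

lemma carries_digit_sum:
  assumes "p > 1" "a < p ^ m" "j < p ^ m"
  shows "carry_out p m a j c = (j + a + c) div p ^ m"
    "(p - 1) * carries p m a j c + digit_sum p m ((j + a + c) mod p ^ m) + carry_out p m a j c =
     digit_sum p m j + digit_sum p m a + c"
proof -
  have "carry_out p m a j c = (j + a + c) div p ^ m \<and>
    (p - 1) * carries p m a j c + digit_sum p m ((j + a + c) mod p ^ m) + carry_out p m a j c =
     digit_sum p m j + digit_sum p m a + c"
    using assms(2,3)
  proof (induction m arbitrary: a j c)
    case (Suc m)
    define c1 where "c1 = (j mod p + a mod p + c) div p"
    define x0 where "x0 = (j mod p + a mod p + c) mod p"
    have s: "j mod p + a mod p + c = x0 + p * c1" by (simp add: x0_def c1_def)
    have lt: "a div p < p ^ m" "j div p < p ^ m"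
      using Suc.prems by (simp_all add: less_mult_imp_div_less mult.commute)
    define y where "y = j div p + a div p + c1"
    have tot: "j + a + c = x0 + p * y"
    proof -
      have "j + a + c = (j mod p + a mod p + c) + p * (j div p) + p * (a div p)"
        using mod_mult_div_eq[of j p] mod_mult_div_eq[of a p] by linarith
      then show ?thesis unfolding s by (simp add: y_def algebra_simps)
    qed
    have x0: "x0 < p" using assms(1) by (simp add: x0_def)
    have dv: "(x0 + p * y) div p = y" "(x0 + p * y) mod p = x0" using x0 by simp_all
    have dm: "(x0 + p * y) div p ^ Suc m = y div p ^ m" "(x0 + p * y) mod p ^ Suc m = x0 + p * (y mod p ^ m)"
      using dv by (simp_all add: div_mult2_eq mod_mult2_eq)
    have IH: "carry_out p m (a div p) (j div p) c1 = y div p ^ m"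
      "(p - 1) * carries p m (a div p) (j div p) c1 + digit_sum p m (y mod p ^ m) + carry_out p m (a div p) (j div p) c1 =
       digit_sum p m (j div p) + digit_sum p m (a div p) + c1"
      using Suc.IH[OF lt, of c1] by (auto simp: y_def)
    have co: "carry_out p (Suc m) a j c = carry_out p m (a div p) (j div p) c1" by (simp add: c1_def)
    have ca: "carries p (Suc m) a j c = c1 + carries p m (a div p) (j div p) c1" by (simp add: c1_def)
    have ds: "digit_sum p (Suc m) (x0 + p * (y mod p ^ m)) = x0 + digit_sum p m (y mod p ^ m)"
      using x0 by simp
    have pc: "(p - 1) * c1 + c1 = p * c1" using assms(1) by (simp add: diff_mult_distrib)
    show ?case unfolding tot dm ds co ca using IH pc s by (simp add: distrib_left)
  qed simp
  then show "carry_out p m a j c = (j + a + c) div p ^ m"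
    "(p - 1) * carries p m a j c + digit_sum p m ((j + a + c) mod p ^ m) + carry_out p m a j c =
     digit_sum p m j + digit_sum p m a + c" by auto
qed

text \<open>An entry of a product of transfer matrices: j runs over all words of m digits, the state
  is the pair of carries in j + a and j + b, passing from (c, d) to (c', d'), and x and y mark the
  two kinds of carries.\<close>

definition walk_sum :: "'r::comm_ring_1 \<Rightarrow> 'r \<Rightarrow> nat \<Rightarrow> nat \<Rightarrow> nat \<Rightarrow> nat \<Rightarrow> nat \<Rightarrow> nat \<Rightarrow> nat \<Rightarrow> nat \<Rightarrow> 'r" where
  "walk_sum x y p m a b c' d' c d = (\<Sum>j<p ^ m.
     of_bool (carry_out p m a j c = c' \<and> carry_out p m b j d = d') * (x ^ carries p m a j c * y ^ carries p m b j d))"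

lemma sum_digit_split:
  fixes f :: "nat \<Rightarrow> 'r::comm_monoid_add"
  assumes "p > 0" shows "(\<Sum>j<p * N. f j) = (\<Sum>i<p. \<Sum>j<N. f (i + p * j))"
proof -
  have "(\<Sum>i<p. \<Sum>j<N. f (i + p * j)) = (\<Sum>(i, j)\<in>{..<p} \<times> {..<N}. f (i + p * j))"
    by (rule sum.cartesian_product)
  also have "\<dots> = (\<Sum>j<p * N. f j)"
  proof (rule sum.reindex_bij_witness[of _ "\<lambda>j. (j mod p, j div p)" "\<lambda>(i, j). i + p * j"])
    fix z assume z: "z \<in> {..<p} \<times> {..<N}"
    then obtain i j where ij: "z = (i, j)" "i < p" "j < N" by auto
    have "i + p * j < p + p * j" using ij by simp
    also have "\<dots> = p * Suc j" by simp
    also have "\<dots> \<le> p * N" using ij by (intro mult_le_mono2) simp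
    finally show "(case z of (i, j) \<Rightarrow> i + p * j) \<in> {..<p * N}" by (simp add: ij)
  qed (use assms in \<open>auto simp: less_mult_imp_div_less mult.commute\<close>)
  finally show ?thesis ..
qed

lemma walk_sum_Suc:
  assumes "p > 0"
  shows "walk_sum x y p (Suc m) a b c' d' c d = (\<Sum>i<p.
    x ^ ((i + a mod p + c) div p) * y ^ ((i + b mod p + d) div p) *
    walk_sum x y p m (a div p) (b div p) c' d' ((i + a mod p + c) div p) ((i + b mod p + d) div p))"
  unfolding walk_sum_def power_Suc sum_digit_split[OF assms] sum_distrib_left
  by (intro sum.cong refl) (simp add: power_add mult_ac)

lemma sum_three_ranges:
  fixes g0 g1 g2 :: "'r::comm_ring_1"
  assumes "\<alpha> \<le> \<beta>" "\<beta> \<le> p"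
  shows "(\<Sum>i<p. if i < \<alpha> then g0 else if i < \<beta> then g1 else g2) =
    of_nat \<alpha> * g0 + of_nat (\<beta> - \<alpha>) * g1 + of_nat (p - \<beta>) * g2"
proof -
  let ?f = "\<lambda>i. if i < \<alpha> then g0 else if i < \<beta> then g1 else g2"
  have "sum ?f {..<p} = sum ?f {..<\<alpha>} + (sum ?f {\<alpha>..<\<beta>} + sum ?f {\<beta>..<p})"
    unfolding sum.atLeastLessThan_concat[OF assms] lessThan_atLeast0
    by (rule sum.atLeastLessThan_concat[symmetric]) (use assms in auto)
  also have "\<dots> = (\<Sum>i<\<alpha>. g0) + ((\<Sum>i\<in>{\<alpha>..<\<beta>}. g1) + (\<Sum>i\<in>{\<beta>..<p}. g2))"
    using assms by (intro arg_cong2[of _ _ _ _ "(+)"] sum.cong) auto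
  finally show ?thesis by simp
qed

lemma div_threshold:
  assumes "i < p" "v \<le> p" shows "(i + v) div p = (if i < p - v then 0 else (1::nat))"
proof (cases "i < p - v")
  case False
  define r where "r = i + v - p"
  have "i + v = p + r" "r < p" using False assms by (auto simp: r_def)
  then show ?thesis using False by simp
qed (use assms in simp)

text \<open>Let c and d be the carries into the additions of the digits 2 w + 1 and w. If c \<le> d,
  the inequality is reversed afterwards, since a digit that carries with w also carries with 2 w +
  1. So only three of the four states occur; the coefficients count the digits below, between and
  above the two thresholds.\<close>

lemma digit_step:
  fixes g :: "nat \<Rightarrow> nat \<Rightarrow> 'r::comm_ring_1"
  assumes p: "p = 3 * w + 2" and c: "c \<le> d" "d \<le> 1"
  shows "(\<Sum>i<p. g ((i + (2 * w + 1) + c) div p) ((i + w + d) div p)) =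
    of_nat (w + 1 - c) * g 0 0 + of_nat (w + 1 + c - d) * g 1 0 + of_nat (w + d) * g 1 1"
proof -
  have "(\<Sum>i<p. g ((i + (2 * w + 1) + c) div p) ((i + w + d) div p)) =
      (\<Sum>i<p. if i < w + 1 - c then g 0 0 else if i < 2 * w + 2 - d then g 1 0 else g 1 1)"
  proof (rule sum.cong)
    fix i assume "i \<in> {..<p}"
    then have i: "i < p" by simp
    have "(i + (2 * w + 1 + c)) div p = (if i < w + 1 - c then 0 else 1)"
      using div_threshold[OF i, of "2 * w + 1 + c"] c by (simp add: p)
    moreover have "(i + (w + d)) div p = (if i < 2 * w + 2 - d then 0 else 1)"
      using div_threshold[OF i, of "w + d"] c by (simp add: p)
    ultimately show "g ((i + (2 * w + 1) + c) div p) ((i + w + d) div p) =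
       (if i < w + 1 - c then g 0 0 else if i < 2 * w + 2 - d then g 1 0 else g 1 1)"
      using c by (auto simp: add.assoc)
  qed simp
  also have "\<dots> = of_nat (w + 1 - c) * g 0 0 + of_nat ((2 * w + 2 - d) - (w + 1 - c)) * g 1 0 + of_nat (p - (2 * w + 2 - d)) * g 1 1"
    using c by (intro sum_three_ranges) (auto simp: p)
  finally have fin: "(\<Sum>i<p. g ((i + (2 * w + 1) + c) div p) ((i + w + d) div p)) =
      of_nat (w + 1 - c) * g 0 0 + of_nat ((2 * w + 2 - d) - (w + 1 - c)) * g 1 0 + of_nat (p - (2 * w + 2 - d)) * g 1 1" .
  show ?thesis
  proof -
    have "(2 * w + 2 - d) - (w + 1 - c) = w + 1 + c - d" "p - (2 * w + 2 - d) = w + d"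
      using c by (auto simp: p)
    then show ?thesis
      using fin by (simp only:)
  qed
qed

text \<open>After two digits the roles of the two numbers are restored, so on the states (0,0),
  (0,1), (1,1) a double step is a fixed 3 by 3 matrix. \<open>X\<close>, \<open>Y\<close>,
  \<open>Z\<close> absorb the weight of the carries out of the second digit.\<close>

lemma walk_sum_double_step:
  fixes x y :: "'r::comm_ring_1" and m a b c' d' c d :: nat
  assumes p: "p = 3 * w + 2" and c: "c \<le> d" "d \<le> 1"
  defines "W \<equiv> of_nat w :: 'r"
    and "X \<equiv> walk_sum x y p m a b c' d' 0 0"
    and "Y \<equiv> y * walk_sum x y p m a b c' d' 0 1"
    and "Z \<equiv> x * y * walk_sum x y p m a b c' d' 1 1"
  shows "walk_sum x y p (Suc (Suc m)) ((2 * w + 1) + p * (w + p * a)) (w + p * ((2 * w + 1) + p * b)) c' d' c d =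
     of_nat (w + 1 - c) * ((W + 1) * X + (W + 1) * Y + W * Z) +
     of_nat (w + 1 + c - d) * (x * ((W + 1) * X + W * Y + (W + 1) * Z)) +
     of_nat (w + d) * (x * y * (W * X + (W + 1) * Y + (W + 1) * Z))"
proof -
  let ?u = "2 * w + 1"
  let ?G = "walk_sum x y p (Suc m) (w + p * a) (?u + p * b) c' d'"
  let ?F = "walk_sum x y p m a b c' d'"
  have p0: "p > 0" and up: "?u < p" "w < p" using p by auto
  have dm: "(r + p * z) mod p = r" "(r + p * z) div p = z" if "r < p" for r z using that by simp_all
  note md = dm[OF up(1)] dm[OF up(2)]
  have G: "?G d1 c1 = of_nat (w + 1 - c1) * ?F 0 0 + of_nat (w + 1 + c1 - d1) * (y * ?F 0 1) + of_nat (w + d1) * (x * y * ?F 1 1)"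
    if "c1 \<le> d1" "d1 \<le> 1" for c1 d1
  proof -
    have "?G d1 c1 = (\<Sum>i<p. x ^ ((i + w + d1) div p) * y ^ ((i + ?u + c1) div p) * ?F ((i + w + d1) div p) ((i + ?u + c1) div p))"
      unfolding walk_sum_Suc[OF p0] md ..
    also have "\<dots> = of_nat (w + 1 - c1) * (x ^ 0 * y ^ 0 * ?F 0 0) + of_nat (w + 1 + c1 - d1) * (x ^ 0 * y ^ 1 * ?F 0 1) + of_nat (w + d1) * (x ^ 1 * y ^ 1 * ?F 1 1)"
      by (rule digit_step[OF p that, where g = "\<lambda>c d. x ^ d * y ^ c * ?F d c"])
    finally show ?thesis by simp
  qed
  have "walk_sum x y p (Suc (Suc m)) (?u + p * (w + p * a)) (w + p * (?u + p * b)) c' d' c d =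
      (\<Sum>i<p. x ^ ((i + ?u + c) div p) * y ^ ((i + w + d) div p) * ?G ((i + ?u + c) div p) ((i + w + d) div p))"
    unfolding walk_sum_Suc[OF p0, of x y "Suc m"] md ..
  also have "\<dots> = of_nat (w + 1 - c) * (x ^ 0 * y ^ 0 * ?G 0 0) + of_nat (w + 1 + c - d) * (x ^ 1 * y ^ 0 * ?G 1 0) + of_nat (w + d) * (x ^ 1 * y ^ 1 * ?G 1 1)"
    by (rule digit_step[OF p c, where g = "\<lambda>c d. x ^ c * y ^ d * ?G c d"])
  finally show ?thesis using G[of 0 0] G[of 0 1] G[of 1 1]
    unfolding X_def Y_def Z_def W_def by (simp add: mult.assoc add.commute[of 1 "of_nat w"])
qed

text \<open>\<open>P\<close>, \<open>Q\<close>, \<open>R\<close> are the trace, the sum of the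
  principal 2 by 2 minors and the determinant; every coordinate of an orbit satisfies the
  characteristic recurrence.\<close>

lemma cayley_hamilton_3:
  fixes m11 :: "'r::comm_ring_1"
  assumes X: "\<And>n. X (Suc n) = m11 * X n + m12 * Y n + m13 * Z n"
    and Y: "\<And>n. Y (Suc n) = m21 * X n + m22 * Y n + m23 * Z n"
    and Z: "\<And>n. Z (Suc n) = m31 * X n + m32 * Y n + m33 * Z n"
    and P: "P = m11 + m22 + m33"
    and Q: "Q = m11 * m22 - m12 * m21 + m11 * m33 - m13 * m31 + m22 * m33 - m23 * m32"
    and R: "R = m11 * (m22 * m33 - m23 * m32) - m12 * (m21 * m33 - m23 * m31) + m13 * (m21 * m32 - m22 * m31)"
  shows "X (Suc (Suc (Suc n))) = P * X (Suc (Suc n)) - Q * X (Suc n) + R * X n"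
    "Y (Suc (Suc (Suc n))) = P * Y (Suc (Suc n)) - Q * Y (Suc n) + R * Y n"
    "Z (Suc (Suc (Suc n))) = P * Z (Suc (Suc n)) - Q * Z (Suc n) + R * Z n"
  unfolding X Y Z P Q R by (simp_all add: algebra_simps)

primrec cubic_exponent :: "nat \<Rightarrow> nat \<Rightarrow> nat" where
  "cubic_exponent w 0 = 0"
| "cubic_exponent w (Suc m) = (2 * w + 1) + (3 * w + 2) * (w + (3 * w + 2) * cubic_exponent w m)"

lemma cubic_exponent: "3 * cubic_exponent w m + 1 = (3 * w + 2) ^ (2 * m)"
proof (induction m)
  case (Suc m)
  have "(3 * w + 2) ^ (2 * Suc m) = (3 * w + 2) * (3 * w + 2) * (3 * cubic_exponent w m + 1)"
    using Suc by (simp add: algebra_simps)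
  also have "\<dots> = 3 * cubic_exponent w (Suc m) + 1" by (simp add: algebra_simps)
  finally show ?case ..
qed simp

lemma double_cubic_exponent:
  "2 * cubic_exponent w (Suc m) = w + (3 * w + 2) * ((2 * w + 1) + (3 * w + 2) * (2 * cubic_exponent w m))"
  by (simp add: algebra_simps)

definition cubic_walk where
  "cubic_walk x y w c' d' c d m =
     walk_sum x y (3 * w + 2) (2 * m) (cubic_exponent w m) (2 * cubic_exponent w m) c' d' c d"

lemma cubic_walk_0: "cubic_walk x y w c' d' c d 0 = of_bool (c = c' \<and> d = d')"
  by (simp add: cubic_walk_def walk_sum_def)

lemma cubic_walk_Suc:
  fixes x y :: "'r::comm_ring_1" and w c d c' d' m :: nat
  assumes "c \<le> d" "d \<le> 1"
  defines "W \<equiv> of_nat w :: 'r"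
  shows "cubic_walk x y w c' d' c d (Suc m) =
     of_nat (w + 1 - c) * ((W + 1) * cubic_walk x y w c' d' 0 0 m + (W + 1) * (y * cubic_walk x y w c' d' 0 1 m)
       + W * (x * y * cubic_walk x y w c' d' 1 1 m)) +
     of_nat (w + 1 + c - d) * (x * ((W + 1) * cubic_walk x y w c' d' 0 0 m + W * (y * cubic_walk x y w c' d' 0 1 m)
       + (W + 1) * (x * y * cubic_walk x y w c' d' 1 1 m))) +
     of_nat (w + d) * (x * y * (W * cubic_walk x y w c' d' 0 0 m + (W + 1) * (y * cubic_walk x y w c' d' 0 1 m)
       + (W + 1) * (x * y * cubic_walk x y w c' d' 1 1 m)))"
proof -
  have e: "2 * Suc m = Suc (Suc (2 * m))" by simp
  have "cubic_walk x y w c' d' c d (Suc m) =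
    walk_sum x y (3 * w + 2) (Suc (Suc (2 * m))) ((2 * w + 1) + (3 * w + 2) * (w + (3 * w + 2) * cubic_exponent w m))
      (w + (3 * w + 2) * ((2 * w + 1) + (3 * w + 2) * (2 * cubic_exponent w m))) c' d' c d"
    unfolding cubic_walk_def e unfolding double_cubic_exponent unfolding cubic_exponent.simps(2) ..
  then show ?thesis unfolding walk_sum_double_step[OF refl assms(1,2)] W_def cubic_walk_def .
qed

text \<open>An outgoing carry equal to the incoming one is the end-around carry of addition modulo
  p^(2m) - 1. The sum over the three states is the trace of the m-th power of the double-step
  matrix.\<close>

definition cubic_trace where
  "cubic_trace x y w m = cubic_walk x y w 0 0 0 0 m + cubic_walk x y w 0 1 0 1 m + cubic_walk x y w 1 1 1 1 m"

text \<open>With W = (p - 2) / 3, the constants (p + 1) / 3, (2 p - 1) / 3 and p of the theorem are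
  W + 1, 2 W + 1 and 3 W + 2. The initial values are power sums of the eigenvalues, given by
  Newton's identities.\<close>

lemma cubic_trace_recurrence:
  fixes x y :: "'r::comm_ring_1" and w m :: nat
  defines "W \<equiv> of_nat w :: 'r"
  defines "P \<equiv> (W + 1)^2 * (x^2 * y^2 + x^2 * y + x * y^2 + x + y + 1) + W^2 * (3 * x * y)"
    and "Q \<equiv> (W + 1)^2 * (x * y * (x^2 * y^2 + x^2 * y + x * y^2 + x + y + 1)) + (2 * W + 1)^2 * (3 * x^2 * y^2)"
    and "R \<equiv> (3 * W + 2)^2 * (x^3 * y^3)"
  shows "cubic_trace x y w 0 = 3" "cubic_trace x y w 1 = P" "cubic_trace x y w 2 = P^2 - 2 * Q"
    "cubic_trace x y w (m + 3) = P * cubic_trace x y w (m + 2) - Q * cubic_trace x y w (m + 1) + R * cubic_trace x y w m"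
proof -
  let ?V = "W + 1"
  define m11 where "m11 = ?V * ?V + ?V * ?V * x + W * W * (x * y)"
  define m12 where "m12 = y * (?V * ?V + ?V * W * x + W * ?V * (x * y))"
  define m13 where "m13 = x * y * (?V * W + ?V * ?V * x + W * ?V * (x * y))"
  define m21 where "m21 = ?V * ?V + W * ?V * x + ?V * W * (x * y)"
  define m22 where "m22 = y * (?V * ?V + W * W * x + ?V * ?V * (x * y))"
  define m23 where "m23 = x * y * (?V * W + W * ?V * x + ?V * ?V * (x * y))"
  define m31 where "m31 = W * ?V + ?V * ?V * x + ?V * W * (x * y)"
  define m32 where "m32 = y * (W * ?V + ?V * W * x + ?V * ?V * (x * y))"
  define m33 where "m33 = x * y * (W * W + ?V * ?V * x + ?V * ?V * (x * y))"
  note ms = m11_def m12_def m13_def m21_def m22_def m23_def m31_def m32_def m33_def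
  have X: "cubic_walk x y w c' d' 0 0 (Suc i) = m11 * cubic_walk x y w c' d' 0 0 i + m12 * cubic_walk x y w c' d' 0 1 i + m13 * cubic_walk x y w c' d' 1 1 i" for c' d' i
    unfolding ms by (subst cubic_walk_Suc) (simp_all add: W_def algebra_simps)
  have Y: "cubic_walk x y w c' d' 0 1 (Suc i) = m21 * cubic_walk x y w c' d' 0 0 i + m22 * cubic_walk x y w c' d' 0 1 i + m23 * cubic_walk x y w c' d' 1 1 i" for c' d' i
    unfolding ms by (subst cubic_walk_Suc) (simp_all add: W_def algebra_simps)
  have Z: "cubic_walk x y w c' d' 1 1 (Suc i) = m31 * cubic_walk x y w c' d' 0 0 i + m32 * cubic_walk x y w c' d' 0 1 i + m33 * cubic_walk x y w c' d' 1 1 i" for c' d' i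
    unfolding ms by (subst cubic_walk_Suc) (simp_all add: W_def algebra_simps)
  have P: "P = m11 + m22 + m33"
    unfolding P_def ms by (simp add: algebra_simps power2_eq_square)
  have Q: "Q = m11 * m22 - m12 * m21 + m11 * m33 - m13 * m31 + m22 * m33 - m23 * m32"
    unfolding Q_def ms by (simp add: algebra_simps power2_eq_square)
  have R: "R = m11 * (m22 * m33 - m23 * m32) - m12 * (m21 * m33 - m23 * m31) + m13 * (m21 * m32 - m22 * m31)"
    unfolding R_def ms by (simp add: algebra_simps power2_eq_square power3_eq_cube)
  show "cubic_trace x y w 0 = 3" by (simp add: cubic_trace_def cubic_walk_0)
  show "cubic_trace x y w 1 = P"
    unfolding cubic_trace_def One_nat_def X[unfolded One_nat_def] Y[unfolded One_nat_def] Z[unfolded One_nat_def] by (simp add: cubic_walk_0 P)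
  show "cubic_trace x y w 2 = P^2 - 2 * Q"
    unfolding cubic_trace_def numeral_2_eq_2 One_nat_def X[unfolded One_nat_def] Y[unfolded One_nat_def] Z[unfolded One_nat_def]
    by (simp add: cubic_walk_0 P Q power2_eq_square algebra_simps)
  have e: "m + 3 = Suc (Suc (Suc m))" "m + 2 = Suc (Suc m)" "m + 1 = Suc m" by simp_all
  have ch1: "cubic_walk x y w c' d' 0 0 (Suc (Suc (Suc m))) = P * cubic_walk x y w c' d' 0 0 (Suc (Suc m)) - Q * cubic_walk x y w c' d' 0 0 (Suc m) + R * cubic_walk x y w c' d' 0 0 m" for c' d'
    by (rule cayley_hamilton_3(1)[where X = "cubic_walk x y w c' d' 0 0" and Y = "cubic_walk x y w c' d' 0 1"
          and Z = "cubic_walk x y w c' d' 1 1"]) (rule X Y Z P Q R)+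
  have ch2: "cubic_walk x y w c' d' 0 1 (Suc (Suc (Suc m))) = P * cubic_walk x y w c' d' 0 1 (Suc (Suc m)) - Q * cubic_walk x y w c' d' 0 1 (Suc m) + R * cubic_walk x y w c' d' 0 1 m" for c' d'
    by (rule cayley_hamilton_3(2)[where X = "cubic_walk x y w c' d' 0 0" and Y = "cubic_walk x y w c' d' 0 1"
          and Z = "cubic_walk x y w c' d' 1 1"]) (rule X Y Z P Q R)+
  have ch3: "cubic_walk x y w c' d' 1 1 (Suc (Suc (Suc m))) = P * cubic_walk x y w c' d' 1 1 (Suc (Suc m)) - Q * cubic_walk x y w c' d' 1 1 (Suc m) + R * cubic_walk x y w c' d' 1 1 m" for c' d'
    by (rule cayley_hamilton_3(3)[where X = "cubic_walk x y w c' d' 0 0" and Y = "cubic_walk x y w c' d' 0 1"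
          and Z = "cubic_walk x y w c' d' 1 1"]) (rule X Y Z P Q R)+
  show "cubic_trace x y w (m + 3) = P * cubic_trace x y w (m + 2) - Q * cubic_trace x y w (m + 1) + R * cubic_trace x y w m"
    unfolding cubic_trace_def e ch1 ch2 ch3 by (simp add: algebra_simps)
qed

section \<open>The polynomials C(2s) as generating functions\<close>

lemma bi_const_of_nat: "bi_const (of_nat z) = of_nat z"
  by (simp add: bi_const_def of_nat_poly)

text \<open>The trace recurrence already holds from the zeroth trace 3 on, which is where the term 6
  R in C(6) comes from.\<close>

lemma C_poly_eq_trace:
  assumes p: "p = 3 * w + 2" and s: "s > 0"
  shows "C_poly p s = 2 * cubic_trace bi_x bi_y w s"
proof -
  have c: "(of_nat p + 1) / 3 = (of_nat (w + 1) :: complex)" "(of_nat p - 2) / 3 = (of_nat w :: complex)"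
    "(2 * of_nat p - 1) / 3 = (of_nat (2 * w + 1) :: complex)"
    by (simp_all add: p field_simps)
  have sq: "bi_const ((of_nat z)^2) = (of_nat z)^2" for z
    using bi_const_of_nat[of "z^2"] by simp
  have P: "P_poly p = (of_nat w + 1)^2 * (bi_x^2 * bi_y^2 + bi_x^2 * bi_y + bi_x * bi_y^2 + bi_x + bi_y + 1) + (of_nat w)^2 * (3 * bi_x * bi_y)"
    unfolding P_poly_def c sq by (simp add: add.commute)
  have Q: "Q_poly p = (of_nat w + 1)^2 * (bi_x * bi_y * (bi_x^2 * bi_y^2 + bi_x^2 * bi_y + bi_x * bi_y^2 + bi_x + bi_y + 1)) + (2 * of_nat w + 1)^2 * (3 * bi_x^2 * bi_y^2)"
    unfolding Q_poly_def c sq by (simp add: add.commute)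
  have R: "R_poly p = (3 * of_nat w + 2)^2 * (bi_x^3 * bi_y^3)"
    unfolding R_poly_def sq by (simp add: p add.commute[of 2 "3 * of_nat w"])
  note rec = cubic_trace_recurrence[of bi_x bi_y w, folded P Q R]
  show ?thesis using s
  proof (induction s rule: less_induct)
    case (less s)
    consider "s = 1" | "s = 2" | "s = 3" | "s > 3" using less.prems by linarith
    then show ?case
    proof cases
      case 1 then show ?thesis using rec(2) by (simp add: C_poly.simps)
    next
      case 2 then show ?thesis using rec(3) by (simp add: C_poly.simps)
    next
      case 3
      have "cubic_trace bi_x bi_y w 3 = P_poly p * (P_poly p ^ 2 - 2 * Q_poly p) - Q_poly p * P_poly p + R_poly p * 3"
        using rec(4)[of 0] rec(1-3) by (simp add: numeral_2_eq_2)
      then show ?thesis unfolding 3 by (simp add: C_poly.simps) (simp add: algebra_simps power2_eq_square power3_eq_cube)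
    next
      case 4
      have "C_poly p s = P_poly p * C_poly p (s - 1) - Q_poly p * C_poly p (s - 2) + R_poly p * C_poly p (s - 3)"
        by (subst C_poly.simps) (use 4 in simp)
      also have "\<dots> = P_poly p * (2 * cubic_trace bi_x bi_y w (s - 1)) - Q_poly p * (2 * cubic_trace bi_x bi_y w (s - 2))
           + R_poly p * (2 * cubic_trace bi_x bi_y w (s - 3))"
        using 4 less.IH[of "s - 1"] less.IH[of "s - 2"] less.IH[of "s - 3"] by simp
      also have "\<dots> = 2 * cubic_trace bi_x bi_y w s"
      proof -
        have "s - 3 + 3 = s" "s - 3 + 2 = s - 1" "s - 3 + 1 = s - 2" using 4 by auto
        then have "cubic_trace bi_x bi_y w s = P_poly p * cubic_trace bi_x bi_y w (s - 1)
            - Q_poly p * cubic_trace bi_x bi_y w (s - 2) + R_poly p * cubic_trace bi_x bi_y w (s - 3)"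
          using rec(4)[of "s - 3"] by (simp only:)
        then show ?thesis by (simp only: mult_2 distrib_left) (simp add: algebra_simps)
      qed
      finally show ?thesis .
    qed
  qed
qed

lemma coeff_xy_add: "coeff_xy (F + G) a b = coeff_xy F a b + coeff_xy G a b"
  by (simp add: coeff_xy_def)

lemma coeff_xy_sum: "coeff_xy (\<Sum>i\<in>I. F i) a b = (\<Sum>i\<in>I. coeff_xy (F i) a b)"
  by (simp add: coeff_xy_def coeff_sum)

lemma coeff_xy_double: "coeff_xy (2 * F) a b = 2 * coeff_xy F a b"
  unfolding mult_2 by (rule coeff_xy_add)

lemma coeff_xy_monomial: "coeff_xy (of_bool Pr * (bi_x ^ i * bi_y ^ l)) a b = of_bool (Pr \<and> i = a \<and> l = b)"
proof -
  have x: "bi_x ^ i = monom 1 i" by (induction i) (simp_all add: bi_x_def monom_Suc)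
  have "bi_y ^ l = [:monom 1 l:]"
  proof (induction l)
    case (Suc l)
    then show ?case by (simp add: bi_y_def) (simp add: monom_Suc)
  qed (simp add: one_pCons)
  then have "bi_x ^ i * bi_y ^ l = monom (monom 1 l) i" unfolding x
    by (simp add: smult_monom mult.commute[of "monom _ _"])
  then show ?thesis by (cases Pr) (auto simp: coeff_xy_def)
qed

context cubic_jacobi
begin

definition closed_walk :: "nat \<Rightarrow> nat \<Rightarrow> nat \<Rightarrow> bool" where
  "closed_walk c d j \<longleftrightarrow> carry_out p (2 * t) k j c = c \<and> carry_out p (2 * t) (2 * k) j d = d"

lemma carry_out_cubic:
  assumes "u \<in> {k, 2 * k}" "j \<le> n"
  shows "carry_out p (2 * t) u j c = (j + u + c) div Suc n"
    "(p - 1) * carries p (2 * t) u j c + s ((j + u + c) mod Suc n) + carry_out p (2 * t) u j c = s j + (p - 1) * t + c"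
proof -
  have "u < p ^ (2 * t)" "j < p ^ (2 * t)" using assms by (auto simp: q_eq[symmetric] n_eq)
  note cd = carries_digit_sum[OF p_gt_1 this, of c]
  have "s u = (p - 1) * t" using assms(1) digit_sum_k by (auto simp: mult.commute)
  then show "carry_out p (2 * t) u j c = (j + u + c) div Suc n"
    "(p - 1) * carries p (2 * t) u j c + s ((j + u + c) mod Suc n) + carry_out p (2 * t) u j c = s j + (p - 1) * t + c"
    using cd by (simp_all only: q_eq)
qed

text \<open>The end-around carry is self-consistent for exactly one \<open>c\<close>. The exception
  is \<open>j + u = n\<close>, where all digits of the sum are p - 1 and both values reproduce
  themselves.\<close>

lemma carry_out_eq_iff:
  assumes "u \<in> {k, 2 * k}" "j \<le> n" "j + u \<noteq> n" "c \<le> 1"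
  shows "carry_out p (2 * t) u j c = c \<longleftrightarrow> c = (if j + u < n then 0 else 1)"
proof -
  have u: "0 < u" "u < n" using assms(1) k_gt_1 by (auto simp: n_eq)
  show ?thesis
  proof (cases "j + u < n")
    case True
    then show ?thesis using assms unfolding carry_out_cubic(1)[OF assms(1,2)] by auto
  next
    case False
    then have "Suc n \<le> j + u + c" "j + u + c < 2 * Suc n" using assms u by auto
    then have "(j + u + c) div Suc n = 1" by (simp add: div_nat_eqI)
    then show ?thesis using False assms(4) unfolding carry_out_cubic(1)[OF assms(1,2)] by auto
  qed
qed

lemma carries_closed:
  assumes "u \<in> {k, 2 * k}" "j \<le> n" "c \<le> 1" "carry_out p (2 * t) u j c = c"
  shows "(p - 1) * carries p (2 * t) u j c + s ((j + u + c) mod Suc n) = s j + (p - 1) * t"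
  using carry_out_cubic(2)[OF assms(1,2), of c] assms(4) by simp

text \<open>With the self-consistent carry the addition is the one modulo n, so the number of
  carries satisfies the same digit sum equation as the valuation in
  \<open>cubic_val\<close>.\<close>

lemma carries_generic:
  assumes j: "j \<in> gen" and c: "c \<le> 1"
  shows "carry_out p (2 * t) k j c = c \<Longrightarrow> carries p (2 * t) k j c = A j"
    "carry_out p (2 * t) (2 * k) j c = c \<Longrightarrow> carries p (2 * t) (2 * k) j c = B j"
proof -
  have jn: "j \<le> n" "j < n" "\<not> k dvd j" using j by (auto simp: gen_def)
  have main: "carries p (2 * t) u j c = vJ j u" if pr: "cubic_pair u v" and co: "carry_out p (2 * t) u j c = c" for u v
  proof -
    have u: "u \<in> {k, 2 * k}" "0 < u" "u < n" using pr k_gt_1 by (auto simp: cubic_pair_def n_eq)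
    have ne: "j + u \<noteq> n"
    proof
      assume e: "j + u = n"
      have "k dvd n" by (simp add: n_eq)
      then have "k dvd j + u" by (simp only: e)
      then show False using jn(3) cubic_pairD(1)[OF pr] by (simp add: dvd_add_left_iff)
    qed
    have "c = (if j + u < n then 0 else 1)" using carry_out_eq_iff[OF u(1) jn(1) ne c] co by blast
    then have "(j + u + c) mod Suc n = (j + u) mod n"
    proof (cases "j + u < n")
      case False
      then have c1: "c = 1" using \<open>c = _\<close> by simp
      define z where "z = j + u - n"
      have z: "j + u = z + n" "z < n" using False jn u by (auto simp: z_def)
      have "j + u + c = z + Suc n" using z c1 by simp
      then have "(j + u + c) mod Suc n = z" using z by (simp only: mod_add_self2) simp
      then show ?thesis using z by simp
    qed simp
    then have "(p - 1) * carries p (2 * t) u j c + s ((j + u) mod n) = (p - 1) * t + s j"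
      using carries_closed[OF u(1) jn(1) c co] by simp
    then have "(p - 1) * carries p (2 * t) u j c = (p - 1) * vJ j u"
      using cubic_val(2)[OF pr jn(3,2)] by linarith
    then show ?thesis using p_gt_1 by simp
  qed
  show "carry_out p (2 * t) k j c = c \<Longrightarrow> carries p (2 * t) k j c = A j"
    using main[of k "2 * k"] by (simp add: cubic_pair_def A_def)
  show "carry_out p (2 * t) (2 * k) j c = c \<Longrightarrow> carries p (2 * t) (2 * k) j c = B j"
    using main[of "2 * k" k] by (simp add: cubic_pair_def B_def)
qed

definition good :: "nat \<Rightarrow> nat \<Rightarrow> nat \<Rightarrow> nat \<Rightarrow> bool" where
  "good m c d j \<longleftrightarrow> closed_walk c d j \<and> carries p (2 * t) k j c = m \<and>
     m < carries p (2 * t) (2 * k) j d \<and> carries p (2 * t) (2 * k) j d \<le> t"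

text \<open>Exactly one pair of carries closes up, and it is never (1, 0), because j + k \<ge> n
  implies j + 2 k \<ge> n.\<close>

lemma good_generic:
  assumes j: "j \<in> gen"
  shows "of_bool (good m 0 0 j) + of_bool (good m 0 1 j) + of_bool (good m 1 1 j) =
    (of_bool (A j = m \<and> m < B j \<and> B j \<le> t) :: nat)"
proof -
  have jn: "j \<le> n" "\<not> k dvd j" using j by (auto simp: gen_def)
  have ne: "j + u \<noteq> n" if u: "u \<in> {k, 2 * k}" for u
  proof
    assume e: "j + u = n"
    have "k dvd n" by (simp add: n_eq)
    then have "k dvd j + u" by (simp only: e)
    then show False using jn(2) u by (auto simp: dvd_add_left_iff)
  qed
  have k1: "k \<in> {k, 2 * k}" "2 * k \<in> {k, 2 * k}" by auto
  have cl: "closed_walk c d j \<longleftrightarrow> c = (if j + k < n then 0 else 1) \<and> d = (if j + 2 * k < n then 0 else 1)"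
    if "c \<le> 1" "d \<le> 1" for c d
    unfolding closed_walk_def carry_out_eq_iff[OF k1(1) jn(1) ne[OF k1(1)] that(1)]
      carry_out_eq_iff[OF k1(2) jn(1) ne[OF k1(2)] that(2)] ..
  have g: "good m c d j \<longleftrightarrow> closed_walk c d j \<and> A j = m \<and> m < B j \<and> B j \<le> t" if "c \<le> 1" "d \<le> 1" for c d
    using carries_generic[OF j] that unfolding good_def closed_walk_def by auto
  have g3: "good m 0 0 j \<longleftrightarrow> closed_walk 0 0 j \<and> A j = m \<and> m < B j \<and> B j \<le> t"
    "good m 0 1 j \<longleftrightarrow> closed_walk 0 1 j \<and> A j = m \<and> m < B j \<and> B j \<le> t"
    "good m 1 1 j \<longleftrightarrow> closed_walk 1 1 j \<and> A j = m \<and> m < B j \<and> B j \<le> t" by (auto simp: g)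
  have c3: "closed_walk 0 0 j \<longleftrightarrow> j + k < n \<and> j + 2 * k < n" "closed_walk 0 1 j \<longleftrightarrow> j + k < n \<and> \<not> j + 2 * k < n"
    "closed_walk 1 1 j \<longleftrightarrow> \<not> j + k < n \<and> \<not> j + 2 * k < n" by (auto simp: cl)
  show ?thesis unfolding g3 c3 by auto
qed

lemma digit_sum_n: "s n = 2 * t * (p - 1)"
proof -
  have "s n \<le> 2 * t * (p - 1)"
  proof -
    have "digit_sum p m x \<le> m * (p - 1)" for m x
    proof (induction m arbitrary: x)
      case (Suc m)
      have "x mod p \<le> p - 1" using p_gt_1 by (metis Suc_pred' less_Suc_eq_le mod_less_divisor neq0_conv not_less_zero less_trans zero_less_one)
      then show ?case using Suc[of "x div p"] by simp
    qed simp
    then show ?thesis .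
  qed
  moreover have "digit_sum p m (p ^ m - 1) = m * (p - 1)" for m
  proof (induction m)
    case (Suc m)
    have "p ^ Suc m - 1 = (p - 1) + p * (p ^ m - 1)" using p_gt_1
      by (simp add: diff_mult_distrib2)
    moreover have "(r + p * z) mod p = r" "(r + p * z) div p = z" if "r < p" for r z using that by simp_all
    from this[of "p - 1" "p ^ m - 1"] have "((p - 1) + p * (p ^ m - 1)) mod p = p - 1" "((p - 1) + p * (p ^ m - 1)) div p = p ^ m - 1"
      using p_gt_1 by simp_all
    ultimately show ?case using Suc by simp
  qed simp
  moreover have "n = p ^ (2 * t) - 1" using q_eq by simp
  ultimately show ?thesis by simp
qed

text \<open>The multiples 0, k, 2 k, n of k belong to no generic block, and 0 and n are distinct
  digit words. Only 2 k contributes, in the state (0, 1): adding k gives n without any carry, adding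
  2 k gives t carries. After doubling, this is the summand 2 in e_0.\<close>

lemma good_special:
  assumes j: "j \<le> n" "k dvd j" and m: "m < t"
  shows "of_bool (good m 0 0 j) + of_bool (good m 0 1 j) + of_bool (good m 1 1 j) = (of_bool (j = 2 * k \<and> m = 0) :: nat)"
proof -
  have k1: "k \<in> {k, 2 * k}" "2 * k \<in> {k, 2 * k}" by auto
  have k0: "0 < k" using k_gt_1 by simp
  have sk: "s k = (p - 1) * t" "s (2 * k) = (p - 1) * t" "s n = (p - 1) * (2 * t)" "s 0 = 0"
    using digit_sum_k digit_sum_n by (simp_all add: mult.commute)
  have p1: "p - 1 \<noteq> 0" using p_gt_1 by simp
  have lin: "x = y" if "(p - 1) * x = (p - 1) * y" for x y using that p1 by simp
  obtain i where i: "j = k * i" using j(2) by blast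
  then have "k * i \<le> k * 3" using j(1) by (simp add: n_eq mult.commute)
  then have "i \<le> 3" using k0 by simp
  then consider "j = 0" | "j = k" | "j = 2 * k" | "j = n" using i by (auto simp: n_eq le_Suc_eq numeral_3_eq_3)
  then show ?thesis
  proof cases
    case 1
    have co: "carry_out p (2 * t) (2 * k) 0 d = 0" if "d \<le> 1" for d
      using carry_out_cubic(1)[OF k1(2), of 0 d] that k0 by (simp add: n_eq)
    have "carries p (2 * t) (2 * k) 0 0 = 0"
      using carries_closed[OF k1(2), of 0 0] co[of 0] sk k0 p1 by (simp add: n_eq)
    then have "\<not> good m c d 0" if "d \<le> 1" for c d
      using co[of d] that unfolding good_def closed_walk_def by (cases "d = 0") auto
    then show ?thesis using 1 k0 by simp
  next
    case 2
    have "(k + k + c) < Suc n" "(k + k + c) mod Suc n = k + k + c" if "c \<le> 1" for c using that k_gt_1 by (auto simp: n_eq)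
    then have co: "carry_out p (2 * t) k k c = 0" if "c \<le> 1" for c
      using carry_out_cubic(1)[OF k1(1), of k c] that k0 by (simp add: n_eq)
    have "(p - 1) * carries p (2 * t) k k 0 = (p - 1) * t"
      using carries_closed[OF k1(1), of k 0] co[of 0] sk k_gt_1 by (auto simp: n_eq mult_2[symmetric])
    then have "carries p (2 * t) k k 0 = t" by (rule lin)
    then have "\<not> good m c d k" if "c \<le> 1" for c d
      using co[of c] that m unfolding good_def closed_walk_def by (cases "c = 0") auto
    then show ?thesis using 2 k0 by simp
  next
    case 3
    have co2: "carry_out p (2 * t) (2 * k) (2 * k) d = 1" if "d \<le> 1" for d
    proof -
      have "2 * k \<le> n" by (simp add: n_eq)
      then have "carry_out p (2 * t) (2 * k) (2 * k) d = (2 * k + 2 * k + d) div Suc n"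
        by (rule carry_out_cubic(1)[OF k1(2)])
      also have "\<dots> = 1" by (rule div_nat_eqI) (use that k_gt_1 in \<open>simp_all add: n_eq\<close>)
      finally show ?thesis .
    qed
    have "2 * k + 2 * k + 1 = k + Suc n" by (simp add: n_eq)
    moreover have "(k + Suc n) mod Suc n = k" by (simp only: mod_add_self2) (simp add: n_eq)
    ultimately have "(2 * k + 2 * k + 1) mod Suc n = k" by (simp only:)
    then have "(p - 1) * carries p (2 * t) (2 * k) (2 * k) 1 + s k = s (2 * k) + (p - 1) * t"
      using carries_closed[OF k1(2), of "2 * k" 1] co2[of 1] by (simp add: n_eq)
    then have c21: "carries p (2 * t) (2 * k) (2 * k) 1 = t" using sk lin by simp
    have co10: "carry_out p (2 * t) k (2 * k) 0 = 0" "carry_out p (2 * t) k (2 * k) 1 = 1"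
      using carry_out_cubic(1)[OF k1(1), of "2 * k"] by (simp_all add: n_eq)
    have "(p - 1) * carries p (2 * t) k (2 * k) 0 + s n = s (2 * k) + (p - 1) * t"
      using carries_closed[OF k1(1), of "2 * k" 0] co10 by (simp add: n_eq)
    then have c10: "carries p (2 * t) k (2 * k) 0 = 0" using sk p1 by (simp add: mult_2[symmetric] mult.left_commute)
    have "(p - 1) * carries p (2 * t) k (2 * k) 1 + s 0 = s (2 * k) + (p - 1) * t"
      using carries_closed[OF k1(1), of "2 * k" 1] co10 by (simp add: n_eq)
    then have c11: "carries p (2 * t) k (2 * k) 1 = 2 * t" using sk lin[of _ "2 * t"] by (simp add: mult_2[symmetric] mult.left_commute)
    have "\<not> good m 0 0 j" "good m 0 1 j \<longleftrightarrow> m = 0" "\<not> good m 1 1 j"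
      unfolding 3 good_def closed_walk_def using co2[of 0] co2[of 1] co10 c10 c11 c21 m by auto
    then show ?thesis using 3 by simp
  next
    case 4
    have "(n + k + c) div Suc n = 1" if "c \<le> 1" for c
    proof -
      have "n + k + c = Suc n + (k - 1 + c)" "k - 1 + c < Suc n" using that k_gt_1 by (auto simp: n_eq)
      then show ?thesis by (metis div_add_self1 div_less nat.distinct(1) add_0 One_nat_def plus_1_eq_Suc add.commute)
    qed
    then have co: "carry_out p (2 * t) k n c = 1" if "c \<le> 1" for c
      using carry_out_cubic(1)[OF k1(1), of n c] that by simp
    have "n + k + 1 = Suc n + k" "k < Suc n" by (auto simp: n_eq)
    then have "(n + k + 1) mod Suc n = k" by (metis mod_add_self1 mod_less)
    then have "(p - 1) * carries p (2 * t) k n 1 + s k = s n + (p - 1) * t"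
      using carries_closed[OF k1(1), of n 1] co[of 1] by simp
    then have "(p - 1) * carries p (2 * t) k n 1 = (p - 1) * (2 * t)" by (simp only: sk add_right_cancel)
    then have "carries p (2 * t) k n 1 = 2 * t" by (rule lin)
    then have "\<not> good m c d n" if "c \<le> 1" for c d
      using co[of c] that m unfolding good_def closed_walk_def by (cases "c = 1") auto
    then show ?thesis using 4 k0 by (simp add: n_eq)
  qed
qed

text \<open>The trace is a sum of monomials over digit words j, so the sum of coefficients counts
  closed words, split into generic exponents and multiples of k.\<close>

lemma sum_coeff_C_poly:
  assumes m: "m < t"
  shows "(\<Sum>b\<in>{m<..t}. coeff_xy (C_poly p t) m b) =
    of_nat (2 * (card {j \<in> gen. A j = m \<and> m < B j \<and> B j \<le> t} + of_bool (m = 0)))"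
proof -
  have "p mod 3 = 2" using p_mod_3 by (simp add: cong_def)
  then have p: "p = 3 * (p div 3) + 2" by (metis mult_div_mod_eq)
  define w where "w = p div 3"
  note p' = p[folded w_def]
  have k: "cubic_exponent w t = k" using cubic_exponent[of w t] p' q_eq n_eq by simp
  have co: "coeff_xy (cubic_walk bi_x bi_y w c d c d t) m b =
      (\<Sum>j\<le>n. of_bool (closed_walk c d j \<and> carries p (2 * t) k j c = m \<and> carries p (2 * t) (2 * k) j d = b))" for c d b
  proof -
    have "{..<p ^ (2 * t)} = {..n}" using q_eq by (simp add: lessThan_Suc_atMost[symmetric])
    then show ?thesis unfolding cubic_walk_def walk_sum_def coeff_xy_sum coeff_xy_monomial k p'[symmetric] closed_walk_def
      by (simp add: conj_assoc)
  qed
  have sum_b: "(\<Sum>b\<in>{m<..t}. coeff_xy (cubic_walk bi_x bi_y w c d c d t) m b) = (\<Sum>j\<le>n. of_bool (good m c d j))" for c d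
  proof -
    have "(\<Sum>b\<in>{m<..t}. of_bool (closed_walk c d j \<and> carries p (2 * t) k j c = m \<and> carries p (2 * t) (2 * k) j d = b)) =
        (of_bool (good m c d j) :: complex)" for j
    proof -
      have "(\<Sum>b\<in>{m<..t}. of_bool (Pr \<and> z = b)) = (of_bool (Pr \<and> m < z \<and> z \<le> t) :: complex)" for Pr and z :: nat
        by (cases Pr) (simp_all add: of_bool_def sum.delta)
      from this[of "closed_walk c d j \<and> carries p (2 * t) k j c = m" "carries p (2 * t) (2 * k) j d"]
      show ?thesis by (simp add: good_def conj_assoc)
    qed
    then show ?thesis unfolding co by (subst sum.swap) simp
  qed
  have "(\<Sum>b\<in>{m<..t}. coeff_xy (C_poly p t) m b) = 2 * (\<Sum>b\<in>{m<..t}. coeff_xy (cubic_trace bi_x bi_y w t) m b)"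
    unfolding C_poly_eq_trace[OF p' t_pos] coeff_xy_double by (rule sum_distrib_left[symmetric])
  also have "(\<Sum>b\<in>{m<..t}. coeff_xy (cubic_trace bi_x bi_y w t) m b) =
      (\<Sum>j\<le>n. of_bool (good m 0 0 j)) + (\<Sum>j\<le>n. of_bool (good m 0 1 j)) + (\<Sum>j\<le>n. of_bool (good m 1 1 j))"
    unfolding cubic_trace_def coeff_xy_add sum.distrib sum_b ..
  also have "\<dots> = of_nat (\<Sum>j\<le>n. of_bool (good m 0 0 j) + of_bool (good m 0 1 j) + of_bool (good m 1 1 j))"
    by (simp add: sum.distrib)
  also have "(\<Sum>j\<le>n. of_bool (good m 0 0 j) + of_bool (good m 0 1 j) + of_bool (good m 1 1 j)) =
      (\<Sum>j\<in>gen. of_bool (A j = m \<and> m < B j \<and> B j \<le> t)) + (\<Sum>j\<in>{j. j \<le> n \<and> k dvd j}. of_bool (j = 2 * k \<and> m = 0) :: nat)"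
  proof -
    have "k dvd n" by (simp add: n_eq)
    then have "{..n} = gen \<union> {j. j \<le> n \<and> k dvd j}" unfolding gen_def by (auto simp: le_less)
    then have "(\<Sum>j\<le>n. of_bool (good m 0 0 j) + of_bool (good m 0 1 j) + of_bool (good m 1 1 j)) =
      (\<Sum>j\<in>gen. of_bool (good m 0 0 j) + of_bool (good m 0 1 j) + of_bool (good m 1 1 j)) +
      (\<Sum>j\<in>{j. j \<le> n \<and> k dvd j}. of_bool (good m 0 0 j) + of_bool (good m 0 1 j) + of_bool (good m 1 1 j) :: nat)"
      by (simp only:) (rule sum.union_disjoint, auto simp: gen_def)
    then show ?thesis by (simp add: good_generic good_special m del: One_nat_def)
  qed
  also have "(\<Sum>j\<in>gen. of_bool (A j = m \<and> m < B j \<and> B j \<le> t)) = card {j \<in> gen. A j = m \<and> m < B j \<and> B j \<le> t}"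
    using finite_gen by (simp add: of_bool_def sum.If_cases Int_def)
  also have "(\<Sum>j\<in>{j. j \<le> n \<and> k dvd j}. of_bool (j = 2 * k \<and> m = 0)) = (of_bool (m = 0) :: nat)"
  proof -
    have "(\<Sum>j\<in>{j. j \<le> n \<and> k dvd j}. of_bool (j = 2 * k \<and> m = 0)) =
        (\<Sum>j\<in>{j. j \<le> n \<and> k dvd j}. if j = 2 * k then of_bool (m = 0) else (0::nat))" by (intro sum.cong) auto
    also have "\<dots> = of_bool (m = 0)" by (subst sum.delta) (auto simp: n_eq)
    finally show ?thesis .
  qed
  finally show ?thesis by simp
qed

end

text \<open>At x = 0 the polynomials Q and R vanish and P becomes c (1 + y), so C(2 t) becomes 2 c^t
  (1 + y)^t. The sum over b > 0 is its value at y = 1 minus that at y = 0.\<close>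

lemma sum_coeff_C_poly_0:
  assumes "t > 0"
  shows "(\<Sum>b\<in>{0<..t}. coeff_xy (C_poly p t) 0 b) = ((of_nat p + 1) / 3) ^ (2 * t) * (2 ^ (t + 1) - 2)"
proof -
  define c where "c = ((of_nat p + 1) / 3 :: complex)^2"
  have x0: "poly bi_x 0 = 0" by (simp add: bi_x_def)
  have P: "poly (P_poly p) 0 = smult c [:1, 1:]"
    by (simp add: P_poly_def x0 bi_const_def bi_y_def c_def one_pCons)
  have Q: "poly (Q_poly p) 0 = 0" by (simp add: Q_poly_def x0)
  have R: "poly (R_poly p) 0 = 0" by (simp add: R_poly_def x0)
  have C1: "C_poly p 1 = 2 * P_poly p" by (simp add: C_poly.simps)
  have C2: "C_poly p 2 = 2 * ((P_poly p)^2 - 2 * Q_poly p)" by (simp add: C_poly.simps)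
  have C3: "C_poly p 3 = 6 * R_poly p + 2 * ((P_poly p)^3 - 2 * Q_poly p * P_poly p) - 2 * P_poly p * Q_poly p"
    by (simp add: C_poly.simps)
  have C: "poly (C_poly p s) 0 = 2 * (smult c [:1, 1:]) ^ s" if "s > 0" for s
    using that
  proof (induction s rule: less_induct)
    case (less s)
    consider "s = 1" | "s = 2" | "s = 3" | "s > 3" using less.prems by linarith
    then show ?case
    proof cases
      case 4
      have "poly (C_poly p s) 0 = poly (P_poly p * C_poly p (s - 1) - Q_poly p * C_poly p (s - 2) + R_poly p * C_poly p (s - 3)) 0"
        by (subst C_poly.simps) (use 4 in simp)
      also have "\<dots> = smult c [:1, 1:] * (2 * (smult c [:1, 1:]) ^ (s - 1))"
        using less.IH[of "s - 1"] 4 by (simp only: poly_add poly_diff poly_mult P Q R) simp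
      also have "\<dots> = 2 * (smult c [:1, 1:] * (smult c [:1, 1:]) ^ (s - 1))" by (rule mult.left_commute)
      also have "smult c [:1, 1:] * (smult c [:1, 1:]) ^ (s - 1) = (smult c [:1, 1:]) ^ s"
        using 4 by (metis less.prems power_minus_mult mult.commute)
      finally show ?thesis .
    qed (simp_all only: C1 C2 C3 poly_add poly_diff poly_mult poly_power P Q R, simp_all)
  qed
  define f where "f = smult (2 * c ^ t) ([:1, 1:] ^ t)"
  have f: "poly (C_poly p t) 0 = f"
  proof -
    have "(smult c v) ^ u = smult (c ^ u) (v ^ u)" for v :: "complex poly" and u
      by (induction u) (simp_all add: mult.commute)
    then show ?thesis unfolding C[OF assms] f_def by (simp only: mult_2 smult_add_left)
  qed
  have deg: "degree f \<le> t"
    unfolding f_def using degree_linear_power[of "1::complex" t] by (metis degree_smult_le)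
  have "(\<Sum>b\<in>{0<..t}. coeff_xy (C_poly p t) 0 b) = (\<Sum>b\<in>{0<..t}. coeff f b)"
    by (simp add: coeff_xy_def f[symmetric] poly_0_coeff_0)
  also have "\<dots> = (\<Sum>b\<le>t. coeff f b) - coeff f 0"
  proof -
    have "{..t} = insert 0 {0<..t}" by auto
    then show ?thesis by simp
  qed
  also have "(\<Sum>b\<le>t. coeff f b) = poly f 1"
    using poly_altdef[of f 1] deg by (simp add: sum.mono_neutral_left[of "{..t}" "{..degree f}"] coeff_eq_0)
  also have "poly f 1 - coeff f 0 = 2 * c ^ t * 2 ^ t - 2 * c ^ t"
    by (simp add: f_def poly_0_coeff_0[symmetric])
  also have "\<dots> = c ^ t * (2 ^ (t + 1) - 2)" by (simp add: algebra_simps)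
  also have "c ^ t = ((of_nat p + 1) / 3) ^ (2 * t)" by (simp only: c_def power_mult)
  finally show ?thesis .
qed

lemma card_filter_eq_sum: "finite X \<Longrightarrow> card {z \<in> X. Pr z} = (\<Sum>z\<in>X. of_bool (Pr z))"
  by (simp add: of_bool_def sum.If_cases Int_def)

section \<open>Collecting the multiplicities\<close>

context cubic_jacobi
begin

text \<open>The terms come from the exceptional part and then from the first, second and third
  vectors of the blocks. The guard on \<open>j\<close> excludes large \<open>j\<close>, for which
  \<open>2 * t + \<delta> - j\<close> would be truncated to 0.\<close>

lemma card_block_exp:
  assumes \<mu>: "\<And>r. 0 < r \<Longrightarrow> r < k \<Longrightarrow> \<mu> r \<le> t"
  defines "c \<equiv> \<lambda>j. card {r. 0 < r \<and> r < k \<and> \<mu> r = j}"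
  shows "card {z \<in> {..<k} \<times> {..<3}. block_exp \<mu> z = j} =
    2 * of_bool (j = 0) + of_bool (j = t + \<delta>) + c j + (k - 1) * of_bool (j = t) +
    (if t + \<delta> \<le> j \<and> j \<le> 2 * t + \<delta> then c (2 * t + \<delta> - j) else 0)"
proof -
  let ?K = "{0<..<k}"
  have c: "c i = (\<Sum>r\<in>?K. of_bool (\<mu> r = i))" for i
  proof -
    have "{r. 0 < r \<and> r < k \<and> \<mu> r = i} = {r \<in> ?K. \<mu> r = i}" by auto
    then show ?thesis unfolding c_def by (simp only: card_filter_eq_sum[OF finite_greaterThanLessThan])
  qed
  have three: "(\<Sum>i<3. f i) = f 0 + f 1 + f (2::nat)" for f :: "nat \<Rightarrow> nat"
    by (simp add: eval_nat_numeral)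
  have "card {z \<in> {..<k} \<times> {..<3}. block_exp \<mu> z = j} = (\<Sum>z\<in>{..<k} \<times> {..<3}. of_bool (block_exp \<mu> z = j))"
    by (rule card_filter_eq_sum) simp
  also have "\<dots> = (\<Sum>r<k. \<Sum>i<3. of_bool (block_exp \<mu> (r, i) = j))"
    by (subst sum.cartesian_product) (rule sum.cong, auto)
  also have "\<dots> = (\<Sum>r<k. of_bool (block_exp \<mu> (r, 0) = j) + of_bool (block_exp \<mu> (r, 1) = j) + of_bool (block_exp \<mu> (r, 2) = j))"
    unfolding three ..
  also have "\<dots> = (\<Sum>r\<in>insert 0 ?K. of_bool (block_exp \<mu> (r, 0) = j) + of_bool (block_exp \<mu> (r, 1) = j) + of_bool (block_exp \<mu> (r, 2) = j))"
    by (rule sum.cong) (use k_gt_1 in auto)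
  also have "(\<Sum>r\<in>insert 0 ?K. of_bool (block_exp \<mu> (r, 0) = j) + of_bool (block_exp \<mu> (r, 1) = j) + of_bool (block_exp \<mu> (r, 2) = j)) =
      (2 * of_bool (j = 0) + of_bool (j = t + \<delta>)) +
      (\<Sum>r\<in>?K. of_bool (\<mu> r = j) + of_bool (t = j) + of_bool (2 * t + \<delta> - \<mu> r = j) :: nat)"
    by (subst sum.insert) (auto simp: block_exp_def intro!: sum.cong)
  also have "(\<Sum>r\<in>?K. of_bool (\<mu> r = j) + of_bool (t = j) + of_bool (2 * t + \<delta> - \<mu> r = j) :: nat) =
      c j + (k - 1) * of_bool (j = t) + (\<Sum>r\<in>?K. of_bool (2 * t + \<delta> - \<mu> r = j))"
    by (simp add: sum.distrib c eq_commute[of t])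
  also have "(\<Sum>r\<in>?K. of_bool (2 * t + \<delta> - \<mu> r = j) :: nat) = (if t + \<delta> \<le> j \<and> j \<le> 2 * t + \<delta> then c (2 * t + \<delta> - j) else 0)"
  proof -
    have "2 * t + \<delta> - \<mu> r = j \<longleftrightarrow> (t + \<delta> \<le> j \<and> j \<le> 2 * t + \<delta>) \<and> \<mu> r = 2 * t + \<delta> - j" if "r \<in> ?K" for r
      using \<mu>[of r] that by auto
    then have "(\<Sum>r\<in>?K. of_bool (2 * t + \<delta> - \<mu> r = j) :: nat) =
       (\<Sum>r\<in>?K. of_bool ((t + \<delta> \<le> j \<and> j \<le> 2 * t + \<delta>) \<and> \<mu> r = 2 * t + \<delta> - j))" by (intro sum.cong refl) (simp only:)
    then show ?thesis unfolding c
      by (cases "t + \<delta> \<le> j \<and> j \<le> 2 * t + \<delta>") (simp_all only: simp_thms if_True if_False of_bool_eq sum.neutral_const)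
  qed
  finally show ?thesis by (simp only: add.assoc)
qed

lemma rep_bounds:
  assumes "0 < r" "r < k"
  shows "rep r mod k = r" "has_val (J (rep r) k) (A (rep r)) \<and> A (rep r) \<le> t"
    "has_val (J (rep r) (2 * k)) (B (rep r)) \<and> B (rep r) \<le> t"
  using rep[OF assms] has_val_AB[of "rep r"] by (auto simp: leading_def gen_def)

end

text \<open>The difference of the cumulative counts for j and j + 1; the extra 1, which stands for a
  zero diagonal entry, cancels.\<close>

lemma card_multiplicity_eq:
  fixes d :: "'b::finite \<Rightarrow> int" and ev :: "'c \<Rightarrow> nat"
  assumes p: "prime p" and X: "finite X"
    and eq: "\<And>m. card {i. int p ^ m dvd d i} = card {z \<in> X. m \<le> ev z} + 1"
  shows "card {i. d i \<noteq> 0 \<and> multiplicity (int p) (d i) = j} = card {z \<in> X. ev z = j}"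
proof -
  have nu: "\<not> is_unit (int p)" using p not_prime_unit[of "int p"] by auto
  have pow: "int p ^ m dvd x \<longleftrightarrow> x = 0 \<or> m \<le> multiplicity (int p) x" for m x
  proof (cases "x = 0")
    case False
    then show ?thesis using multiplicity_geI[OF False nu] multiplicity_dvd'[of m "int p" x] by blast
  qed simp
  have e1: "{i. int p ^ j dvd d i} = {i. int p ^ Suc j dvd d i} \<union> {i. d i \<noteq> 0 \<and> multiplicity (int p) (d i) = j}"
    unfolding pow by auto
  have e2: "card ({i. int p ^ Suc j dvd d i} \<union> {i. d i \<noteq> 0 \<and> multiplicity (int p) (d i) = j}) =
    card {i. int p ^ Suc j dvd d i} + card {i. d i \<noteq> 0 \<and> multiplicity (int p) (d i) = j}"
    by (rule card_Un_disjoint) (auto simp: pow simp del: power_Suc)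
  have e3: "{z \<in> X. j \<le> ev z} = {z \<in> X. Suc j \<le> ev z} \<union> {z \<in> X. ev z = j}" by auto
  have e4: "card ({z \<in> X. Suc j \<le> ev z} \<union> {z \<in> X. ev z = j}) = card {z \<in> X. Suc j \<le> ev z} + card {z \<in> X. ev z = j}"
    by (rule card_Un_disjoint) (use X in auto)
  show ?thesis using eq[of j] eq[of "Suc j"] unfolding e1 e2 e3 e4 by linarith
qed

theorem theorem2:
  fixes p t q k \<delta> :: nat
    and S :: "'a::{field,finite} set"
    and e :: "nat \<Rightarrow> nat"
  assumes "prime p" and "[p = 2] (mod 3)" and "t \<ge> 1" and "(p, t) \<noteq> (2, 1)"
    and "q = p ^ (2 * t)" and "k = (q - 1) div 3"
    and "CARD('a) = q"
    and "subgroup S units_group" and "card S = k"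
    and "L = regular_laplacian k (cayley_adj S)"
    and "CARD('f::{field,finite}) = p"
    and "e 0 = p_rank TYPE('f) L"
    and "\<forall>j>0. e j = elementary_divisor_multiplicity p (critical_group L) j"
    and "\<delta> = (if p = 2 then 1 else 0)"
  shows
    "(e 0 = e (2 * t + \<delta>) + 2 \<and>
      real (e 0) = ((real p + 1) / 3) ^ (2 * t) * (2 ^ (t + 1) - 2)) \<and>
     ((\<forall>a<t. of_nat (e a) = (\<Sum>b\<in>{a<..t}. coeff_xy (C_poly p t) a b)) \<and>
      (\<forall>a. 0 < a \<and> a < t \<longrightarrow> e a = e (2 * t + \<delta> - a))) \<and>
     int (e (t + \<delta>)) =
       (int k + 2 - (\<Sum>j<t. int (e j))) + (1 - int \<delta>) * (2 * int k - (\<Sum>j<t. int (e j))) \<and>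
     int (e t) =
       (1 - int \<delta>) * (int k + 2 - (\<Sum>j<t. int (e j))) + (2 * int k - (\<Sum>j<t. int (e j))) \<and>
     (\<forall>a>2 * t + \<delta>. e a = 0)"
proof -
  define n where "n = 3 * k"
  have p: "prime p" and p3: "[p = 2] (mod 3)" by fact+
  have t0: "t > 0" using assms(3) by simp
  have "[q = 1] (mod 3)"
  proof -
    have "[p * p = 2 * 2] (mod 3)" using p3 p3 by (rule cong_mult)
    then have "[p * p = 1] (mod 3)" by (simp add: cong_def)
    then have "[(p * p) ^ t = 1 ^ t] (mod 3)" by (rule cong_pow)
    then show ?thesis by (simp add: assms(5) power_mult power2_eq_square)
  qed
  then have "q mod 3 = 1" by (simp add: cong_def)
  then have qn: "q = Suc n" unfolding n_def assms(6) by presburger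
  \<comment> \<open>This gives k > 1; the smaller value q = 4 is the excluded pair (2, 1).\<close>
  have "q \<ge> 9"
  proof (cases "p = 2")
    case True
    then have "t \<ge> 2" using assms(3,4) by auto
    then have "(2::nat) ^ 4 \<le> 2 ^ (2 * t)" by (intro power_increasing) auto
    then show ?thesis using True assms(5) by simp
  next
    case False
    then have "p \<ge> 3" using prime_ge_2_nat[OF p] by simp
    then have "3 ^ 2 \<le> p ^ 2" by (intro power_mono) auto
    also have "\<dots> \<le> p ^ (2 * t)" using t0 prime_gt_0_nat[OF p] by (intro power_increasing) auto
    finally show ?thesis using assms(5) by simp
  qed
  then have k1: "k > 1" using qn n_def by simp
  obtain R and \<nu> :: "complex \<Rightarrow> 'a" and T where lift: "teichmueller_lift p R \<nu> T"
    using teichmueller_lift_exists[OF p, where 'a = 'a] assms(5,7) by metis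
  interpret teichmueller_lift p R \<nu> T by (rule lift)
  interpret C: cubic_jacobi p R \<nu> T n k t
  proof unfold_locales
    show "CARD('a) = Suc n" using assms(7) qn by simp
    show "n = 3 * k" "k > 1" "[p = 2] (mod 3)" "t > 0" by (fact n_def k1 p3 t0)+
    show "Suc n = p ^ (2 * t)" using qn assms(5) by simp
  qed
  have dl: "C.\<delta> = \<delta>" unfolding C.\<delta>_def assms(14) ..
  have S: "S = {z. z ^ k = 1}" by (rule subgroup_units_eq_roots_of_unity[OF assms(8,9)]) (use k1 in simp)
  obtain U V :: "((int, 'a) vec, 'a) vec" and d
    where UV: "invertible U" "invertible V" "U ** L ** V = (\<chi> i j. if i = j then d i else 0)"
    by (rule int_matrix_diagonal_form)
  define \<mu> where "\<mu> r = min (C.A (C.rep r)) (C.B (C.rep r))" for r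
  define X where "X = {..<k} \<times> {..<3::nat}"
  have ev: "card {i. int p ^ m dvd d i} = card {z \<in> X. m \<le> C.block_exp \<mu> z} + 1" for m
    unfolding X_def \<mu>_def
    by (rule C.laplacian_elementary_divisors[OF S UV[unfolded assms(10)] C.rep_bounds])
  define E where "E j = card {z \<in> X. C.block_exp \<mu> z = j}" for j
  have eE0: "card {i. d i \<noteq> 0 \<and> multiplicity (int p) (d i) = j} = E j" for j
    unfolding E_def by (rule card_multiplicity_eq[OF p _ ev]) (simp add: X_def)
  have eE: "e j = E j" for j
  proof (cases "j = 0")
    case True
    have pf: "of_nat p = (0::'f)" by (rule of_nat_prime_eq_0[of p 1]) (simp add: assms(11))
    have nu: "\<not> is_unit (int p)" using p not_prime_unit[of "int p"] by auto
    have "e 0 = card {i. \<not> int p dvd d i}" unfolding assms(12) by (rule p_rank_diagonal[OF p pf UV])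
    also have "{i. \<not> int p dvd d i} = {i. d i \<noteq> 0 \<and> multiplicity (int p) (d i) = 0}"
      using nu by (auto simp: not_dvd_imp_multiplicity_0 multiplicity_eq_zero_iff)
    finally show ?thesis using True eE0 by simp
  next
    case False
    then have "e j = elementary_divisor_multiplicity p (critical_group L) j" using assms(13) by simp
    also have "\<dots> = E j" using elementary_divisor_multiplicity_critical_group[OF p _ UV] False eE0 by simp
    finally show ?thesis .
  qed
  have \<mu>t: "\<mu> r \<le> t" if "0 < r" "r < k" for r
    using C.rep_bounds[OF that] by (auto simp: \<mu>_def min_def)
  define c where "c j = card {r. 0 < r \<and> r < k \<and> \<mu> r = j}" for j
  have E: "e j = 2 * of_bool (j = 0) + of_bool (j = t + \<delta>) + c j + (k - 1) * of_bool (j = t) +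
    (if t + \<delta> \<le> j \<and> j \<le> 2 * t + \<delta> then c (2 * t + \<delta> - j) else 0)" for j
    unfolding eE E_def X_def c_def using C.card_block_exp[of \<mu> j, OF \<mu>t] by (simp only: dl)
  have c0: "c j = 0" if "j > t" for j
  proof -
    have "\<not> (0 < r \<and> r < k \<and> \<mu> r = j)" for r using \<mu>t[of r] that by auto
    then show ?thesis by (simp add: c_def)
  qed
  have csum: "(\<Sum>j\<le>t. c j) = k - 1"
  proof -
    have "(\<Sum>j\<le>t. c j) = card (\<Union>j\<in>{..t}. {r. 0 < r \<and> r < k \<and> \<mu> r = j})"
      unfolding c_def by (rule card_UN_disjoint[symmetric]) auto
    also have "(\<Union>j\<in>{..t}. {r. 0 < r \<and> r < k \<and> \<mu> r = j}) = {0<..<k}" using \<mu>t by auto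
    finally show ?thesis by simp
  qed
  have small: "e j = 2 * of_bool (j = 0) + c j" if "j < t" for j using that by (simp add: E)
  \<comment> \<open>\<open>c t\<close> counts the blocks with both valuations equal to t. In terms
    of it, k + 2 minus the sum is 1 + c t, and 2 k minus the sum is k - 1 + c t; these are the two
    expressions in items 3 and 4.\<close>
  have esum: "(\<Sum>j<t. int (e j)) = int k + 1 - int (c t)"
  proof -
    have "(\<Sum>j<t. e j) = (\<Sum>j<t. 2 * of_bool (j = 0) + c j)" by (intro sum.cong) (auto simp: small)
    also have "\<dots> = 2 + (\<Sum>j<t. c j)"
    proof -
      have "(\<Sum>j<t. 2 * of_bool (j = (0::nat)) :: nat) = (\<Sum>j<t. if j = 0 then 2 else 0)" by (intro sum.cong) auto
      then show ?thesis using t0 by (simp add: sum.distrib)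
    qed
    finally have "(\<Sum>j<t. e j) + c t = k + 1"
      using csum k1 by (simp add: lessThan_Suc_atMost[symmetric])
    then show ?thesis by (simp flip: of_nat_sum)
  qed
  have coeff: "of_nat (e a) = (\<Sum>b\<in>{a<..t}. coeff_xy (C_poly p t) a b)" if "a < t" for a
  proof -
    have "c a = 2 * card {j \<in> C.gen. C.A j = a \<and> a < C.B j \<and> C.B j \<le> t}"
      unfolding c_def \<mu>_def by (rule C.card_blocks[OF that])
    then show ?thesis using C.sum_coeff_C_poly[OF that] small[OF that] by simp
  qed
  have "of_nat (e 0) = (complex_of_real (((real p + 1) / 3) ^ (2 * t) * (2 ^ (t + 1) - 2)))"
    using coeff[OF t0] sum_coeff_C_poly_0[OF t0, of p] by simp
  then have e0: "real (e 0) = ((real p + 1) / 3) ^ (2 * t) * (2 ^ (t + 1) - 2)"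
    by (metis of_real_eq_iff of_real_of_nat_eq)
  have last: "e 0 = e (2 * t + \<delta>) + 2" using t0 c0[of "2 * t + \<delta>"] by (simp add: E)
  have sym: "e a = e (2 * t + \<delta> - a)" if "0 < a" "a < t" for a
    using that c0[of "2 * t + \<delta> - a"] by (auto simp: E)
  \<comment> \<open>For \<delta> = 0 the exponents t and t + \<delta> coincide and their
    contributions add up; for \<delta> = 1 they separate.\<close>
  have "\<delta> = 0 \<or> \<delta> = 1" using assms(14) by simp
  then have mid: "int (e (t + \<delta>)) = (int k + 2 - (\<Sum>j<t. int (e j))) + (1 - int \<delta>) * (2 * int k - (\<Sum>j<t. int (e j)))"
    "int (e t) = (1 - int \<delta>) * (int k + 2 - (\<Sum>j<t. int (e j))) + (2 * int k - (\<Sum>j<t. int (e j)))"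
    unfolding esum using t0 k1 c0[of "t + 1"] by (auto simp: E)
  have big: "e a = 0" if "a > 2 * t + \<delta>" for a using that t0 c0[of a] by (simp add: E)
  show ?thesis using last e0 coeff sym mid big by blast
qed

thm_deps theorem2

end
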